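(* Let $Q$ be a connected quiver of finite mutation type with at least three vertices, on the vertex set $\{1,\dots,n\}$. Let $S$ be a subquiver of $Q$ which is either a double edge (two vertices joined by an edge of weight $2$) or a non-oriented cycle, and let $u\in(\mathbb{Z}/2\mathbb{Z})^n$ be the vector with coordinate $1$ at the vertices of $S$ and $0$ elsewhere. Then $u$ is a radical vector of $\bar B^Q$. Furthermore, if $Q$ comes from the triangulation of a surface or $Q$ is mutation-equivalent to $X_6$ or $X_7$, then: (i) $\dim(\bar V^Q_0/\bar V^Q_{00})\le 1$; (ii) if $Q'$ is mutation-equivalent to $Q$, then $\dim \bar V^Q_{00}=\dim \bar V^{Q'}_{00}$.
   Context: A quiver is a finite directed graph with no loops and no 2-cycles, each edge carrying a positive integer weight (weight 1: single edge, weight 2: double edge); simply-laced means all edges single. A subquiver is an induced subgraph with the same weights. For $Q$ on $\{1,\dots,n\}$, $B^Q$ is the skew-symmetric integer matrix with $B_{ij}=w$, $B_{ji}=-w$ for an edge $i\to j$ of weight $w$, and $0$ for non-adjacent $i,j$. Mutation at $k$: $B'_{ij}=-B_{ij}$ if $k\in\{i,j\}$, else $B'_{ij}=B_{ij}+\mathrm{sgn}(B_{ik})[B_{ik}B_{kj}]_+$ with $[x]_+=\max\{x,0\}$; mutation-equivalence is generated by mutations (and isomorphism); finite mutation type means finite mutation class. A cycle is a subquiver whose vertices can be labelled by $\mathbb{Z}/m\mathbb{Z}$ so that its edges are exactly $\{i,i+1\}$; it is oriented if all edges go $i\to i+1$ for a suitable labelling, non-oriented otherwise. $\bar B^Q$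 is $B^Q$ with entries reduced mod $2$, a matrix over the field $\mathbb{Z}/2\mathbb{Z}$; $\bar V^Q_0$ is its space of radical vectors $\{u\in(\mathbb{Z}/2\mathbb{Z})^n:\bar B^Qu=0\}$. For $u$, $\mathrm{supp}_Q(u)$ is the subquiver on vertices with non-zero coordinate. A basic radical vector is a $u\in\bar V^Q_0$ such that $\mathrm{supp}_Q(u)$ has exactly two vertices or is a cycle (oriented or not); $\bar V^Q_{00}$ is the subspace spanned by the basic radical vectors (zero if there are none). $X_6$: vertices $c,a,b,p,q,d$ with edges $c\to a$ (weight 1), $a\to b$ (weight 2), $b\to c$ (weight 1), $c\to p$ (weight 1), $p\to q$ (weight 2), $q\to c$ (weight 1), and a single edge between $c$ and $d$ (either orientation). $X_7$: vertices $c,a,b,p,q,d,e$ with edges $c\to a,\ a\to b\,(2),\ b\to c,\ c\to p,\ p\to q\,(2),\ q\to c,\ c\to d,\ d\to e\,(2),\ e\to c$ (unmarked weights 1). "$Q$ comes from the triangulation of a surface" is in the sense of Fomin–Shapiro–Thurston: $Q$ is the quiver associated with a (tagged) ideal triangulation of a bordered oriented surface with marked points (equivalently, $Q$ is block-decomposable). *)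

theory Defs
  imports "HOL-Analysis.Analysis" "HOL-Library.Z2"
begin

section \<open>Quivers\<close>

text \<open>
  A quiver is given by its weight function: \<open>Q i j\<close> is the weight of the edge \<open>i \<rightarrow> j\<close>,
  and \<open>0\<close> if there is no such edge. A quiver on \<open>{1,\<dots>,n}\<close> is a quiver on a finite type
  with \<open>n\<close> elements.
\<close>

type_synonym 'v quiver = "'v \<Rightarrow> 'v \<Rightarrow> nat"

definition is_quiver :: "'v quiver \<Rightarrow> bool" where
  "is_quiver Q \<longleftrightarrow> (\<forall>i. Q i i = 0) \<and> (\<forall>i j. Q i j = 0 \<or> Q j i = 0)"

definition quiver_matrix :: "'v quiver \<Rightarrow> 'v \<Rightarrow> 'v \<Rightarrow> int" where
  "quiver_matrix Q i j = int (Q i j) - int (Q j i)"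

definition adjacent :: "'v quiver \<Rightarrow> 'v \<Rightarrow> 'v \<Rightarrow> bool" where
  "adjacent Q i j \<longleftrightarrow> Q i j > 0 \<or> Q j i > 0"

definition connected_quiver :: "'v quiver \<Rightarrow> bool" where
  "connected_quiver Q \<longleftrightarrow> (\<forall>i j. (adjacent Q)\<^sup>*\<^sup>* i j)"

subsection \<open>Mutation\<close>

definition mutate_matrix :: "'v \<Rightarrow> ('v \<Rightarrow> 'v \<Rightarrow> int) \<Rightarrow> 'v \<Rightarrow> 'v \<Rightarrow> int" where
  "mutate_matrix k B i j =
     (if k = i \<or> k = j then - B i j
      else B i j + sgn (B i k) * max 0 (B i k * B k j))"

text \<open>The quiver of a skew-symmetric matrix: \<open>nat\<close> sends negative entries to \<open>0\<close>.\<close>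

definition mutate :: "'v \<Rightarrow> 'v quiver \<Rightarrow> 'v quiver" where
  "mutate k Q i j = nat (mutate_matrix k (quiver_matrix Q) i j)"

definition mutation_step :: "'v quiver \<Rightarrow> 'v quiver \<Rightarrow> bool" where
  "mutation_step Q R \<longleftrightarrow> is_quiver Q \<and> (\<exists>k. R = mutate k Q)"

definition isomorphic_quivers :: "'v quiver \<Rightarrow> 'w quiver \<Rightarrow> bool" where
  "isomorphic_quivers Q R \<longleftrightarrow> (\<exists>f. bij f \<and> (\<forall>i j. R (f i) (f j) = Q i j))"

text \<open>
  Mutation commutes with relabelling of vertices, so one relabelling at the end suffices. This
  also allows the two quivers to have different vertex types.
\<close>

definition mutation_equivalent :: "'v quiver \<Rightarrow> 'w quiver \<Rightarrow> bool" where
  "mutation_equivalent Q R \<longleftrightarrow> (\<exists>P. equivclp mutation_step Q P \<and> isomorphic_quivers P R)"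

text \<open>
  The mutation class is represented on one finite vertex type; since every isomorphism class then
  has only finitely many labelled representatives, this is finiteness up to isomorphism.
\<close>

definition finite_mutation_type :: "'v::finite quiver \<Rightarrow> bool" where
  "finite_mutation_type Q \<longleftrightarrow> finite {R :: 'v quiver. mutation_equivalent Q R}"

lemma mutate_matrix_skew:
  assumes "\<And>i j. B i j = - B j i"
  shows "mutate_matrix k B i j = - mutate_matrix k B j i"
proof -
  have "sgn (B i k) * max 0 (B i k * B k j) = - (sgn (B j k) * max 0 (B j k * B k i))"
    using assms[of i k] assms[of k j]
    by (auto simp: max_def sgn_if mult.commute mult_le_0_iff zero_le_mult_iff)
  then show ?thesis
    using assms[of i j] by (auto simp: mutate_matrix_def)
qed

lemma is_quiver_mutate: "is_quiver (mutate k Q)"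
proof -
  have skew: "quiver_matrix Q i j = - quiver_matrix Q j i" for i j
    by (simp add: quiver_matrix_def)
  show ?thesis
    unfolding is_quiver_def mutate_def
  proof (intro conjI allI)
    show "nat (mutate_matrix k (quiver_matrix Q) i i) = 0" for i
      using mutate_matrix_skew[of "quiver_matrix Q" k i i] skew by fastforce
    show "nat (mutate_matrix k (quiver_matrix Q) i j) = 0 \<or>
          nat (mutate_matrix k (quiver_matrix Q) j i) = 0" for i j
      using mutate_matrix_skew[of "quiver_matrix Q" k i j] skew by fastforce
  qed
qed

lemma quiver_matrix_mutate:
  "quiver_matrix (mutate k Q) = mutate_matrix k (quiver_matrix Q)"
proof (intro ext)
  fix i j
  have "mutate_matrix k (quiver_matrix Q) i j = - mutate_matrix k (quiver_matrix Q) j i"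
    by (rule mutate_matrix_skew) (simp add: quiver_matrix_def)
  then show "quiver_matrix (mutate k Q) i j = mutate_matrix k (quiver_matrix Q) i j"
    by (simp add: quiver_matrix_def[of "mutate k Q"] mutate_def)
qed

subsection \<open>Double edges and cycles\<close>

text \<open>Subquivers are induced, hence are given by their vertex sets.\<close>

definition double_edge :: "'v quiver \<Rightarrow> 'v set \<Rightarrow> bool" where
  "double_edge Q S \<longleftrightarrow> (\<exists>i j. S = {i, j} \<and> Q i j = 2)"

text \<open>
  A labelling of \<open>S\<close> by \<open>{0,\<dots>,m-1}\<close>, standing for the integers mod \<open>m\<close>. As there are no loops
  and no 2-cycles, a cycle has at least three vertices; a single edge (\<open>m = 2\<close>) is not a cycle.
\<close>

definition cycle_labelling :: "'v quiver \<Rightarrow> 'v set \<Rightarrow> nat \<Rightarrow> (nat \<Rightarrow> 'v) \<Rightarrow> bool" where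
  "cycle_labelling Q S m f \<longleftrightarrow> m \<ge> 3 \<and> bij_betw f {..<m} S \<and>
     (\<forall>x<m. \<forall>y<m. adjacent Q (f x) (f y) \<longleftrightarrow> y = Suc x mod m \<or> x = Suc y mod m)"

definition is_cycle :: "'v quiver \<Rightarrow> 'v set \<Rightarrow> bool" where
  "is_cycle Q S \<longleftrightarrow> (\<exists>m f. cycle_labelling Q S m f)"

definition oriented_cycle :: "'v quiver \<Rightarrow> 'v set \<Rightarrow> bool" where
  "oriented_cycle Q S \<longleftrightarrow>
     (\<exists>m f. cycle_labelling Q S m f \<and> (\<forall>x<m. Q (f x) (f (Suc x mod m)) > 0))"

definition nonoriented_cycle :: "'v quiver \<Rightarrow> 'v set \<Rightarrow> bool" where
  "nonoriented_cycle Q S \<longleftrightarrow> is_cycle Q S \<and> \<not> oriented_cycle Q S"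

section \<open>Radical vectors mod 2\<close>

definition matrix_mod2 :: "'v::finite quiver \<Rightarrow> bit^'v^'v" where
  "matrix_mod2 Q = (\<chi> i j. of_int (quiver_matrix Q i j))"

definition indicator_vector :: "'v::finite set \<Rightarrow> bit^'v" where
  "indicator_vector S = (\<chi> i. if i \<in> S then 1 else 0)"

definition radical_space :: "'v::finite quiver \<Rightarrow> (bit^'v) set" where
  "radical_space Q = {u. matrix_mod2 Q *v u = 0}"

definition support :: "bit^'v::finite \<Rightarrow> 'v set" where
  "support u = {i. u $ i \<noteq> 0}"

definition basic_radical_vectors :: "'v::finite quiver \<Rightarrow> (bit^'v) set" where
  "basic_radical_vectors Q =
     {u \<in> radical_space Q. card (support u) = 2 \<or> is_cycle Q (support u)}"

definition basic_radical_space :: "'v::finite quiver \<Rightarrow> (bit^'v) set" where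
  "basic_radical_space Q = vec.span (basic_radical_vectors Q)"

subsection \<open>Dimension of a quotient space\<close>

text \<open>
  \<open>basis_modulo V W A\<close> says that the cosets \<open>a + W\<close> for \<open>a \<in> A\<close> are pairwise distinct and form a
  basis of \<open>V / W\<close>: every coset is a linear combination of them in exactly one way.
\<close>

definition basis_modulo ::
  "('k::field^'n) set \<Rightarrow> ('k^'n) set \<Rightarrow> ('k^'n) set \<Rightarrow> bool" where
  "basis_modulo V W A \<longleftrightarrow> finite A \<and> A \<subseteq> V \<and>
     (\<forall>v\<in>V. \<exists>!c. (\<forall>a. a \<notin> A \<longrightarrow> c a = 0) \<and> v - (\<Sum>a\<in>A. c a *s a) \<in> W)"

definition quotient_dim :: "('k::field^'n) set \<Rightarrow> ('k^'n) set \<Rightarrow> nat" where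
  "quotient_dim V W = card (SOME A. basis_modulo V W A)"

lemma basis_modulo_card:
  fixes V W :: "('k::field^'n) set"
  assumes V: "vec.subspace V" and W: "vec.subspace W" and WV: "W \<subseteq> V"
    and A: "basis_modulo V W A"
  shows "vec.dim V = card A + vec.dim W"
proof -
  have finA: "finite A" and AV: "A \<subseteq> V"
    using A by (auto simp: basis_modulo_def)
  have mod0: "c a = 0" if c: "(\<Sum>a\<in>A. c a *s a) \<in> W" and a: "a \<in> A" for c a
  proof -
    define d where "d = (\<lambda>a. if a \<in> A then c a else 0)"
    define P where
      "P c \<longleftrightarrow> (\<forall>a. a \<notin> A \<longrightarrow> c a = 0) \<and> 0 - (\<Sum>a\<in>A. c a *s a) \<in> W" for c :: "'k^'n \<Rightarrow> 'k"
    have "(\<Sum>a\<in>A. d a *s a) = (\<Sum>a\<in>A. c a *s a)"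
      by (rule sum.cong) (auto simp: d_def)
    then have "P d"
      using c vec.subspace_neg[OF W] by (auto simp: d_def P_def)
    moreover have "P (\<lambda>_. 0)"
      using vec.subspace_0[OF W] by (simp add: P_def)
    moreover have "\<exists>!c. P c"
      using A vec.subspace_0[OF V] unfolding basis_modulo_def P_def by blast
    ultimately have "d = (\<lambda>_. 0)" by blast
    then show ?thesis using a by (metis d_def)
  qed
  obtain C where C: "C \<subseteq> W" "vec.independent C" "W \<subseteq> vec.span C" "card C = vec.dim W"
    using vec.basis_exists by blast
  have finC: "finite C" using C(2) vec.finiteI_independent by blast
  have disj: "A \<inter> C = {}"
  proof (rule ccontr)
    assume "A \<inter> C \<noteq> {}"
    then obtain x where x: "x \<in> A" "x \<in> C" by blast
    have "(\<Sum>a\<in>A. (if a = x then 1 else 0) *s a) = (\<Sum>a\<in>A. if a = x then x else 0)"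
      by (rule sum.cong) auto
    also have "\<dots> = x" using finA x by simp
    finally show False using mod0[of "\<lambda>a. if a = x then 1 else 0" x] x C(1) by auto
  qed
  have ind: "vec.independent (A \<union> C)"
  proof (rule vec.independent_if_scalars_zero)
    show "finite (A \<union> C)" using finA finC by simp
    fix f x assume f: "(\<Sum>x\<in>A \<union> C. f x *s x) = 0" and x: "x \<in> A \<union> C"
    have eq: "(\<Sum>x\<in>A. f x *s x) + (\<Sum>x\<in>C. f x *s x) = 0"
      using f sum.union_disjoint[OF finA finC disj] by metis
    have CW: "(\<Sum>x\<in>C. f x *s x) \<in> W"
      using C(1) by (intro vec.subspace_sum[OF W] vec.subspace_scale[OF W]) auto
    have "(\<Sum>x\<in>A. f x *s x) = - (\<Sum>x\<in>C. f x *s x)"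
      using eq by (simp add: eq_neg_iff_add_eq_0)
    then have "(\<Sum>x\<in>A. f x *s x) \<in> W"
      using vec.subspace_neg[OF W CW] by simp
    then have fA: "f a = 0" if "a \<in> A" for a using mod0 that by blast
    then have "(\<Sum>x\<in>C. f x *s x) = 0" using eq by simp
    then have "f a = 0" if "a \<in> C" for a
      using vec.independentD[OF C(2) finC order_refl] that by blast
    then show "f x = 0" using fA x by blast
  qed
  have "V \<subseteq> vec.span (A \<union> C)"
  proof
    fix v assume "v \<in> V"
    then obtain c where c: "v - (\<Sum>a\<in>A. c a *s a) \<in> W"
      using A unfolding basis_modulo_def by blast
    have "v - (\<Sum>a\<in>A. c a *s a) \<in> vec.span (A \<union> C)"
      using c C(3) vec.span_mono[of C "A \<union> C"] by blast
    moreover have "(\<Sum>a\<in>A. c a *s a) \<in> vec.span (A \<union> C)"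
      by (intro vec.span_sum vec.span_scale vec.span_base) auto
    ultimately show "v \<in> vec.span (A \<union> C)"
      using vec.span_add by fastforce
  qed
  then have "vec.dim V = card (A \<union> C)"
    using ind AV C(1) WV by (intro vec.basis_card_eq_dim[symmetric]) auto
  then show ?thesis using card_Un_disjoint[OF finA finC disj] C(4) by simp
qed

lemma basis_modulo_exists:
  fixes V W :: "('k::field^'n) set"
  assumes V: "vec.subspace V" and W: "vec.subspace W" and WV: "W \<subseteq> V"
  shows "\<exists>A. basis_modulo V W A"
proof -
  obtain C where C: "C \<subseteq> W" "vec.independent C" "W \<subseteq> vec.span C" "card C = vec.dim W"
    using vec.basis_exists by blast
  obtain B where B: "C \<subseteq> B" "B \<subseteq> V" "vec.independent B" "V \<subseteq> vec.span B"
    using vec.maximal_independent_subset_extend[of C V] C(1,2) WV by blast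
  have finB: "finite B" using B(3) vec.finiteI_independent by blast
  have finC: "finite C" using finB B(1) finite_subset by blast
  have spanC: "vec.span C = W"
    using C(1,3) W vec.span_minimal by blast
  define A where "A = B - C"
  have finA: "finite A" and BA: "B = A \<union> C" and disj: "A \<inter> C = {}"
    using finB B(1) by (auto simp: A_def)
  have "\<exists>!c. (\<forall>a. a \<notin> A \<longrightarrow> c a = 0) \<and> v - (\<Sum>a\<in>A. c a *s a) \<in> W" if v: "v \<in> V" for v
  proof (rule ex_ex1I)
    have "v \<in> vec.span B" using v B(4) by blast
    then obtain u where u: "v = (\<Sum>b\<in>B. u b *s b)"
      using vec.span_finite[OF finB] by auto
    define c where "c = (\<lambda>a. if a \<in> A then u a else 0)"
    have "(\<Sum>a\<in>A. c a *s a) = (\<Sum>a\<in>A. u a *s a)"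
      by (rule sum.cong) (auto simp: c_def)
    then have "v - (\<Sum>a\<in>A. c a *s a) = (\<Sum>b\<in>C. u b *s b)"
      using u sum.union_disjoint[OF finA finC disj] BA by (metis add_diff_cancel_left')
    also have "\<dots> \<in> W"
      using C(1) by (intro vec.subspace_sum[OF W] vec.subspace_scale[OF W]) auto
    finally show "\<exists>c. (\<forall>a. a \<notin> A \<longrightarrow> c a = 0) \<and> v - (\<Sum>a\<in>A. c a *s a) \<in> W"
      by (intro exI[of _ c]) (simp add: c_def)
  next
    fix c d
    assume c: "(\<forall>a. a \<notin> A \<longrightarrow> c a = 0) \<and> v - (\<Sum>a\<in>A. c a *s a) \<in> W"
      and d: "(\<forall>a. a \<notin> A \<longrightarrow> d a = 0) \<and> v - (\<Sum>a\<in>A. d a *s a) \<in> W"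
    have "(v - (\<Sum>a\<in>A. d a *s a)) - (v - (\<Sum>a\<in>A. c a *s a)) \<in> vec.span C"
      using c d vec.subspace_diff[OF W] spanC by blast
    then obtain w where w: "(\<Sum>a\<in>A. c a *s a) - (\<Sum>a\<in>A. d a *s a) = (\<Sum>b\<in>C. w b *s b)"
      using vec.span_finite[OF finC] by auto
    define f where "f = (\<lambda>b. if b \<in> A then c b - d b else - w b)"
    have "(\<Sum>b\<in>A. f b *s b) = (\<Sum>a\<in>A. c a *s a) - (\<Sum>a\<in>A. d a *s a)"
      by (simp add: f_def vec.scale_left_diff_distrib sum_subtractf)
    moreover have "(\<Sum>b\<in>C. f b *s b) = (\<Sum>b\<in>C. - (w b *s b))"
      using disj by (intro sum.cong) (auto simp: f_def)
    ultimately have "(\<Sum>b\<in>B. f b *s b) = 0"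
      using w sum.union_disjoint[OF finA finC disj, of "\<lambda>b. f b *s b"] BA
      by (simp add: sum_negf)
    then have "f a = 0" if "a \<in> A" for a
      using vec.independentD[OF B(3) finB order_refl] that BA by blast
    then have "c a = d a" for a
      using c d by (cases "a \<in> A") (auto simp: f_def)
    then show "c = d" by blast
  qed
  then have "basis_modulo V W A"
    using finA B(2) by (auto simp: basis_modulo_def A_def)
  then show ?thesis by blast
qed

lemma quotient_dim_eq:
  fixes V W :: "('k::field^'n) set"
  assumes "vec.subspace V" and "vec.subspace W" and "W \<subseteq> V"
  shows "quotient_dim V W = vec.dim V - vec.dim W"
  using basis_modulo_card[OF assms someI_ex[OF basis_modulo_exists[OF assms]]]
  by (simp add: quotient_dim_def)

section \<open>The exceptional quivers\<close>

definition quiver_of_edges :: "(('v \<times> 'v) \<times> nat) list \<Rightarrow> 'v quiver" where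
  "quiver_of_edges es i j = (case map_of es (i, j) of None \<Rightarrow> 0 | Some w \<Rightarrow> w)"

datatype X6_vertex = C6 | A6 | B6 | P6 | Q6 | D6

text \<open>The argument chooses the orientation of the edge between \<open>c\<close> and \<open>d\<close>.\<close>

definition X6 :: "bool \<Rightarrow> X6_vertex quiver" where
  "X6 outward = quiver_of_edges
     [((C6, A6), 1), ((A6, B6), 2), ((B6, C6), 1),
      ((C6, P6), 1), ((P6, Q6), 2), ((Q6, C6), 1),
      (if outward then (C6, D6) else (D6, C6), 1)]"

datatype X7_vertex = C7 | A7 | B7 | P7 | Q7 | D7 | E7

definition X7 :: "X7_vertex quiver" where
  "X7 = quiver_of_edges
     [((C7, A7), 1), ((A7, B7), 2), ((B7, C7), 1),
      ((C7, P7), 1), ((P7, Q7), 2), ((Q7, C7), 1),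
      ((C7, D7), 1), ((D7, E7), 2), ((E7, C7), 1)]"

lemma is_quiver_X6: "is_quiver (X6 outward)"
proof -
  have "X6 outward i i = 0" for i
    by (cases i) (simp_all add: X6_def quiver_of_edges_def)
  moreover have "X6 outward i j = 0 \<or> X6 outward j i = 0" for i j
    by (cases i; cases j) (simp_all add: X6_def quiver_of_edges_def)
  ultimately show ?thesis by (simp add: is_quiver_def)
qed

lemma is_quiver_X7: "is_quiver X7"
proof -
  have "X7 i i = 0" for i
    by (cases i) (simp_all add: X7_def quiver_of_edges_def)
  moreover have "X7 i j = 0 \<or> X7 j i = 0" for i j
    by (cases i; cases j) (simp_all add: X7_def quiver_of_edges_def)
  ultimately show ?thesis by (simp add: is_quiver_def)
qed

section \<open>Quivers from triangulated surfaces\<close>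

text \<open>
  An ideal triangulation of a connected bordered oriented surface with marked points is given by
  its list of triangles, each written as the cyclic sequence of its sides in clockwise order. A
  side is either an arc \<open>Inl i\<close>, which occurs exactly twice among all sides, or a boundary
  segment \<open>Inr b\<close>, which occurs at most once. The surface is obtained by gluing the two
  occurrences of each arc, and orientability forces how they are glued. A triangle in which an arc
  occurs twice is self-folded: \<open>(r, r, l)\<close> has radius \<open>r\<close> and enclosing loop \<open>l\<close>.

  Fomin, Shapiro and Thurston define the matrix of a tagged triangulation to be the matrix of an
  associated ideal triangulation, so that tagged triangulations yield the same quivers.
  Of the surfaces which they exclude, the only one with at least three arcs is the sphere with
  three punctures; its quivers have no edges.
\<close>

type_synonym 'v triangle = "('v + nat) \<times> ('v + nat) \<times> ('v + nat)"

fun sides :: "'v triangle \<Rightarrow> ('v + nat) list" where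
  "sides (x, y, z) = [x, y, z]"

definition is_triangulation :: "'v triangle list \<Rightarrow> bool" where
  "is_triangulation T \<longleftrightarrow>
     (\<forall>i. count_list (concat (map sides T)) (Inl i) = 2) \<and>
     (\<forall>b. count_list (concat (map sides T)) (Inr b) \<le> 1) \<and>
     (\<forall>t\<in>set T. \<forall>t'\<in>set T.
        (\<lambda>s s'. s' \<in> set T \<and> set (sides s) \<inter> set (sides s') \<noteq> {})\<^sup>*\<^sup>* t t')"

definition self_folded :: "'v triangle \<Rightarrow> bool" where
  "self_folded t \<longleftrightarrow> \<not> distinct (sides t)"

definition folded_inside :: "'v triangle list \<Rightarrow> ('v + nat) \<Rightarrow> ('v + nat) \<Rightarrow> bool" where
  "folded_inside T r l \<longleftrightarrow> {(r, r, l), (r, l, r), (l, r, r)} \<inter> set T \<noteq> {}"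

text \<open>The map \<open>\<pi>\<^sub>T\<close> of Fomin, Shapiro and Thurston, replacing a radius by its enclosing loop.\<close>

definition fold_map :: "'v triangle list \<Rightarrow> ('v + nat) \<Rightarrow> ('v + nat)" where
  "fold_map T s = (if \<exists>l. folded_inside T s l then THE l. folded_inside T s l else s)"

text \<open>\<open>follows t x y\<close>: in the triangle \<open>t\<close>, the side \<open>y\<close> follows the side \<open>x\<close> clockwise.\<close>

fun follows :: "'v triangle \<Rightarrow> ('v + nat) \<Rightarrow> ('v + nat) \<Rightarrow> bool" where
  "follows (a, b, c) x y \<longleftrightarrow> (x, y) \<in> {(a, b), (b, c), (c, a)}"

definition signed_adjacency :: "'v triangle list \<Rightarrow> 'v \<Rightarrow> 'v \<Rightarrow> int" where
  "signed_adjacency T i j =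
     (\<Sum>t\<leftarrow>filter (\<lambda>t. \<not> self_folded t) T.
        of_bool (follows t (fold_map T (Inl i)) (fold_map T (Inl j)))
      - of_bool (follows t (fold_map T (Inl j)) (fold_map T (Inl i))))"

definition from_triangulation :: "'v quiver \<Rightarrow> bool" where
  "from_triangulation Q \<longleftrightarrow>
     (\<exists>T. is_triangulation T \<and> (\<forall>i j. quiver_matrix Q i j = signed_adjacency T i j))"

end

theory Submission
  imports Defs
begin

section \<open>The radical modulo 2 under mutation\<close>

text \<open>
  Mutation is a congruence of the matrix, so modulo 2 it carries the radical to the radical by an
  explicit involution. A non-oriented cycle shrinks under mutations at its own vertices to a double
  edge, its indicator vector being carried along; and a double edge is radical because the triples
  of weights in a quiver of finite mutation type are very restricted.

  For the second part no flips of triangulations are needed. The dual graph of a triangulation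
  (triangles as vertices, arcs as edges) is a connected multigraph whose edges have the matrix
  modulo 2 as intersection form; the quivers \<open>X6\<close> and \<open>X7\<close> have such a graph as well, with three
  vertices. Mutation slides edges of the graph along an edge, so every quiver of the mutation class
  has such a graph on the same vertex set \<open>P\<close>. The radical vectors are the edge sets for which all
  vertices have even degree, or all have odd degree. The former form the cycle space of the graph,
  of codimension at most 1, and are spanned by basic radical vectors. Basic radical vectors of the
  latter kind exist only if \<open>P\<close> has 2 or 4 elements, and then the basic ones span the radical.
\<close>

text \<open>Modulo 2, signs enter a mutation only through the parity of
  \<open>max 0 (quiver_matrix Q k i)\<close>. Sliding the edges so selected reproduces the mutated
  intersection parities, so one set \<open>P\<close> serves the whole mutation class and a case
  distinction on \<open>card P\<close> is mutation invariant. The obstacle to (ii) is that the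
  notion of a basic vector is not visibly compatible with mutation. No correspondence between
  individual basic vectors is used; their span is identified as a whole, as the full radical or as
  the cycle space, and mutation carries each of these along. The number 4 is the size of
  \<open>P\<close> when two disjoint edges exhaust it, which radicality of a double edge joining
  them forces. The number 2 belongs to the three-vertex quiver with all weights 2, whose vertices
  are parallel edges of the graph. The restrictions on weights come from an extremal argument: a
  connected triple whose weight is maximal in the class and above 2 could be mutated to a larger
  weight.\<close>

declare add_bit_eq_xor [simp del] mult_bit_eq_and [simp del]

lemma bit_add_self [simp]: "x + x = (0 :: bit)"
  by (cases x) (simp_all add: add_bit_eq_xor)

lemma bit_add_self_left [simp]: "x + (x + y) = (y :: bit)"
  by (simp flip: add.assoc)

lemma of_int_bit: "(of_int n :: bit) = of_bool (odd n)"
proof (cases "even n")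
  case True
  then obtain m where "n = m + m" by (auto elim!: evenE)
  then show ?thesis by simp
next
  case False
  then obtain m where "n = m + m + 1" by (auto elim!: oddE)
  then show ?thesis by simp
qed

lemma of_nat_bit: "(of_nat n :: bit) = of_bool (odd n)"
  using of_int_bit[of "int n"] by simp

lemma matrix_skew: "quiver_matrix Q i j = - quiver_matrix Q j i"
  by (simp add: quiver_matrix_def)

lemma matrix_self [simp]: "quiver_matrix Q i i = 0"
  by (simp add: quiver_matrix_def)

lemma quiver_of_matrix: "is_quiver Q \<Longrightarrow> Q i j = nat (quiver_matrix Q i j)"
  unfolding is_quiver_def quiver_matrix_def by (metis diff_0 diff_zero int_ops(1) nat_0 nat_int nat_zminus_int)

lemma adjacent_iff: "is_quiver Q \<Longrightarrow> adjacent Q i j \<longleftrightarrow> quiver_matrix Q i j \<noteq> 0"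
  unfolding is_quiver_def adjacent_def quiver_matrix_def
  by (metis diff_0 diff_zero gr0I neg_equal_0_iff_equal of_nat_0_eq_iff less_irrefl)

lemma adjacent_sym: "adjacent Q i j \<longleftrightarrow> adjacent Q j i"
  by (auto simp: adjacent_def)

definition out_parity :: "'v quiver \<Rightarrow> 'v \<Rightarrow> 'v \<Rightarrow> bit" where
  "out_parity Q k i = of_int (max 0 (quiver_matrix Q k i))"

lemma out_parity_self [simp]: "out_parity Q k k = 0"
  by (simp add: out_parity_def)

text \<open>Uses the form B'_ij = B_ij + B_ik [B_kj]_+ + [-B_ik]_+ B_kj of mutation. Modulo 2 it
  also covers \<open>k = i\<close> and \<open>k = j\<close>: the correction terms vanish and the
  sign change is invisible.\<close>

lemma mutate_mod2:
  "(of_int (quiver_matrix (mutate k Q) i j) :: bit) =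
     of_int (quiver_matrix Q i j) + of_int (quiver_matrix Q i k) * out_parity Q k j
      + out_parity Q k i * of_int (quiver_matrix Q k j)"
proof (cases "k = i \<or> k = j")
  case True
  then show ?thesis
    by (auto simp: quiver_matrix_mutate mutate_matrix_def of_int_bit)
next
  case False
  define x y where "x = quiver_matrix Q i k" and "y = quiver_matrix Q k j"
  have "sgn x * max 0 (x * y) = x * max 0 y + max 0 (- x) * y"
    by (auto simp: sgn_if max_def zero_le_mult_iff mult_le_0_iff)
  moreover have "quiver_matrix Q k i = - x"
    unfolding x_def by (rule matrix_skew)
  ultimately show ?thesis
    using False by (simp add: quiver_matrix_mutate mutate_matrix_def out_parity_def flip: x_def y_def)
qed

text \<open>
  Mutation at \<open>k\<close> is a congruence of the matrix over the integers; modulo 2 this change of basis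
  becomes an involution which identifies the radicals.
\<close>

definition mutate_vector :: "'v::finite quiver \<Rightarrow> 'v \<Rightarrow> bit^'v \<Rightarrow> bit^'v" where
  "mutate_vector Q k u = (\<chi> i. if i = k then u $ k + (\<Sum>j\<in>UNIV. out_parity Q k j * u $ j) else u $ i)"

lemma mutate_vector_sum:
  fixes f :: "'v::finite \<Rightarrow> bit"
  shows "(\<Sum>j\<in>UNIV. f j * mutate_vector Q k u $ j) =
    (\<Sum>j\<in>UNIV. f j * u $ j) + f k * (\<Sum>j\<in>UNIV. out_parity Q k j * u $ j)"
proof -
  have "(\<Sum>j\<in>UNIV. f j * mutate_vector Q k u $ j) =
      (\<Sum>j\<in>UNIV. f j * u $ j + (if j = k then f k * (\<Sum>j\<in>UNIV. out_parity Q k j * u $ j) else 0))"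
    by (rule sum.cong) (auto simp: mutate_vector_def algebra_simps)
  then show ?thesis by (simp add: sum.distrib)
qed

lemma mutate_vector_involution [simp]: "mutate_vector Q k (mutate_vector Q k u) = u"
proof (rule vec_eq_iff[THEN iffD2], rule allI)
  fix i
  show "mutate_vector Q k (mutate_vector Q k u) $ i = u $ i"
  proof (cases "i = k")
    case True
    have "mutate_vector Q k (mutate_vector Q k u) $ k = mutate_vector Q k u $ k +
       (\<Sum>j\<in>UNIV. out_parity Q k j * mutate_vector Q k u $ j)"
      by (simp add: mutate_vector_def[of Q k "mutate_vector Q k u"])
    also have "\<dots> = u $ k"
      unfolding mutate_vector_sum by (simp add: mutate_vector_def add.assoc)
    finally show ?thesis using True by simp
  qed (simp add: mutate_vector_def)
qed

lemma linear_mutate_vector: "Vector_Spaces.linear (*s) (*s) (mutate_vector Q k)"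
  by unfold_locales
    (auto simp: vec_eq_iff mutate_vector_def sum.distrib sum_distrib_left algebra_simps)

lemma inj_mutate_vector: "inj (mutate_vector Q k)"
  by (metis injI mutate_vector_involution)

lemma radical_space_iff:
  "u \<in> radical_space Q \<longleftrightarrow> (\<forall>i. (\<Sum>j\<in>UNIV. of_int (quiver_matrix Q i j) * u $ j) = 0)"
  by (simp add: radical_space_def matrix_mod2_def matrix_vector_mult_def vec_eq_iff)

lemma subspace_radical_space: "vec.subspace (radical_space Q)"
  by (auto simp: vec.subspace_def radical_space_def vec.add vec.scale)

text \<open>With r the image of \<open>mutate_vector Q k u\<close> under the old matrix, the new
  matrix sends u to r_i + m_i r_k, where m_i is \<open>out_parity Q k i\<close>. As m_k = 0,
  vanishing of row k gives r_k = 0, and then r = 0.\<close>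

lemma mutate_radical_space:
  "u \<in> radical_space (mutate k Q) \<longleftrightarrow> mutate_vector Q k u \<in> radical_space Q"
proof -
  define r where "r i = (\<Sum>j\<in>UNIV. of_int (quiver_matrix Q i j) * mutate_vector Q k u $ j)" for i
  have eq: "(\<Sum>j\<in>UNIV. of_int (quiver_matrix (mutate k Q) i j) * u $ j) = r i + out_parity Q k i * r k"
    for i
  proof -
    have "(\<Sum>j\<in>UNIV. of_int (quiver_matrix (mutate k Q) i j) * u $ j) =
       (\<Sum>j\<in>UNIV. of_int (quiver_matrix Q i j) * u $ j)
        + of_int (quiver_matrix Q i k) * (\<Sum>j\<in>UNIV. out_parity Q k j * u $ j)
        + out_parity Q k i * (\<Sum>j\<in>UNIV. of_int (quiver_matrix Q k j) * u $ j)"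
      by (simp add: mutate_mod2 sum.distrib sum_distrib_left algebra_simps)
    then show ?thesis unfolding r_def mutate_vector_sum by simp
  qed
  show ?thesis
    unfolding radical_space_iff eq
  proof
    assume *: "\<forall>i. r i + out_parity Q k i * r k = 0"
    from *[rule_format, of k] have "r k = 0" by simp
    with * show "\<forall>i. (\<Sum>j\<in>UNIV. of_int (quiver_matrix Q i j) * mutate_vector Q k u $ j) = 0"
      by (simp add: r_def)
  qed (simp add: r_def)
qed

lemma mutate_radical_space_image:
  "radical_space (mutate k Q) = mutate_vector Q k ` radical_space Q"
  by (auto simp: mutate_radical_space image_iff) (metis mutate_vector_involution)+

section \<open>Triples of vertices in quivers of finite mutation type\<close>

text \<open>\<open>Cyc a b c\<close> stands for a triangle i -> j -> k -> i with weights a, b, c,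
  and \<open>Acyc a b c\<close> for edges i -> j, j -> k, i -> k with these weights; weight 0 is a
  missing edge. The axioms record relabelling, reversal of all edges, mutation at the middle vertex
  j, and, in \<open>Acyc_rotate\<close>, mutation at the source. \<open>N\<close> reflects finite
  mutation type.\<close>

locale weight_triples =
  fixes Cyc Acyc :: "nat \<Rightarrow> nat \<Rightarrow> nat \<Rightarrow> bool" and N :: nat
  assumes Cyc_rotate: "Cyc a b c \<Longrightarrow> Cyc b c a"
    and Cyc_swap: "Cyc a b c \<Longrightarrow> Cyc b a c"
    and Acyc_rotate: "Acyc a b c \<Longrightarrow> Acyc b c a"
    and Acyc_swap: "Acyc a b c \<Longrightarrow> Acyc b a c"
    and Acyc_mutate: "Acyc a b c \<Longrightarrow> Cyc a b (c + a * b)"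
    and Cyc_mutate: "Cyc a b c \<Longrightarrow> c \<le> a * b \<Longrightarrow> Cyc a b (a * b - c)"
    and Cyc_mutate_Acyc: "Cyc a b c \<Longrightarrow> a * b \<le> c \<Longrightarrow> Acyc a b (c - a * b)"
    and Cyc_0: "Cyc a b 0 \<Longrightarrow> Acyc a b 0"
    and bounded: "Cyc a b c \<or> Acyc a b c \<Longrightarrow> c \<le> N"
begin

text \<open>Positivity means that at least two of the three weights are non-zero. An isolated edge
  of a triple is not constrained by mutations inside the triple.\<close>

definition heavy :: "nat \<Rightarrow> bool" where
  "heavy c \<longleftrightarrow> (\<exists>a b. (Cyc a b c \<or> Acyc a b c) \<and> a * b + b * c + c * a > 0)"

lemma heavyI: "Cyc a b c \<or> Acyc a b c \<Longrightarrow> a * b + b * c + c * a > 0 \<Longrightarrow> heavy c"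
  unfolding heavy_def by blast

lemma heavy_le_2:
  assumes "heavy c"
  shows "c \<le> 2"
proof -
  define m where "m = Max (Collect heavy)"
  have fin: "finite (Collect heavy)"
  proof (rule finite_subset)
    show "Collect heavy \<subseteq> {..N}" using bounded unfolding heavy_def by blast
  qed simp
  have max: "heavy x \<Longrightarrow> x \<le> m" for x
    unfolding m_def using fin by (intro Max_ge) auto
  have "heavy m"
    unfolding m_def using Max_in[OF fin] assms by auto
  then obtain a0 b0 where ab0: "Cyc a0 b0 m \<or> Acyc a0 b0 m" "a0 * b0 + b0 * m + m * a0 > 0"
    unfolding heavy_def by meson
  have False if m3: "m \<ge> 3"
  proof -
    have "a0 > 0 \<or> b0 > 0" using ab0(2) by auto
    moreover have "Cyc m a0 b0 \<or> Acyc m a0 b0" "Cyc m b0 a0 \<or> Acyc m b0 a0"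
      using ab0(1) Cyc_rotate[of a0 b0 m] Cyc_rotate[of b0 m a0] Cyc_swap[of a0 b0 m]
        Cyc_rotate[of b0 a0 m] Cyc_rotate[of a0 m b0]
        Acyc_rotate[of a0 b0 m] Acyc_rotate[of b0 m a0] Acyc_swap[of a0 b0 m]
        Acyc_rotate[of b0 a0 m] Acyc_rotate[of a0 m b0] by blast+
    ultimately obtain b c where bc: "Cyc m b c \<or> Acyc m b c" "b > 0"
      by blast
    \<comment> \<open>Maximality of m against y + m x leaves only the triple (m, 1, 0). Its
      mutations include the triangle (m, m, 1) and from there the weight m m - 1.\<close>
    have acyc: False if A: "Acyc m x y" "x > 0" for x y
    proof -
      have "heavy (y + m * x)"
        using Acyc_mutate[OF A(1)] A(2) m3 by (intro heavyI[of m x]) auto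
      then have le: "y + m * x \<le> m" using max by blast
      have "x < 2"
      proof (rule ccontr)
        assume "\<not> x < 2"
        then have "m * 2 \<le> m * x" by (intro mult_left_mono) auto
        then show False using le m3 by linarith
      qed
      then have "x = 1" using A(2) by linarith
      with le have "y = 0" by simp
      have "Cyc m 1 m" using Acyc_mutate[OF A(1)] \<open>x = 1\<close> \<open>y = 0\<close> by simp
      then have "Cyc m m 1" by (metis Cyc_rotate)
      then have "Cyc m m (m * m - 1)" using m3 by (intro Cyc_mutate) auto
      then have "heavy (m * m - 1)" using m3 by (intro heavyI[of m m]) auto
      then have "m * m - 1 \<le> m" using max by blast
      moreover have "m * m \<ge> 3 * m" using m3 by simp
      ultimately show False using m3 by linarith
    qed
    then have cyc: "Cyc m b c" using bc by blast
    have "c > 0"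
      using acyc[of b 0] Cyc_0[of m b] cyc bc(2) by (cases c) auto
    have "heavy c" using cyc bc(2) m3 by (intro heavyI[of m b]) auto
    then have "c \<le> m" using max by blast
    have "Cyc m c b" using cyc by (metis Cyc_rotate Cyc_swap)
    then have "heavy b" using \<open>c > 0\<close> m3 by (intro heavyI[of m c]) auto
    then have "b \<le> m" using max by blast
    have step: "m * x - y \<le> m" if "Cyc m x y" "x > 0" "y \<le> m" for x y
    proof -
      have "m \<le> m * x" using that(2) by simp
      then have "y \<le> m * x" using that(3) by linarith
      then have "Cyc m x (m * x - y)" using that by (intro Cyc_mutate) auto
      then show ?thesis using that m3 by (intro max heavyI[of m x]) auto
    qed
    \<comment> \<open>Here m x is at least 2 m and y at most m, so m x - y <= m forces x = 2 and y =
      m. The triangle (m, m, 2) then yields the weight m m - 2.\<close>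
    have big: False if "Cyc m x y" "x \<ge> 2" "y \<le> m" for x y
    proof -
      have 1: "m * x - y \<le> m" using step that by auto
      have "m * 2 \<le> m * x" using that(2) by (intro mult_left_mono) auto
      then have y: "y = m" using 1 that(3) by linarith
      have "x < 3"
      proof (rule ccontr)
        assume "\<not> x < 3"
        then have "m * 3 \<le> m * x" by (intro mult_left_mono) auto
        then show False using 1 that(3) m3 by linarith
      qed
      then have "x = 2" using that(2) by simp
      then have "Cyc m m 2" using that(1) y by (metis Cyc_rotate)
      then have "m * m - 2 \<le> m" using step[of m 2] m3 by auto
      moreover have "m * m \<ge> 3 * m" using m3 by simp
      ultimately show False using m3 by linarith
    qed
    \<comment> \<open>Only the triangle (m, 1, 1) survives. Mutation at the vertex opposite m makes
      it acyclic with weights 1, 1, m - 1; from there another vertex leads to the triangle (m, m -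
      1, 1).\<close>
    have "b = 1" using big[OF cyc _ \<open>c \<le> m\<close>] bc(2) by (cases "b \<ge> 2") auto
    moreover have "c = 1" using big[OF \<open>Cyc m c b\<close> _ \<open>b \<le> m\<close>] \<open>c > 0\<close> by (cases "c \<ge> 2") auto
    ultimately have "Cyc 1 1 m" using cyc by (metis Cyc_rotate)
    then have "Acyc 1 1 (m - 1)" using Cyc_mutate_Acyc[of 1 1 m] m3 by auto
    then have "Acyc (m - 1) 1 1" by (metis Acyc_rotate)
    then have "Cyc (m - 1) 1 m" using Acyc_mutate[of "m - 1" 1 1] m3 by simp
    then have "Cyc m (m - 1) 1" by (metis Cyc_rotate)
    then have "m * (m - 1) - 1 \<le> m" using step[of "m - 1" 1] m3 by auto
    moreover have "m * (m - 1) \<ge> m * 2" using m3 by (intro mult_left_mono) auto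
    ultimately show False using m3 by linarith
  qed
  then have "m \<le> 2" by (cases "m \<ge> 3") auto
  then show ?thesis using max[OF assms] by linarith
qed

text \<open>Mutation at the middle vertex gives c + a b <= 2. Apart from the claimed weights this
  leaves only {a, b} = {1, 2} with c = 0, which reaches the triangle (2, 2, 1) and hence weight
  3.\<close>

lemma Acyc_weights:
  assumes "Acyc a b c" "a > 0" "b > 0"
  shows "a = 1 \<and> b = 1 \<and> c \<le> 1"
proof -
  have "Cyc a b (c + a * b)" using assms Acyc_mutate by blast
  then have 1: "c + a * b \<le> 2" using assms by (intro heavy_le_2 heavyI[of a b]) auto
  have *: "\<not> Acyc 2 1 0"
  proof
    assume "Acyc 2 1 0"
    then have "Cyc 2 1 2" using Acyc_mutate[of 2 1 0] by (simp add: numeral_2_eq_2)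
    then have "Cyc 2 2 1" by (metis Cyc_rotate)
    then have "Cyc 2 2 3" using Cyc_mutate[of 2 2 1] by simp
    then have "heavy 3" by (intro heavyI[of 2 2]) auto
    then show False using heavy_le_2 by fastforce
  qed
  have "a \<le> a * b" "b \<le> a * b" using assms by auto
  then consider "a = 1" "b = 1" "c \<le> 1" | "a = 1" "b = 2" "c = 0" | "a = 2" "b = 1" "c = 0" | "a = 2" "b = 2"
    using 1 assms by linarith
  then show ?thesis
  proof cases
    case 2
    then show ?thesis using * assms(1) Acyc_swap by blast
  next
    case 3
    then show ?thesis using * assms(1) by blast
  next
    case 4
    then show ?thesis using 1 by simp
  qed simp
qed

text \<open>A zero weight would make the triple acyclic with a weight 2, and (2, 2, 1) reaches
  weight 3. What remains is (2, 1, 1) and (2, 2, 2); the latter is fixed by every mutation.\<close>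

lemma Cyc_weights:
  assumes "Cyc 2 b c" "b > 0 \<or> c > 0"
  shows "b = c \<and> (b = 1 \<or> b = 2)"
proof -
  have no: False if "Cyc 2 x 0" "x > 0" for x
    using that Acyc_weights[of 2 x 0] Cyc_0 by auto
  have no21: False if "Cyc 2 2 1"
  proof -
    have "Cyc 2 2 3" using Cyc_mutate[of 2 2 1] that by simp
    then have "heavy 3" by (intro heavyI[of 2 2]) auto
    then show False using heavy_le_2 by fastforce
  qed
  have sw: "Cyc 2 c b" using assms(1) by (metis Cyc_rotate Cyc_swap)
  have pos: "b > 0" "c > 0"
    using no[of b] no[of c] assms sw by (cases b; cases c; auto)+
  have "b \<le> 2" "c \<le> 2"
    using assms(1) sw pos by (auto intro!: heavy_le_2 heavyI[of 2 c b] heavyI[of 2 b c])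
  then show ?thesis
    using no21 assms(1) sw pos by (auto simp: le_Suc_eq numeral_2_eq_2)
qed

end

section \<open>Mutation classes of finite type and their weight triples\<close>

definition mutation_finite :: "'v::finite quiver \<Rightarrow> bool" where
  "mutation_finite Q \<longleftrightarrow> is_quiver Q \<and> connected_quiver Q \<and> finite_mutation_type Q"

text \<open>An edge can disappear only if both its ends are adjacent to k. Edges at k are merely
  reversed, so the path through k replaces it.\<close>

lemma connected_quiver_mutate:
  assumes "is_quiver Q" "connected_quiver Q"
  shows "connected_quiver (mutate k Q)"
proof -
  let ?B = "quiver_matrix Q" and ?Q = "mutate k Q"
  have k: "adjacent ?Q i j" if "adjacent Q i j" "i = k \<or> j = k" for i j
    using that assms(1) by (auto simp: adjacent_iff is_quiver_mutate quiver_matrix_mutate mutate_matrix_def)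
  have edge: "(adjacent ?Q)\<^sup>*\<^sup>* i j" if ij: "adjacent Q i j" for i j
  proof (cases "adjacent ?Q i j")
    case False
    then have "i \<noteq> k" "j \<noteq> k" using k ij by blast+
    then have "?B i k \<noteq> 0" "?B k j \<noteq> 0"
      using False ij assms(1)
      by (auto simp: adjacent_iff is_quiver_mutate quiver_matrix_mutate mutate_matrix_def)
    then have "adjacent Q i k" "adjacent Q k j"
      using assms(1) by (simp_all add: adjacent_iff)
    then have "adjacent ?Q i k" "adjacent ?Q k j"
      using k by blast+
    then show ?thesis by (meson converse_rtranclp_into_rtranclp r_into_rtranclp)
  qed auto
  have "(adjacent ?Q)\<^sup>*\<^sup>* i j" if "(adjacent Q)\<^sup>*\<^sup>* i j" for i j
    using that by induction (auto intro: rtranclp_trans edge)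
  then show ?thesis using assms(2) by (auto simp: connected_quiver_def)
qed

lemma equivclp_imp_mutation_equivalent:
  "equivclp mutation_step Q R \<Longrightarrow> mutation_equivalent Q R"
  unfolding mutation_equivalent_def isomorphic_quivers_def by (metis bij_id id_apply)

lemma mutation_equivalent_trans_step:
  "equivclp mutation_step Q R \<Longrightarrow> mutation_equivalent R S \<Longrightarrow> mutation_equivalent Q S"
  unfolding mutation_equivalent_def by (meson equivclp_trans)

lemma mutation_finite_mutate:
  assumes "mutation_finite Q"
  shows "mutation_finite (mutate k Q)"
proof -
  have "equivclp mutation_step Q (mutate k Q)"
    using assms by (intro r_into_equivclp) (auto simp: mutation_step_def mutation_finite_def)
  then have "{R :: 'a quiver. mutation_equivalent (mutate k Q) R} \<subseteq> {R. mutation_equivalent Q R}"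
    using mutation_equivalent_trans_step by blast
  then show ?thesis
    using assms connected_quiver_mutate is_quiver_mutate finite_subset
    by (auto simp: mutation_finite_def finite_mutation_type_def)
qed

definition mutation_class :: "'v::finite quiver \<Rightarrow> 'v quiver set" where
  "mutation_class Q = {R. (\<lambda>P P'. \<exists>k. P' = mutate k P)\<^sup>*\<^sup>* Q R}"

lemma mutation_class_mutate: "R \<in> mutation_class Q \<Longrightarrow> mutate k R \<in> mutation_class Q"
  unfolding mutation_class_def by (auto intro: rtranclp.rtrancl_into_rtrancl)

lemma mutation_class_self: "Q \<in> mutation_class Q"
  by (simp add: mutation_class_def)

lemma finite_mutation_class:
  assumes "mutation_finite Q"
  shows "finite (mutation_class Q)"
proof -
  have "mutation_finite R \<and> equivclp mutation_step Q R"
    if "(\<lambda>P P'. \<exists>k. P' = mutate k P)\<^sup>*\<^sup>* Q R" for R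
    using that
  proof induction
    case (step R S)
    then have "mutation_step R S" by (auto simp: mutation_step_def mutation_finite_def)
    then show ?case
      using step mutation_finite_mutate by (meson equivclp_trans r_into_equivclp)
  qed (use assms in auto)
  then have "mutation_class Q \<subseteq> {R. mutation_equivalent Q R}"
    using equivclp_imp_mutation_equivalent by (auto simp: mutation_class_def)
  then show ?thesis
    using assms finite_subset by (auto simp: mutation_finite_def finite_mutation_type_def)
qed

text \<open>
  A triple of weights is recorded up to reversing all edges, which the sign \<open>s\<close> accounts for:
  then a mutation of the quiver acts on the weights alone.
\<close>

definition cyclic_weights :: "'v::finite quiver \<Rightarrow> nat \<Rightarrow> nat \<Rightarrow> nat \<Rightarrow> bool" where
  "cyclic_weights Q a b c \<longleftrightarrow> (\<exists>R\<in>mutation_class Q. \<exists>i j k s. distinct [i, j, k] \<and> s * s = 1 \<and>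
     quiver_matrix R i j = s * int a \<and> quiver_matrix R j k = s * int b \<and>
     quiver_matrix R i k = - s * int c)"

definition acyclic_weights :: "'v::finite quiver \<Rightarrow> nat \<Rightarrow> nat \<Rightarrow> nat \<Rightarrow> bool" where
  "acyclic_weights Q a b c \<longleftrightarrow> (\<exists>R\<in>mutation_class Q. \<exists>i j k s. distinct [i, j, k] \<and> s * s = 1 \<and>
     quiver_matrix R i j = s * int a \<and> quiver_matrix R j k = s * int b \<and>
     quiver_matrix R i k = s * int c)"

text \<open>The common sign s makes the two edges a directed path through j, forward or backward, so
  mutation adds the product of the weights with the same sign.\<close>

lemma mutate_middle:
  assumes "distinct [i, j, k]" "s * s = 1" "quiver_matrix R i j = s * int a" "quiver_matrix R j k = s * int b"
  shows "quiver_matrix (mutate j R) i j = - s * int a" "quiver_matrix (mutate j R) j k = - s * int b"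
    "quiver_matrix (mutate j R) i k = quiver_matrix R i k + s * int (a * b)"
proof -
  have "sgn (s * int a) * max 0 (s * int a * (s * int b)) = s * int (a * b)"
  proof -
    have eq: "s * int a * (s * int b) = (s * s) * int (a * b)" by simp
    have 1: "max 0 (s * int a * (s * int b)) = int (a * b)" unfolding eq assms(2) by simp
    have "sgn s = s" using assms(2) by (auto simp: zmult_eq_1_iff)
    then show ?thesis unfolding 1 by (cases "a = 0") (auto simp: sgn_mult)
  qed
  then show "quiver_matrix (mutate j R) i k = quiver_matrix R i k + s * int (a * b)"
    using assms by (auto simp: quiver_matrix_mutate mutate_matrix_def)
  show "quiver_matrix (mutate j R) i j = - s * int a" "quiver_matrix (mutate j R) j k = - s * int b"
    using assms by (auto simp: quiver_matrix_mutate mutate_matrix_def)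
qed

lemma weight_triples_mutation_class:
  assumes "mutation_finite Q"
  shows "\<exists>N. weight_triples (cyclic_weights Q) (acyclic_weights Q) N"
proof -
  \<comment> \<open>The largest absolute value of a matrix entry over the whole class, which is
    finite.\<close>
  define N where "N = Max ((\<lambda>(R, i, k). nat \<bar>quiver_matrix R i k\<bar>) ` (mutation_class Q \<times> UNIV \<times> UNIV))"
  have fin: "finite (mutation_class Q \<times> (UNIV :: 'a set) \<times> (UNIV :: 'a set))"
    using finite_mutation_class[OF assms] by simp
  have N: "c \<le> N" if "R \<in> mutation_class Q" "quiver_matrix R i k = t * int c" "t * t = 1" for R i k t c
  proof -
    have "nat \<bar>quiver_matrix R i k\<bar> = c" using that(2,3) by (auto simp: zmult_eq_1_iff)
    then have "c \<in> (\<lambda>(R, i, k). nat \<bar>quiver_matrix R i k\<bar>) ` (mutation_class Q \<times> UNIV \<times> UNIV)"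
      using that(1) by (auto intro!: image_eqI[of _ _ "(R, i, k)"])
    then show ?thesis unfolding N_def using fin by (intro Max_ge) auto
  qed
  have "weight_triples (cyclic_weights Q) (acyclic_weights Q) N"
  proof
    fix a b c
    show "cyclic_weights Q b c a" if c: "cyclic_weights Q a b c"
    proof -
      from c obtain R i j k s where *: "R \<in> mutation_class Q" "distinct [i, j, k]" "s * s = 1"
        "quiver_matrix R i j = s * int a" "quiver_matrix R j k = s * int b"
        "quiver_matrix R i k = - s * int c" unfolding cyclic_weights_def by blast
      show ?thesis unfolding cyclic_weights_def
        by (intro bexI[of _ R] exI[of _ j] exI[of _ k] exI[of _ i] exI[of _ s])
          (use * matrix_skew[of R k i] matrix_skew[of R j i] in auto)
    qed
    show "cyclic_weights Q b a c" if c: "cyclic_weights Q a b c"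
    proof -
      from c obtain R i j k s where *: "R \<in> mutation_class Q" "distinct [i, j, k]" "s * s = 1"
        "quiver_matrix R i j = s * int a" "quiver_matrix R j k = s * int b"
        "quiver_matrix R i k = - s * int c" unfolding cyclic_weights_def by blast
      show ?thesis unfolding cyclic_weights_def
        by (intro bexI[of _ R] exI[of _ k] exI[of _ j] exI[of _ i] exI[of _ "- s"])
          (use * matrix_skew[of R k i] matrix_skew[of R j i] matrix_skew[of R k j] in auto)
    qed
    show "acyclic_weights Q b a c" if c: "acyclic_weights Q a b c"
    proof -
      from c obtain R i j k s where *: "R \<in> mutation_class Q" "distinct [i, j, k]" "s * s = 1"
        "quiver_matrix R i j = s * int a" "quiver_matrix R j k = s * int b"
        "quiver_matrix R i k = s * int c" unfolding acyclic_weights_def by blast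
      show ?thesis unfolding acyclic_weights_def
        by (intro bexI[of _ R] exI[of _ k] exI[of _ j] exI[of _ i] exI[of _ "- s"])
          (use * matrix_skew[of R k i] matrix_skew[of R j i] matrix_skew[of R k j] in auto)
    qed
    show "acyclic_weights Q b c a" if c: "acyclic_weights Q a b c"
    proof -
      from c obtain R i j k s where *: "R \<in> mutation_class Q" "distinct [i, j, k]" "s * s = 1"
        "quiver_matrix R i j = s * int a" "quiver_matrix R j k = s * int b"
        "quiver_matrix R i k = s * int c" unfolding acyclic_weights_def by blast
      \<comment> \<open>Within the triple, i is a source, or a sink if s = -1. Mutation there only
        reverses its edges, which rotates the roles of the vertices.\<close>
      have "quiver_matrix R j i * quiver_matrix R i k = - ((s * s) * int (a * c))"
        using *(4,6) matrix_skew[of R j i] by simp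
      then have "max 0 (quiver_matrix R j i * quiver_matrix R i k) = 0"
        using *(3) by simp
      then show ?thesis unfolding acyclic_weights_def
        by (intro bexI[of _ "mutate i R"] exI[of _ j] exI[of _ k] exI[of _ i] exI[of _ "s"])
          (use * matrix_skew[of R k i] matrix_skew[of R j i] matrix_skew[of R k j] in
            \<open>auto simp: quiver_matrix_mutate mutate_matrix_def mutation_class_mutate\<close>)
    qed
    show "cyclic_weights Q a b (c + a * b)" if c: "acyclic_weights Q a b c"
    proof -
      from c obtain R i j k s where *: "R \<in> mutation_class Q" "distinct [i, j, k]" "s * s = 1"
        "quiver_matrix R i j = s * int a" "quiver_matrix R j k = s * int b"
        "quiver_matrix R i k = s * int c" unfolding acyclic_weights_def by blast
      show ?thesis unfolding cyclic_weights_def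
        by (intro bexI[of _ "mutate j R"] exI[of _ i] exI[of _ j] exI[of _ k] exI[of _ "- s"])
          (use * mutate_middle[OF *(2-5)] mutation_class_mutate in \<open>auto simp: algebra_simps\<close>)
    qed
    show "cyclic_weights Q a b (a * b - c)" if c: "cyclic_weights Q a b c" and le: "c \<le> a * b"
    proof -
      from c obtain R i j k s where *: "R \<in> mutation_class Q" "distinct [i, j, k]" "s * s = 1"
        "quiver_matrix R i j = s * int a" "quiver_matrix R j k = s * int b"
        "quiver_matrix R i k = - s * int c" unfolding cyclic_weights_def by blast
      show ?thesis unfolding cyclic_weights_def
        by (intro bexI[of _ "mutate j R"] exI[of _ i] exI[of _ j] exI[of _ k] exI[of _ "- s"])
          (use * mutate_middle[OF *(2-5)] mutation_class_mutate le in
            \<open>auto simp: algebra_simps of_nat_diff simp del: of_nat_mult\<close>)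
    qed
    show "acyclic_weights Q a b (c - a * b)" if c: "cyclic_weights Q a b c" and le: "a * b \<le> c"
    proof -
      from c obtain R i j k s where *: "R \<in> mutation_class Q" "distinct [i, j, k]" "s * s = 1"
        "quiver_matrix R i j = s * int a" "quiver_matrix R j k = s * int b"
        "quiver_matrix R i k = - s * int c" unfolding cyclic_weights_def by blast
      show ?thesis unfolding acyclic_weights_def
        by (intro bexI[of _ "mutate j R"] exI[of _ i] exI[of _ j] exI[of _ k] exI[of _ "- s"])
          (use * mutate_middle[OF *(2-5)] mutation_class_mutate le in
            \<open>auto simp: algebra_simps of_nat_diff simp del: of_nat_mult\<close>)
    qed
    show "acyclic_weights Q a b 0" if "cyclic_weights Q a b 0"
      using that by (simp add: cyclic_weights_def acyclic_weights_def)
    show "c \<le> N" if c: "cyclic_weights Q a b c \<or> acyclic_weights Q a b c"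
    proof -
      from c obtain R i j k s t where "R \<in> mutation_class Q" "s * s = 1"
        "quiver_matrix R i k = t * int c" "t = s \<or> t = - s"
        unfolding cyclic_weights_def acyclic_weights_def by blast
      then show ?thesis using N[of R i k t c] by auto
    qed
  qed
  then show ?thesis by blast
qed

section \<open>Weights around an edge of a quiver of finite mutation type\<close>

lemma connected_quiver_exit:
  assumes "connected_quiver Q" "a \<in> A" "b \<notin> A"
  shows "\<exists>x\<in>A. \<exists>y. y \<notin> A \<and> adjacent Q x y"
proof -
  have "(adjacent Q)\<^sup>*\<^sup>* a b" using assms(1) by (simp add: connected_quiver_def)
  then show ?thesis
    using assms(3) by (induction rule: rtranclp_induct) (use assms(2) in auto)
qed

lemma ex_third_vertex:
  assumes "CARD('v::finite) \<ge> 3"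
  shows "\<exists>k. k \<noteq> i \<and> k \<noteq> (j :: 'v)"
proof (rule ccontr)
  assume "\<not> ?thesis"
  then have "UNIV = {i, j}" by auto
  then have "CARD('v) = card {i, j}" by simp
  also have "\<dots> \<le> 2" by (simp add: card_insert_if)
  finally show False using assms by simp
qed

lemma acyclic_weightsI:
  assumes "distinct [i, j, k]" "s * s = 1" "quiver_matrix Q i j = s * int a"
    "quiver_matrix Q j k = s * int b" "quiver_matrix Q i k = s * int c"
  shows "acyclic_weights Q a b c"
  using assms mutation_class_self unfolding acyclic_weights_def by blast

lemma cyclic_weightsI:
  assumes "distinct [i, j, k]" "s * s = 1" "quiver_matrix Q i j = s * int a"
    "quiver_matrix Q j k = s * int b" "quiver_matrix Q i k = - s * int c"
  shows "cyclic_weights Q a b c"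
  using assms mutation_class_self unfolding cyclic_weights_def by blast

context
  fixes Q :: "'v::finite quiver"
  assumes Q: "mutation_finite Q" and card: "CARD('v) \<ge> 3"
begin

text \<open>Relative to the sign of the entry (i, k) there are four sign patterns: acyclic with
  middle vertex j, cyclic, and acyclic with middle vertex k or i. The last two are brought into the
  stated order by the symmetries of \<open>Acyc\<close>.\<close>

lemma weights_cyclic_or_acyclic:
  assumes "distinct [i, j, k]"
  defines "a \<equiv> nat \<bar>quiver_matrix Q i j\<bar>" and "b \<equiv> nat \<bar>quiver_matrix Q j k\<bar>"
    and "c \<equiv> nat \<bar>quiver_matrix Q i k\<bar>"
  shows "cyclic_weights Q a b c \<or> acyclic_weights Q a b c"
proof -
  from weight_triples_mutation_class[OF Q] obtain N where
    "weight_triples (cyclic_weights Q) (acyclic_weights Q) N" ..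
  then interpret weight_triples "cyclic_weights Q" "acyclic_weights Q" N .
  have skew: "quiver_matrix Q k j = - quiver_matrix Q j k" "quiver_matrix Q k i = - quiver_matrix Q i k"
    "quiver_matrix Q j i = - quiver_matrix Q i j"
    by (rule matrix_skew)+
  define s where "s = (if quiver_matrix Q i k \<ge> 0 then 1 else - 1 :: int)"
  have s: "s * s = 1" "quiver_matrix Q i k = s * int c"
    by (auto simp: s_def c_def)
  have "quiver_matrix Q i j = s * int a \<or> quiver_matrix Q i j = - s * int a"
    by (cases "quiver_matrix Q i j \<ge> 0") (auto simp: s_def a_def)
  moreover have "quiver_matrix Q j k = s * int b \<or> quiver_matrix Q j k = - s * int b"
    by (cases "quiver_matrix Q j k \<ge> 0") (auto simp: s_def b_def)
  ultimately consider "quiver_matrix Q i j = s * int a" "quiver_matrix Q j k = s * int b"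
    | "quiver_matrix Q i j = - s * int a" "quiver_matrix Q j k = - s * int b"
    | "quiver_matrix Q i j = s * int a" "quiver_matrix Q j k = - s * int b"
    | "quiver_matrix Q i j = - s * int a" "quiver_matrix Q j k = s * int b"
    by blast
  then show ?thesis
  proof cases
    case 1
    then show ?thesis using acyclic_weightsI[of i j k s Q a b c] assms(1) s by blast
  next
    case 2
    then show ?thesis using cyclic_weightsI[of i j k "- s" Q a b c] assms(1) s by simp
  next
    case 3
    then have "acyclic_weights Q c b a"
      using acyclic_weightsI[of i k j s Q c b a] assms(1) s skew by auto
    then show ?thesis using Acyc_rotate[of c b a] Acyc_swap[of b a c] by blast
  next
    case 4
    then have "acyclic_weights Q a c b"
      using acyclic_weightsI[of j i k s Q a c b] assms(1) s skew by auto
    then show ?thesis using Acyc_swap[of a c b] Acyc_rotate[of c a b] by blast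
  qed
qed

text \<open>Connectedness and a third vertex supply a neighbour of i or j outside the edge, so the
  weight belongs to a connected triple and is heavy.\<close>

lemma weight_le_2: "\<bar>quiver_matrix Q i j\<bar> \<le> 2"
proof (cases "quiver_matrix Q i j = 0")
  case False
  then have ij: "i \<noteq> j" by auto
  from weight_triples_mutation_class[OF Q] obtain N where
    "weight_triples (cyclic_weights Q) (acyclic_weights Q) N" ..
  then interpret weight_triples "cyclic_weights Q" "acyclic_weights Q" N .
  obtain v where "v \<noteq> i" "v \<noteq> j" using ex_third_vertex[OF card] by blast
  then obtain x k where k: "x \<in> {i, j}" "k \<notin> {i, j}" "adjacent Q x k"
    using connected_quiver_exit[of Q i "{i, j}" v] Q by (auto simp: mutation_finite_def)
  then have nz: "quiver_matrix Q i k \<noteq> 0 \<or> quiver_matrix Q j k \<noteq> 0"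
    using Q by (auto simp: mutation_finite_def adjacent_iff)
  let ?a = "nat \<bar>quiver_matrix Q i j\<bar>" and ?b = "nat \<bar>quiver_matrix Q j k\<bar>"
    and ?c = "nat \<bar>quiver_matrix Q i k\<bar>"
  have "cyclic_weights Q ?a ?b ?c \<or> acyclic_weights Q ?a ?b ?c"
    by (rule weights_cyclic_or_acyclic) (use k ij in auto)
  then have "cyclic_weights Q ?b ?c ?a \<or> acyclic_weights Q ?b ?c ?a"
    using Cyc_rotate[of ?a ?b ?c] Acyc_rotate[of ?a ?b ?c] by blast
  moreover have "?b * ?c + ?c * ?a + ?a * ?b > 0" using nz False by auto
  ultimately have "heavy ?a" by (rule heavyI)
  then show ?thesis using heavy_le_2[of ?a] by simp
qed simp

text \<open>In an acyclic triple containing a weight 2 the other two weights vanish, as two of its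
  rotations show. In a cyclic one they agree by \<open>Cyc_weights\<close>.\<close>

lemma double_edge_weights:
  assumes "\<bar>quiver_matrix Q i j\<bar> = 2" "k \<noteq> i" "k \<noteq> j"
  shows "\<bar>quiver_matrix Q i k\<bar> = \<bar>quiver_matrix Q j k\<bar>"
proof -
  from weight_triples_mutation_class[OF Q] obtain N where
    "weight_triples (cyclic_weights Q) (acyclic_weights Q) N" ..
  then interpret weight_triples "cyclic_weights Q" "acyclic_weights Q" N .
  let ?b = "nat \<bar>quiver_matrix Q j k\<bar>" and ?c = "nat \<bar>quiver_matrix Q i k\<bar>"
  have "distinct [i, j, k]" using assms by auto
  then have "cyclic_weights Q 2 ?b ?c \<or> acyclic_weights Q 2 ?b ?c"
    using weights_cyclic_or_acyclic[of i j k] assms(1) by simp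
  then have "?b = ?c"
  proof
    assume "cyclic_weights Q 2 ?b ?c"
    then show ?thesis using Cyc_weights[of ?b ?c] by (cases "?b > 0 \<or> ?c > 0") auto
  next
    assume A: "acyclic_weights Q 2 ?b ?c"
    then have A': "acyclic_weights Q ?c 2 ?b" using Acyc_rotate[of 2] Acyc_rotate[of ?b ?c 2] by blast
    show ?thesis using Acyc_weights[OF A] Acyc_weights[OF A'] by (cases "?b > 0"; cases "?c > 0") auto
  qed
  then show ?thesis by simp
qed

lemma triangle_weights:
  assumes "distinct [i, j, k]" "s * s = 1" "quiver_matrix Q i j = s * int a"
    "quiver_matrix Q j k = s * int b" "quiver_matrix Q i k = s * int c" "a > 0" "b > 0"
  shows "a = 1 \<and> b = 1 \<and> c \<le> 1"
proof -
  from weight_triples_mutation_class[OF Q] obtain N where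
    "weight_triples (cyclic_weights Q) (acyclic_weights Q) N" ..
  then interpret weight_triples "cyclic_weights Q" "acyclic_weights Q" N .
  show ?thesis using Acyc_weights acyclic_weightsI assms by blast
qed

text \<open>When the third edge is missing, cyclic and acyclic patterns coincide, so the stronger
  bound for acyclic triples holds for every orientation.\<close>

lemma path_weights:
  assumes "quiver_matrix Q i j \<noteq> 0" "quiver_matrix Q j k \<noteq> 0" "quiver_matrix Q i k = 0" "i \<noteq> k"
  shows "\<bar>quiver_matrix Q i j\<bar> = 1" "\<bar>quiver_matrix Q j k\<bar> = 1"
proof -
  from weight_triples_mutation_class[OF Q] obtain N where
    "weight_triples (cyclic_weights Q) (acyclic_weights Q) N" ..
  then interpret weight_triples "cyclic_weights Q" "acyclic_weights Q" N .
  let ?a = "nat \<bar>quiver_matrix Q i j\<bar>" and ?b = "nat \<bar>quiver_matrix Q j k\<bar>"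
  have "distinct [i, j, k]" using assms by auto
  then have "cyclic_weights Q ?a ?b 0 \<or> acyclic_weights Q ?a ?b 0"
    using weights_cyclic_or_acyclic[of i j k] assms(3) by simp
  then have "acyclic_weights Q ?a ?b 0" using Cyc_0 by blast
  then have "?a = 1 \<and> ?b = 1"
    using Acyc_weights[of ?a ?b 0] assms by simp
  then show "\<bar>quiver_matrix Q i j\<bar> = 1" "\<bar>quiver_matrix Q j k\<bar> = 1" by auto
qed

end

section \<open>Indicator vectors in the radical and under mutation\<close>

lemma sum_indicator_vector:
  "(\<Sum>j\<in>UNIV. f j * indicator_vector S $ j) = (\<Sum>j\<in>S. f j)"
  by (auto simp: indicator_vector_def sum.If_cases if_distrib cong: if_cong)

lemma indicator_radical_iff:
  "indicator_vector S \<in> radical_space Q \<longleftrightarrow> (\<forall>i. (\<Sum>j\<in>S. of_int (quiver_matrix Q i j)) = (0 :: bit))"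
  by (simp add: radical_space_iff sum_indicator_vector)

lemma double_edge_radical:
  fixes Q :: "'v::finite quiver"
  assumes "mutation_finite Q" "CARD('v) \<ge> 3" "\<bar>quiver_matrix Q i j\<bar> = 2"
  shows "indicator_vector {i, j} \<in> radical_space Q"
  unfolding indicator_radical_iff
proof
  fix r
  have ij: "i \<noteq> j" using assms(3) by auto
  have "even (quiver_matrix Q r i + quiver_matrix Q r j)"
  proof (cases "r = i \<or> r = j")
    case True
    have "even \<bar>quiver_matrix Q i j\<bar>" by (simp add: assms(3))
    then have "even (quiver_matrix Q i j)" "even (quiver_matrix Q j i)"
      using matrix_skew[of Q j i] by simp_all
    then show ?thesis using True by auto
  next
    case False
    then have "\<bar>quiver_matrix Q i r\<bar> = \<bar>quiver_matrix Q j r\<bar>"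
      using double_edge_weights[OF assms] by auto
    then have "even (quiver_matrix Q i r) \<longleftrightarrow> even (quiver_matrix Q j r)"
      by (metis dvd_abs_iff)
    then show ?thesis
      using matrix_skew[of Q i r] matrix_skew[of Q j r] by simp
  qed
  then have "of_int (quiver_matrix Q r i + quiver_matrix Q r j) = (0 :: bit)"
    by (simp only: of_int_bit) simp
  then show "(\<Sum>j\<in>{i, j}. of_int (quiver_matrix Q r j)) = (0 :: bit)"
    using ij by simp
qed

lemma mutate_indicator_vector:
  assumes "k \<in> S"
  shows "mutate_vector Q k (indicator_vector S) =
    (if (\<Sum>j\<in>S. out_parity Q k j) = 0 then indicator_vector S else indicator_vector (S - {k}))"
  using assms
  by (auto simp: vec_eq_iff mutate_vector_def sum_indicator_vector) (auto simp: indicator_vector_def)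

lemma mutate_vector_radical:
  "mutate_vector Q k u \<in> radical_space (mutate k Q) \<longleftrightarrow> u \<in> radical_space Q"
  by (simp add: mutate_radical_space)

section \<open>Non-oriented cycles\<close>

lemma add_mod_cancel:
  assumes "(x + c) mod m = (y + c) mod m" "x < m" "y < (m :: nat)"
  shows "x = y"
proof -
  have *: "x = y" if "x \<le> y" "(x + c) mod m = (y + c) mod m" "y < m" for x y
  proof -
    have "m dvd (y + c) - (x + c)"
      using that mod_eq_dvd_iff_nat[of "x + c" "y + c" m] by auto
    then have "m dvd y - x" by simp
    moreover have "y - x < m" using that(3) by simp
    ultimately have "y - x = 0" using nat_dvd_not_less by blast
    then show ?thesis using that(1) by simp
  qed
  then show ?thesis using *[OF _ assms(1,3)] *[OF _ assms(1)[symmetric] assms(2)] by (metis nle_le)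
qed

lemma Suc_mod_shift:
  assumes "x < m" "y < m"
  shows "(y + c) mod m = Suc ((x + c) mod m) mod m \<longleftrightarrow> y = Suc x mod m"
proof -
  have "Suc ((x + c) mod m) mod m = (Suc x mod m + c) mod m"
    by (simp add: mod_simps)
  moreover have "(y + c) mod m = (z + c) mod m \<longleftrightarrow> y = z" if "z < m" for z
    using that assms(2) add_mod_cancel[of y c m z] by auto
  ultimately show ?thesis using assms(1) by auto
qed

text \<open>Rotations allow every mutation of a cycle to take place at label m - 1, whose removal
  leaves an initial segment of labels.\<close>

lemma cycle_labelling_rotate:
  assumes "cycle_labelling Q S m f"
  shows "cycle_labelling Q S m (\<lambda>x. f ((x + c) mod m))"
proof -
  have m: "m \<ge> 3" "bij_betw f {..<m} S"
    and adj: "\<And>x y. x < m \<Longrightarrow> y < m \<Longrightarrow>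
      adjacent Q (f x) (f y) \<longleftrightarrow> y = Suc x mod m \<or> x = Suc y mod m"
    using assms by (auto simp: cycle_labelling_def)
  have "inj_on (\<lambda>x. (x + c) mod m) {..<m}"
    by (auto intro!: inj_onI elim: add_mod_cancel)
  then have "bij_betw (\<lambda>x. (x + c) mod m) {..<m} {..<m}"
    using m(1) by (intro bij_betw_imageI endo_inj_surj) auto
  then have "bij_betw (\<lambda>x. f ((x + c) mod m)) {..<m} S"
    using bij_betw_trans[OF _ m(2)] by (fastforce simp: comp_def)
  moreover have "adjacent Q (f ((x + c) mod m)) (f ((y + c) mod m)) \<longleftrightarrow> y = Suc x mod m \<or> x = Suc y mod m"
    if "x < m" "y < m" for x y
    using adj[of "(x + c) mod m" "(y + c) mod m"] m(1) that by (simp add: Suc_mod_shift)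
  ultimately show ?thesis using m(1) by (simp add: cycle_labelling_def)
qed

lemma cycle_labelling_reverse:
  assumes "cycle_labelling Q S m f"
  shows "cycle_labelling Q S m (\<lambda>x. f (m - 1 - x))"
proof -
  have m: "m \<ge> 3" "bij_betw f {..<m} S"
    and adj: "\<And>x y. x < m \<Longrightarrow> y < m \<Longrightarrow>
      adjacent Q (f x) (f y) \<longleftrightarrow> y = Suc x mod m \<or> x = Suc y mod m"
    using assms by (auto simp: cycle_labelling_def)
  have "bij_betw (\<lambda>x. m - 1 - x) {..<m} {..<m}"
    by (rule bij_betw_byWitness[where f' = "\<lambda>x. m - 1 - x"]) auto
  then have "bij_betw (\<lambda>x. f (m - 1 - x)) {..<m} S"
    using bij_betw_trans[OF _ m(2)] by (fastforce simp: comp_def)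
  moreover have "m - 1 - y = Suc (m - 1 - x) mod m \<longleftrightarrow> x = Suc y mod m" if "x < m" "y < m" for x y
    using that by (cases "x = 0"; cases "Suc y = m") (auto simp: mod_if)
  then have "adjacent Q (f (m - 1 - x)) (f (m - 1 - y)) \<longleftrightarrow> y = Suc x mod m \<or> x = Suc y mod m"
    if "x < m" "y < m" for x y
    using adj[of "m - 1 - x" "m - 1 - y"] that by auto
  ultimately show ?thesis using m(1) by (simp add: cycle_labelling_def)
qed

text \<open>Non-orientedness witnessed in one fixed labelling, by a step along an edge and a step
  against one. In this form it can be followed through mutations, unlike the negated statement about
  all labellings.\<close>

definition mixed_labelling :: "'v quiver \<Rightarrow> 'v set \<Rightarrow> nat \<Rightarrow> (nat \<Rightarrow> 'v) \<Rightarrow> bool" where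
  "mixed_labelling Q S m f \<longleftrightarrow> cycle_labelling Q S m f \<and>
     (\<exists>x<m. quiver_matrix Q (f x) (f (Suc x mod m)) > 0) \<and>
     (\<exists>x<m. quiver_matrix Q (f x) (f (Suc x mod m)) < 0)"

lemma mixed_labelling_rotate:
  assumes "mixed_labelling Q S m f"
  shows "mixed_labelling Q S m (\<lambda>x. f ((x + c) mod m))"
proof -
  have m: "m \<ge> 3" using assms by (auto simp: mixed_labelling_def cycle_labelling_def)
  have *: "\<exists>x<m. P (f ((x + c) mod m)) (f ((Suc x mod m + c) mod m))"
    if "\<exists>x<m. P (f x) (f (Suc x mod m))" for P
  proof -
    from that obtain x where x: "x < m" "P (f x) (f (Suc x mod m))" by blast
    \<comment> \<open>The inverse rotation: \<open>m - c mod m\<close> represents -c modulo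
      m.\<close>
    define y where "y = (x + (m - c mod m)) mod m"
    have "(y + c) mod m = (x + (m - c mod m) + c mod m) mod m"
      unfolding y_def by (simp add: mod_simps)
    also have "x + (m - c mod m) + c mod m = x + m"
    proof -
      have "c mod m < m" using m by simp
      then show ?thesis by linarith
    qed
    also have "(x + m) mod m = x" using x(1) by simp
    finally have y: "(y + c) mod m = x" .
    have "(Suc y mod m + c) mod m = Suc ((y + c) mod m) mod m" by (simp add: mod_simps)
    then show ?thesis using x y m by (intro exI[of _ y]) (simp add: y_def)
  qed
  show ?thesis
    using assms *[of "\<lambda>a b. quiver_matrix Q a b > 0"] *[of "\<lambda>a b. quiver_matrix Q a b < 0"]
      cycle_labelling_rotate
    unfolding mixed_labelling_def by auto
qed

text \<open>The given labelling is not oriented, which yields a backward step. Its reversal is not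
  oriented either, which yields a forward step of the given one.\<close>

lemma nonoriented_cycle_mixed:
  assumes "is_quiver Q" "nonoriented_cycle Q S"
  shows "\<exists>m f. mixed_labelling Q S m f"
proof -
  obtain m f where f: "cycle_labelling Q S m f"
    using assms(2) by (auto simp: nonoriented_cycle_def is_cycle_def)
  have no: "\<not> (\<forall>x<m. Q (g x) (g (Suc x mod m)) > 0)" if "cycle_labelling Q S m g" for g
    using assms(2) that by (auto simp: nonoriented_cycle_def oriented_cycle_def)
  have m: "m \<ge> 3" using f by (simp add: cycle_labelling_def)
  have nz: "quiver_matrix Q (f x) (f (Suc x mod m)) \<noteq> 0" if "x < m" for x
    using f that m assms(1) unfolding cycle_labelling_def by (simp flip: adjacent_iff)
  obtain x where x: "x < m" "\<not> Q (f x) (f (Suc x mod m)) > 0" using no[OF f] by blast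
  then have neg: "quiver_matrix Q (f x) (f (Suc x mod m)) < 0"
    using nz[OF x(1)] quiver_of_matrix[OF assms(1)] by (metis linorder_neqE_linordered_idom zero_less_nat_eq)
  obtain y where y: "y < m" "\<not> Q (f (m - 1 - y)) (f (m - 1 - Suc y mod m)) > 0"
    using no[OF cycle_labelling_reverse[OF f]] by blast
  define z where "z = m - 1 - Suc y mod m"
  have z: "z < m" "Suc z mod m = m - 1 - y"
    using y(1) m by (cases "Suc y = m"; auto simp: z_def mod_if)+
  have "\<not> quiver_matrix Q (f (Suc z mod m)) (f z) > 0"
    using y(2) z quiver_of_matrix[OF assms(1)] by (simp add: z_def)
  then have "quiver_matrix Q (f z) (f (Suc z mod m)) > 0"
    using nz[OF z(1)] matrix_skew[of Q "f z" "f (Suc z mod m)"] by linarith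
  then show ?thesis using f x z neg unfolding mixed_labelling_def by blast
qed

lemma cycle_labelling_neighbours:
  assumes "is_quiver Q" "cycle_labelling Q S m f" "x < m"
  shows "quiver_matrix Q (f (m - 1)) (f x) \<noteq> 0 \<longleftrightarrow> x = m - 2 \<or> x = 0"
proof -
  have m: "m \<ge> 3" using assms(2) by (simp add: cycle_labelling_def)
  have "adjacent Q (f (m - 1)) (f x) \<longleftrightarrow> x = Suc (m - 1) mod m \<or> m - 1 = Suc x mod m"
    using assms(2,3) m unfolding cycle_labelling_def by auto
  moreover have "Suc (m - 1) mod m = 0" using m by simp
  moreover have "m - 1 = Suc x mod m \<longleftrightarrow> x = m - 2"
    using assms(3) m by (cases "Suc x = m") auto
  ultimately show ?thesis using assms(1) by (auto simp: adjacent_iff)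
qed

lemma cycle_out_parity:
  assumes "is_quiver Q" "cycle_labelling Q S m f"
  shows "(\<Sum>x\<in>S. out_parity Q (f (m - 1)) x) =
    out_parity Q (f (m - 1)) (f (m - 2)) + out_parity Q (f (m - 1)) (f 0)"
proof -
  have m: "m \<ge> 3" and f: "bij_betw f {..<m} S"
    using assms(2) by (auto simp: cycle_labelling_def)
  have ne: "f (m - 2) \<noteq> f 0"
    using f m by (auto simp: bij_betw_def dest!: inj_onD)
  have "(\<Sum>x\<in>S. out_parity Q (f (m - 1)) x) = (\<Sum>x\<in>{f (m - 2), f 0}. out_parity Q (f (m - 1)) x)"
  proof (rule sum.mono_neutral_right)
    show "\<forall>x\<in>S - {f (m - 2), f 0}. out_parity Q (f (m - 1)) x = 0"
    proof
      fix y assume y: "y \<in> S - {f (m - 2), f 0}"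
      then obtain x where "x < m" "y = f x" using f by (auto simp: bij_betw_def)
      then have "quiver_matrix Q (f (m - 1)) y = 0"
        using cycle_labelling_neighbours[OF assms, of x] y by auto
      then show "out_parity Q (f (m - 1)) y = 0" by (simp add: out_parity_def)
    qed
  qed (use f m in \<open>auto simp: bij_betw_def\<close>)
  then show ?thesis using ne by simp
qed

text \<open>An entry away from k changes only if a directed path of length two through k joins its
  indices.\<close>

lemma mutate_matrix_off:
  assumes "a \<noteq> k" "b \<noteq> k" "quiver_matrix Q a k = 0 \<or> quiver_matrix Q k b = 0
    \<or> quiver_matrix Q a k * quiver_matrix Q k b < 0"
  shows "quiver_matrix (mutate k Q) a b = quiver_matrix Q a b"
  using assms by (auto simp: quiver_matrix_mutate mutate_matrix_def)

context
  fixes Q :: "'v::finite quiver"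
  assumes Q: "mutation_finite Q" and card: "CARD('v) \<ge> 3"
begin

text \<open>At least four vertices ensure that the two neighbours of the last one are not adjacent,
  so that \<open>path_weights\<close> applies.\<close>

lemma cycle_weights:
  assumes f: "cycle_labelling Q S m f" and m: "m \<ge> 4"
  shows "\<bar>quiver_matrix Q (f (m - 2)) (f (m - 1))\<bar> = 1" "\<bar>quiver_matrix Q (f (m - 1)) (f 0)\<bar> = 1"
    "quiver_matrix Q (f (m - 2)) (f 0) = 0"
proof -
  have q: "is_quiver Q" using Q by (simp add: mutation_finite_def)
  have "Suc 0 mod m = 1" "Suc (m - 2) mod m = m - 1" using m by auto
  then have "\<not> adjacent Q (f (m - 2)) (f 0)"
    using f m unfolding cycle_labelling_def by auto
  then show 0: "quiver_matrix Q (f (m - 2)) (f 0) = 0" using q by (simp add: adjacent_iff)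
  have "f (m - 2) \<noteq> f 0"
    using f m by (auto simp: cycle_labelling_def bij_betw_def dest!: inj_onD)
  moreover have "quiver_matrix Q (f (m - 1)) (f 0) \<noteq> 0" "quiver_matrix Q (f (m - 1)) (f (m - 2)) \<noteq> 0"
    using cycle_labelling_neighbours[OF q f] m by auto
  moreover from this have "quiver_matrix Q (f (m - 2)) (f (m - 1)) \<noteq> 0"
    using matrix_skew[of Q "f (m - 1)" "f (m - 2)"] by simp
  ultimately show "\<bar>quiver_matrix Q (f (m - 2)) (f (m - 1))\<bar> = 1"
    "\<bar>quiver_matrix Q (f (m - 1)) (f 0)\<bar> = 1"
    using path_weights[OF Q card] 0 by blast+
qed

text \<open>Mutation bridges the passed vertex by an edge of the same sign between its neighbours.
  Two steps of sign s become one and all others stay, so both signs still occur.\<close>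

lemma mixed_shrink:
  assumes f: "mixed_labelling Q S m f" and m: "m \<ge> 4"
    and pass: "quiver_matrix Q (f (m - 2)) (f (m - 1)) = s" "quiver_matrix Q (f (m - 1)) (f 0) = s"
  shows "mixed_labelling (mutate (f (m - 1)) Q) (S - {f (m - 1)}) (m - 1) f"
proof -
  have q: "is_quiver Q" using Q by (simp add: mutation_finite_def)
  have cl: "cycle_labelling Q S m f" using f by (simp add: mixed_labelling_def)
  define k where "k = f (m - 1)"
  let ?Q = "mutate k Q" and ?B = "quiver_matrix Q" and ?B' = "quiver_matrix (mutate k Q)"
  have bij: "bij_betw f {..<m} S" and adj: "\<And>x y. x < m \<Longrightarrow> y < m \<Longrightarrow>
      ?B (f x) (f y) \<noteq> 0 \<longleftrightarrow> y = Suc x mod m \<or> x = Suc y mod m"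
    using cl by (auto simp: cycle_labelling_def adjacent_iff[OF q])
  have inj: "f x = f y \<longleftrightarrow> x = y" if "x < m" "y < m" for x y
    using bij that by (auto simp: bij_betw_def dest!: inj_onD)
  have s1: "\<bar>s\<bar> = 1" and B0: "?B (f (m - 2)) (f 0) = 0"
    using cycle_weights[OF cl m] pass by auto
  have nbr: "?B k (f x) \<noteq> 0 \<longleftrightarrow> x = m - 2 \<or> x = 0" if "x < m" for x
    using cycle_labelling_neighbours[OF q cl that] by (simp add: k_def)
  have nbr': "?B (f x) k \<noteq> 0 \<longleftrightarrow> x = m - 2 \<or> x = 0" if "x < m" for x
    using nbr[OF that] matrix_skew[of Q "f x" k] by simp
  have k: "f x \<noteq> k" if "x < m - 1" for x
    using inj[of x "m - 1"] that by (auto simp: k_def)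
  have new: "?B' (f (m - 2)) (f 0) = s"
  proof -
    have "s * s = 1" "sgn s = s" using s1 by (auto simp: abs_if split: if_splits)
    then show ?thesis
      using k[of "m - 2"] k[of 0] m pass B0
      by (auto simp: quiver_matrix_mutate mutate_matrix_def k_def)
  qed
  have off: "?B' (f x) (f y) = ?B (f x) (f y)"
    if "x < m - 1" "y < m - 1" "\<not> (x = m - 2 \<and> y = 0)" "\<not> (x = 0 \<and> y = m - 2)" for x y
  proof (rule mutate_matrix_off)
    show "f x \<noteq> k" "f y \<noteq> k" using k that by auto
    have "?B (f x) k * ?B k (f x) \<le> 0" for x
      using matrix_skew[of Q "f x" k] by simp
    then have "?B (f x) k * ?B k (f x) < 0" if "?B (f x) k \<noteq> 0" for x
      using that matrix_skew[of Q "f x" k] by (simp add: less_le)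
    then show "?B (f x) k = 0 \<or> ?B k (f y) = 0 \<or> ?B (f x) k * ?B k (f y) < 0"
    proof -
      have "x < m" "y < m" using that by auto
      then show ?thesis
        using nbr'[of x] nbr[of y] that \<open>\<And>x. ?B (f x) k \<noteq> 0 \<Longrightarrow> ?B (f x) k * ?B k (f x) < 0\<close>[of x]
        by (cases "x = y") auto
    qed
  qed
  have modS: "Suc x mod (m - 1) = Suc x mod m" if "x < m - 2" for x
    using that by auto
  have e: "Suc (m - 2) = m - 1" "(m - 1) mod m = m - 1" "Suc (m - 1) mod m = 0" "0 < m - 1"
    using m by simp_all
  have adj': "?B' (f x) (f y) \<noteq> 0 \<longleftrightarrow> y = Suc x mod (m - 1) \<or> x = Suc y mod (m - 1)"
    if xy: "x < m - 1" "y < m - 1" for x y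
  proof -
    consider "x = m - 2" "y = 0" | "x = 0" "y = m - 2" | "\<not> (x = m - 2 \<and> y = 0)" "\<not> (x = 0 \<and> y = m - 2)"
      by blast
    then show ?thesis
    proof cases
      case 1
      then show ?thesis using new s1 by (auto simp: e)
    next
      case 2
      then show ?thesis using new s1 matrix_skew[of ?Q "f 0" "f (m - 2)"] by (auto simp: e)
    next
      case 3
      have "y = Suc x mod (m - 1) \<longleftrightarrow> y = Suc x mod m"
        using modS[of x] xy 3 by (cases "x = m - 2") (auto simp: e)
      moreover have "x = Suc y mod (m - 1) \<longleftrightarrow> x = Suc y mod m"
        using modS[of y] xy 3 by (cases "y = m - 2") (auto simp: e)
      moreover have "?B (f x) (f y) \<noteq> 0 \<longleftrightarrow> y = Suc x mod m \<or> x = Suc y mod m"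
        by (intro adj) (use xy in auto)
      ultimately show ?thesis unfolding off[OF xy 3] by blast
    qed
  qed
  have "bij_betw f {..<m - 1} (S - {k})"
  proof -
    have "{..<m} - {m - 1} = {..<m - 1}" using m by auto
    moreover have "f ` {..<m} = S" "inj_on f {..<m}" using bij by (auto simp: bij_betw_def)
    moreover have "f ` ({..<m} - {m - 1}) = f ` {..<m} - f ` {m - 1}"
      using m by (intro inj_on_image_set_diff[OF \<open>inj_on f {..<m}\<close>]) auto
    ultimately show ?thesis
      by (auto simp: k_def bij_betw_def intro: inj_on_subset)
  qed
  then have cl': "cycle_labelling ?Q (S - {k}) (m - 1) f"
    using adj' m by (simp add: cycle_labelling_def adjacent_iff is_quiver_mutate)
  \<comment> \<open>The old steps m - 2 and m - 1 both correspond to the step m - 2 that closes the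
    shorter cycle.\<close>
  have sign: "\<exists>y<m - 1. ?B' (f y) (f (Suc y mod (m - 1))) = ?B (f x) (f (Suc x mod m))"
    if "x < m" for x
  proof (cases "x < m - 2")
    case True
    then have "?B' (f x) (f (Suc x)) = ?B (f x) (f (Suc x))" by (intro off) (use m in auto)
    moreover have "Suc x mod (m - 1) = Suc x" "Suc x mod m = Suc x" using True by auto
    ultimately show ?thesis using True by (intro exI[of _ x]) auto
  next
    case False
    then have "x = m - 2 \<or> x = m - 1" using that by linarith
    then have "?B (f x) (f (Suc x mod m)) = s"
      by (elim disjE) (simp_all only: e pass)
    moreover have "m - 2 < m - 1" using m by simp
    ultimately show ?thesis
      using new by (intro exI[of _ "m - 2"]) (simp add: e)
  qed
  have "\<exists>y<m - 1. ?B' (f y) (f (Suc y mod (m - 1))) > 0"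
    "\<exists>y<m - 1. ?B' (f y) (f (Suc y mod (m - 1))) < 0"
  proof -
    from f obtain x y where x: "x < m" "?B (f x) (f (Suc x mod m)) > 0"
      and y: "y < m" "?B (f y) (f (Suc y mod m)) < 0"
      unfolding mixed_labelling_def by blast
    show "\<exists>y<m - 1. ?B' (f y) (f (Suc y mod (m - 1))) > 0"
      using sign[OF x(1)] x(2) by auto
    show "\<exists>y<m - 1. ?B' (f y) (f (Suc y mod (m - 1))) < 0"
      using sign[OF y(1)] y(2) by auto
  qed
  then show ?thesis
    using cl' unfolding mixed_labelling_def k_def by blast
qed

text \<open>Exactly one of the two neighbours on the cycle is an out-neighbour, along an edge of
  weight 1, so the coordinate of the passed vertex is switched off.\<close>

lemma passing_parity:
  assumes "mixed_labelling Q S m f" "\<bar>s\<bar> = 1"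
    and pass: "quiver_matrix Q (f (m - 2)) (f (m - 1)) = s" "quiver_matrix Q (f (m - 1)) (f 0) = s"
  shows "mutate_vector Q (f (m - 1)) (indicator_vector S) = indicator_vector (S - {f (m - 1)})"
proof -
  have q: "is_quiver Q" using Q by (simp add: mutation_finite_def)
  have cl: "cycle_labelling Q S m f" using assms(1) by (simp add: mixed_labelling_def)
  then have "f (m - 1) \<in> S" by (auto simp: cycle_labelling_def bij_betw_def)
  moreover have "out_parity Q (f (m - 1)) (f (m - 2)) + out_parity Q (f (m - 1)) (f 0) = 1"
    unfolding out_parity_def
    using pass assms(2) matrix_skew[of Q "f (m - 1)" "f (m - 2)"]
    by (auto simp: abs_if max_def split: if_splits)
  ultimately show ?thesis
    unfolding mutate_indicator_vector[OF \<open>f (m - 1) \<in> S\<close>] cycle_out_parity[OF q cl] by simp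
qed

end

text \<open>The induction hypothesis appears as an assumption because the induction on m applies
  this case to two quivers with cycles of equal length: \<open>Q\<close> itself, and its mutation at
  a source or sink of the cycle.\<close>

lemma mixed_passing_radical:
  fixes Q :: "'v::finite quiver"
  assumes Q: "mutation_finite Q" and card: "CARD('v) \<ge> 3"
    and f: "mixed_labelling Q S m f"
    and pass: "quiver_matrix Q (f (m - 2)) (f (m - 1)) * quiver_matrix Q (f (m - 1)) (f 0) > 0"
    and IH: "\<And>R :: 'v quiver. \<And>T g. m \<ge> 4 \<Longrightarrow> mutation_finite R \<Longrightarrow>
        mixed_labelling R T (m - 1) g \<Longrightarrow> indicator_vector T \<in> radical_space R"
  shows "indicator_vector S \<in> radical_space Q"
proof -
  have q: "is_quiver Q" using Q by (simp add: mutation_finite_def)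
  have cl: "cycle_labelling Q S m f" using f by (simp add: mixed_labelling_def)
  then have m3: "m \<ge> 3" and bij: "bij_betw f {..<m} S" by (auto simp: cycle_labelling_def)
  define k where "k = f (m - 1)"
  let ?B = "quiver_matrix Q"
  have R: "mutation_finite (mutate k Q)" using Q by (rule mutation_finite_mutate)
  obtain s where s: "?B (f (m - 2)) k = s" "?B k (f 0) = s" "\<bar>s\<bar> = 1"
    and rad: "indicator_vector (S - {k}) \<in> radical_space (mutate k Q)"
  proof (cases "m \<ge> 4")
    case True
    have "\<bar>?B (f (m - 2)) (f (m - 1))\<bar> = 1" "\<bar>?B (f (m - 1)) (f 0)\<bar> = 1"
      using cycle_weights[OF Q card cl True] by auto
    then have "?B (f (m - 2)) (f (m - 1)) = ?B (f (m - 1)) (f 0)"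
      using pass by (auto simp: abs_if split: if_splits)
    then show thesis
      using mixed_shrink[OF Q card f True] IH[OF True R] that \<open>\<bar>?B (f (m - 1)) (f 0)\<bar> = 1\<close>
      unfolding k_def by blast
  next
    case False
    then have m: "m = 3" using m3 by simp
    \<comment> \<open>A non-oriented triangle passed through at k is acyclic with k in the middle.
      Its weights are then all 1, and mutation at k turns the opposite edge into a double
      edge.\<close>
    define x y z where "x = ?B (f 1) (f 2)" and "y = ?B (f 2) (f 0)" and "z = ?B (f 0) (f 1)"
    have xy: "x * y > 0" using pass m by (simp add: x_def y_def)
    have 3: "(\<exists>i<3. P i) \<longleftrightarrow> P 0 \<or> P 1 \<or> P 2" for P :: "nat \<Rightarrow> bool"
      by (auto simp: less_Suc_eq numeral_3_eq_3 numeral_2_eq_2)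
    have mixed: "(z > 0 \<or> x > 0 \<or> y > 0) \<and> (z < 0 \<or> x < 0 \<or> y < 0)"
      using f m unfolding mixed_labelling_def x_def y_def z_def
      by (simp add: 3 numeral_2_eq_2[symmetric])
    define s where "s = sgn x"
    have inj: "inj_on f {..<3}" using bij m by (simp add: bij_betw_def)
    have dist: "distinct [f 1, f 2, f 0]"
      using inj by (simp add: inj_on_eq_iff)
    have S: "S = {f 0, f 1, f 2}"
      using bij m by (auto simp: bij_betw_def lessThan_Suc numeral_3_eq_3 numeral_2_eq_2)
    have xyz: "x = s * int (nat \<bar>x\<bar>)" "y = s * int (nat \<bar>y\<bar>)" "?B (f 1) (f 0) = s * int (nat \<bar>z\<bar>)"
      "s * s = 1" "x \<noteq> 0" "y \<noteq> 0" "z \<noteq> 0"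
    proof -
      show "x \<noteq> 0" "y \<noteq> 0" using xy by auto
      then show "s * s = 1" by (simp add: s_def sgn_if)
      have y: "sgn y = s" using xy by (auto simp: s_def sgn_if zero_less_mult_iff)
      have z: "sgn z = - s" and "z \<noteq> 0"
        using xy mixed by (auto simp: s_def sgn_if zero_less_mult_iff)
      then show "z \<noteq> 0" by simp
      show "x = s * int (nat \<bar>x\<bar>)" by (simp add: s_def sgn_mult_abs)
      show "y = s * int (nat \<bar>y\<bar>)" using sgn_mult_abs[of y] by (simp add: y)
      have "?B (f 1) (f 0) = - z" unfolding z_def by (rule matrix_skew)
      also have "\<dots> = s * int (nat \<bar>z\<bar>)" using sgn_mult_abs[of z] by (simp add: z)
      finally show "?B (f 1) (f 0) = s * int (nat \<bar>z\<bar>)" .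
    qed
    then have 1: "nat \<bar>x\<bar> = 1 \<and> nat \<bar>y\<bar> = 1 \<and> nat \<bar>z\<bar> \<le> 1"
      by (intro triangle_weights[OF Q card dist, of s]) (auto simp: x_def y_def)
    then have eqs: "x = s" "y = s" "?B (f 1) (f 0) = s" using xyz by auto
    have "quiver_matrix (mutate k Q) (f 1) (f 0) = 2 * s"
      using mutate_middle(3)[OF dist xyz(4), of Q 1 1] eqs m
      by (simp add: x_def y_def k_def)
    moreover have s1: "\<bar>s\<bar> = 1" using xyz(4) by (auto simp: zmult_eq_1_iff)
    ultimately have "indicator_vector {f 1, f 0} \<in> radical_space (mutate k Q)"
      using double_edge_radical[OF R card] by simp
    moreover have "S - {k} = {f 1, f 0}" using dist m by (auto simp: S k_def)
    ultimately show thesis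
      using that[of s] eqs s1 m by (simp add: k_def x_def y_def)
  qed
  then have "mutate_vector Q k (indicator_vector S) \<in> radical_space (mutate k Q)"
    using passing_parity[OF Q card f, of s] by (simp add: k_def)
  then show ?thesis by (simp add: mutate_vector_radical)
qed

lemma mixed_passing_radical_at:
  fixes Q :: "'v::finite quiver"
  assumes Q: "mutation_finite Q" and card: "CARD('v) \<ge> 3"
    and f: "mixed_labelling Q S m f" and x: "x < m"
    and pass: "quiver_matrix Q (f x) (f (Suc x mod m)) *
      quiver_matrix Q (f (Suc x mod m)) (f (Suc (Suc x mod m) mod m)) > 0"
    and IH: "\<And>R :: 'v quiver. \<And>T g. m \<ge> 4 \<Longrightarrow> mutation_finite R \<Longrightarrow>
        mixed_labelling R T (m - 1) g \<Longrightarrow> indicator_vector T \<in> radical_space R"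
  shows "indicator_vector S \<in> radical_space Q"
proof -
  have m: "m \<ge> 3" using f by (simp add: mixed_labelling_def cycle_labelling_def)
  \<comment> \<open>The shift by x + 2 moves the consecutive labels x, x + 1, x + 2 to m - 2, m - 1,
    0.\<close>
  have "m - 2 + (x + 2) = x + m" "m - 1 + (x + 2) = Suc x + m" using m by auto
  then have "(m - 2 + (x + 2)) mod m = x" "(m - 1 + (x + 2)) mod m = Suc x mod m"
    using x by (simp_all only: mod_add_self2 mod_less)
  moreover have "(0 + (x + 2)) mod m = Suc (Suc x mod m) mod m"
    by (simp add: mod_simps)
  ultimately show ?thesis
    using mixed_passing_radical[OF Q card mixed_labelling_rotate[OF f, of "x + 2"] _ IH] pass
    by (simp only:)
qed

text \<open>If no vertex is passed, sources and sinks alternate. Mutation at one of them changes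
  only its own two edges of the cycle, so the next vertex becomes passed. The indicator vector is
  fixed because the mutated vertex has none or two out-neighbours on the cycle, along edges of
  weight 1.\<close>

lemma mixed_radical:
  fixes Q :: "'v::finite quiver"
  assumes "mutation_finite Q" "CARD('v) \<ge> 3" "mixed_labelling Q S m f"
  shows "indicator_vector S \<in> radical_space Q"
  using assms
proof (induction m arbitrary: Q S f rule: less_induct)
  case (less m Q S f)
  note Q = less.prems(1) and card = less.prems(2) and f = less.prems(3)
  have cl: "cycle_labelling Q S m f" using f by (simp add: mixed_labelling_def)
  then have m3: "m \<ge> 3" and bij: "bij_betw f {..<m} S" by (auto simp: cycle_labelling_def)
  have IH: "indicator_vector T \<in> radical_space R"
    if "m \<ge> 4" "mutation_finite R" "mixed_labelling R T (m - 1) g" for R :: "'v quiver" and T g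
    using that less.IH[of "m - 1" R T g] card by simp
  have q: "is_quiver Q" using Q by (simp add: mutation_finite_def)
  define k where "k = f (m - 1)"
  let ?B = "quiver_matrix Q" and ?B' = "quiver_matrix (mutate k Q)"
  have adj: "\<And>x y. x < m \<Longrightarrow> y < m \<Longrightarrow>
      ?B (f x) (f y) \<noteq> 0 \<longleftrightarrow> y = Suc x mod m \<or> x = Suc y mod m"
    using cl by (auto simp: cycle_labelling_def adjacent_iff[OF q])
  show ?case
  proof (cases "\<exists>x<m. ?B (f x) (f (Suc x mod m)) * ?B (f (Suc x mod m)) (f (Suc (Suc x mod m) mod m)) > 0")
    case True
    then obtain x where x: "x < m"
      "?B (f x) (f (Suc x mod m)) * ?B (f (Suc x mod m)) (f (Suc (Suc x mod m) mod m)) > 0"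
      by blast
    show ?thesis by (rule mixed_passing_radical_at[OF Q card f x IH])
  next
    case False
    have nz: "?B (f x) (f (Suc x mod m)) \<noteq> 0" if "x < m" for x
    proof -
      have "Suc x mod m < m" using m3 by simp
      from adj[OF that this] show ?thesis by blast
    qed
    have alt: "?B (f x) (f (Suc x mod m)) * ?B (f (Suc x mod m)) (f (Suc (Suc x mod m) mod m)) < 0"
      if "x < m" for x
    proof -
      have "Suc x mod m < m" using m3 by simp
      then have "?B (f x) (f (Suc x mod m)) * ?B (f (Suc x mod m)) (f (Suc (Suc x mod m) mod m)) \<noteq> 0"
        using nz that by auto
      then show ?thesis using False that by (meson linorder_neqE_linordered_idom)
    qed
    have e: "Suc (m - 2) mod m = m - 1" "Suc (m - 1) mod m = 0" "Suc 0 mod m = 1" "Suc (m - 3) mod m = m - 2"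
    proof -
      have "Suc (m - 2) = m - 1" "Suc (m - 1) = m" "Suc (m - 3) = m - 2" using m3 by auto
      then show "Suc (m - 2) mod m = m - 1" "Suc (m - 1) mod m = 0" "Suc 0 mod m = 1" "Suc (m - 3) mod m = m - 2"
        using m3 by simp_all
    qed
    have alt1: "?B (f (m - 2)) k * ?B k (f 0) < 0"
      using alt[of "m - 2"] m3 by (simp add: e k_def)
    have alt2: "?B k (f 0) * ?B (f 0) (f 1) < 0"
      using alt[of "m - 1"] m3 by (simp add: e k_def)
    \<comment> \<open>Signs cannot alternate around a triangle: the product of the three negative
      products would be a square.\<close>
    have m: "m \<ge> 4"
    proof (rule ccontr)
      assume "\<not> m \<ge> 4"
      then have "m = 3" using m3 by simp
      then have "?B (f 0) (f 1) * ?B (f 1) (f 2) < 0"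
        using alt[of 0] by (simp add: numeral_2_eq_2[symmetric])
      then show False using alt1 alt2 \<open>m = 3\<close>
        by (auto simp: k_def mult_less_0_iff)
    qed
    have R: "mutation_finite (mutate k Q)" using Q by (rule mutation_finite_mutate)
    have inj: "f x = f y \<longleftrightarrow> x = y" if "x < m" "y < m" for x y
      using bij that by (auto simp: bij_betw_def dest!: inj_onD)
    have nbr: "?B k (f x) \<noteq> 0 \<longleftrightarrow> x = m - 2 \<or> x = 0" if "x < m" for x
      using cycle_labelling_neighbours[OF q cl that] by (simp add: k_def)
    have nbr': "?B (f x) k \<noteq> 0 \<longleftrightarrow> x = m - 2 \<or> x = 0" if "x < m" for x
      using nbr[OF that] matrix_skew[of Q "f x" k] by simp
    have on: "?B' k y = - ?B k y" "?B' y k = - ?B y k" for y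
      by (simp_all add: quiver_matrix_mutate mutate_matrix_def)
    have off: "?B' (f x) (f y) = ?B (f x) (f y)"
      if "x < m" "y < m" "f x \<noteq> k" "f y \<noteq> k" for x y
    proof (rule mutate_matrix_off)
      show "f x \<noteq> k" "f y \<noteq> k" using that by auto
      have "?B (f x) k * ?B k (f x) < 0" if "?B (f x) k \<noteq> 0"
        using that matrix_skew[of Q "f x" k] by (auto simp: zero_less_mult_iff neq_iff)
      moreover have "?B (f 0) k * ?B k (f (m - 2)) < 0"
        using alt1 matrix_skew[of Q "f 0" k] matrix_skew[of Q k "f (m - 2)"]
        by (simp add: mult.commute)
      ultimately show "?B (f x) k = 0 \<or> ?B k (f y) = 0 \<or> ?B (f x) k * ?B k (f y) < 0"
        using nbr'[OF that(1)] nbr[OF that(2)] alt1 by (cases "x = y") auto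
    qed
    have "?B' (f x) (f y) \<noteq> 0 \<longleftrightarrow> ?B (f x) (f y) \<noteq> 0" if "x < m" "y < m" for x y
      using off[OF that] on[of "f y"] on[of "f x"] by (cases "f x = k"; cases "f y = k") auto
    then have "cycle_labelling (mutate k Q) S m f"
      using cl by (auto simp: cycle_labelling_def adjacent_iff[OF q] adjacent_iff[OF is_quiver_mutate])
    moreover have "\<exists>x<m. ?B' (f x) (f (Suc x mod m)) > 0" "\<exists>x<m. ?B' (f x) (f (Suc x mod m)) < 0"
    proof -
      have "?B' (f (m - 2)) (f (Suc (m - 2) mod m)) = - ?B (f (m - 2)) k"
        "?B' (f (m - 1)) (f (Suc (m - 1) mod m)) = - ?B k (f 0)"
        unfolding e using on by (simp_all only: k_def)
      moreover have "m - 2 < m" "m - 1 < m" using m by auto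
      ultimately show "\<exists>x<m. ?B' (f x) (f (Suc x mod m)) > 0" "\<exists>x<m. ?B' (f x) (f (Suc x mod m)) < 0"
        using alt1 unfolding mult_less_0_iff by (metis neg_0_less_iff_less neg_less_0_iff_less)+
    qed
    ultimately have mixed: "mixed_labelling (mutate k Q) S m f"
      by (simp add: mixed_labelling_def)
    \<comment> \<open>The edge following the reversed one keeps its sign, so vertex 0 is now
      passed.\<close>
    have "?B' (f 0) (f 1) = ?B (f 0) (f 1)"
      using m inj[of 0 "m - 1"] inj[of 1 "m - 1"] by (intro off) (auto simp: k_def)
    then have "?B' (f (m - 1)) (f 0) * ?B' (f 0) (f 1) > 0"
      using alt2 on by (simp add: k_def)
    then have "?B' (f (m - 1)) (f (Suc (m - 1) mod m)) *
        ?B' (f (Suc (m - 1) mod m)) (f (Suc (Suc (m - 1) mod m) mod m)) > 0"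
      unfolding e .
    then have rad: "indicator_vector S \<in> radical_space (mutate k Q)"
      using m by (intro mixed_passing_radical_at[OF R card mixed, of "m - 1"] IH) auto
    have "out_parity Q k (f (m - 2)) + out_parity Q k (f 0) = 0"
    proof -
      have "\<bar>?B (f (m - 2)) k\<bar> = 1" "\<bar>?B k (f 0)\<bar> = 1"
        using cycle_weights[OF Q card cl m] by (simp_all add: k_def)
      then show ?thesis
        using alt1 matrix_skew[of Q k "f (m - 2)"] unfolding out_parity_def
        by (auto simp: abs_if max_def mult_less_0_iff split: if_splits)
    qed
    then have "(\<Sum>j\<in>S. out_parity Q k j) = 0"
      using cycle_out_parity[OF q cl] unfolding k_def by simp
    moreover have "k \<in> S" using bij m by (auto simp: k_def bij_betw_def)
    ultimately have "mutate_vector Q k (indicator_vector S) = indicator_vector S"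
      by (simp add: mutate_indicator_vector)
    then show ?thesis using rad mutate_vector_radical by metis
  qed
qed

theorem double_edge_or_nonoriented_cycle_radical:
  fixes Q :: "'v::finite quiver"
  assumes "mutation_finite Q" "CARD('v) \<ge> 3" "double_edge Q S \<or> nonoriented_cycle Q S"
  shows "indicator_vector S \<in> radical_space Q"
  using assms(3)
proof
  assume "double_edge Q S"
  then obtain i j where S: "S = {i, j}" "Q i j = 2" by (auto simp: double_edge_def)
  moreover have "is_quiver Q" using assms(1) by (simp add: mutation_finite_def)
  ultimately have "\<bar>quiver_matrix Q i j\<bar> = 2"
    unfolding is_quiver_def quiver_matrix_def by (metis abs_numeral diff_zero of_nat_0 of_nat_numeral zero_neq_numeral)
  then show ?thesis using double_edge_radical[OF assms(1,2)] S by simp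
next
  assume "nonoriented_cycle Q S"
  then show ?thesis
    using nonoriented_cycle_mixed mixed_radical assms by (metis mutation_finite_def)
qed

section \<open>Graph models of the matrix modulo 2\<close>

text \<open>
  Modulo 2, the matrix of \<open>Q\<close> is the intersection form of the edges of a connected multigraph
  without loops on the vertex set \<open>P\<close>; a vertex \<open>i\<close> of \<open>Q\<close> is the edge with end set \<open>e i\<close>.
  Connectedness is expressed by the absence of nontrivial cuts, which is the form in which it
  survives mutation.
\<close>

definition graph_model :: "'v quiver \<Rightarrow> 'p set \<Rightarrow> ('v \<Rightarrow> 'p set) \<Rightarrow> bool" where
  "graph_model Q P e \<longleftrightarrow> finite P \<and> (\<forall>i. e i \<subseteq> P \<and> card (e i) = 2) \<and>
     (\<forall>i j. even (quiver_matrix Q i j) \<longleftrightarrow> even (card (e i \<inter> e j))) \<and>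
     (\<forall>X\<subseteq>P. (\<forall>i. even (card (e i \<inter> X))) \<longrightarrow> X = {} \<or> X = P)"

definition boundary :: "('v::finite \<Rightarrow> 'p set) \<Rightarrow> bit^'v \<Rightarrow> 'p \<Rightarrow> bit" where
  "boundary e u p = (\<Sum>i\<in>UNIV. of_bool (p \<in> e i) * u $ i)"

definition cycle_space :: "('v::finite \<Rightarrow> 'p set) \<Rightarrow> (bit^'v) set" where
  "cycle_space e = {u. \<forall>p. boundary e u p = 0}"

lemma of_nat_card_Int:
  assumes "finite X"
  shows "(of_nat (card (A \<inter> X)) :: bit) = (\<Sum>p\<in>X. of_bool (p \<in> A))"
  using assms by (simp add: Int_commute)

lemma bit_eq_of_int_of_nat: "(of_int m :: bit) = of_nat n \<longleftrightarrow> (even m \<longleftrightarrow> even n)"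
  by (simp add: of_nat_bit of_int_bit)

lemma graph_model_mod2:
  assumes "graph_model Q P e"
  shows "(of_int (quiver_matrix Q i j) :: bit) = (\<Sum>p\<in>P. of_bool (p \<in> e i) * of_bool (p \<in> e j))"
proof -
  have P: "finite P" "e j \<subseteq> P" and par: "even (quiver_matrix Q i j) \<longleftrightarrow> even (card (e i \<inter> e j))"
    using assms by (auto simp: graph_model_def)
  have "(of_int (quiver_matrix Q i j) :: bit) = of_nat (card ((e i \<inter> e j) \<inter> P))"
    using par P(2) by (simp add: bit_eq_of_int_of_nat Int_absorb2 le_infI2)
  also have "\<dots> = (\<Sum>p\<in>P. of_bool (p \<in> e i \<inter> e j))"
    by (rule of_nat_card_Int[OF P(1)])
  also have "\<dots> = (\<Sum>p\<in>P. of_bool (p \<in> e i) * of_bool (p \<in> e j))"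
    by (rule sum.cong) auto
  finally show ?thesis .
qed

text \<open>Mutation at \<open>k\<close> slides edges along the edge \<open>k\<close>.\<close>

definition slide :: "'v quiver \<Rightarrow> 'v \<Rightarrow> ('v \<Rightarrow> 'p set) \<Rightarrow> 'v \<Rightarrow> 'p set" where
  "slide Q k e i = (if out_parity Q k i = 1 then sym_diff (e i) (e k) else e i)"

lemma of_bool_slide:
  "(of_bool (p \<in> slide Q k e i) :: bit) = of_bool (p \<in> e i) + out_parity Q k i * of_bool (p \<in> e k)"
  by (auto simp: slide_def)

text \<open>Sliding edges is adjoint to the involution on vectors. Hence degrees transfer without
  changing the vertices of the graph.\<close>

lemma boundary_slide: "boundary (slide Q k e) u p = boundary e (mutate_vector Q k u) p"
  unfolding boundary_def mutate_vector_sum of_bool_slide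
  by (simp add: algebra_simps sum.distrib sum_distrib_left)

lemma cycle_space_slide: "cycle_space (slide Q k e) = mutate_vector Q k ` cycle_space e"
  by (auto simp: cycle_space_def boundary_slide image_iff) (metis mutate_vector_involution)+

text \<open>The intersection form of slid edges expands to \<open>mutate_mod2\<close> plus a
  multiple of B_kk = 0. A slid edge keeps two ends because an odd weight means exactly one vertex in
  common with k. The cut condition carries over since k itself is not slid.\<close>

lemma graph_model_mutate:
  assumes G: "graph_model Q P e"
  shows "graph_model (mutate k Q) P (slide Q k e)"
proof -
  have P: "finite P" "\<And>i. e i \<subseteq> P" "\<And>i. card (e i) = 2"
    and par: "\<And>i j. even (quiver_matrix Q i j) \<longleftrightarrow> even (card (e i \<inter> e j))"
    and conn: "\<And>X. X \<subseteq> P \<Longrightarrow> (\<And>i. even (card (e i \<inter> X))) \<Longrightarrow> X = {} \<or> X = P"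
    using G by (auto simp: graph_model_def)
  have fin: "finite (e i)" for i using P finite_subset by blast
  have sub: "slide Q k e i \<subseteq> P" for i using P(2) by (auto simp: slide_def)
  have "card (slide Q k e i) = 2" for i
  proof (cases "out_parity Q k i = 1")
    case True
    then have "odd (max 0 (quiver_matrix Q k i))"
      by (simp add: out_parity_def of_int_bit)
    then have "odd (quiver_matrix Q k i)" by (auto simp: max_def split: if_splits)
    then have "odd (card (e k \<inter> e i))" using par by blast
    moreover have "card (e k \<inter> e i) \<le> 2" using card_mono[OF fin, of "e k \<inter> e i" k] P(3) by simp
    ultimately have 1: "card (e k \<inter> e i) = 1"
      by (cases "card (e k \<inter> e i)") (auto simp: le_Suc_eq numeral_2_eq_2)
    have "card (e i - e k) = 1" "card (e k - e i) = 1"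
      using 1 fin P(3) by (simp_all add: card_Diff_subset_Int Int_commute)
    then have "card (sym_diff (e i) (e k)) = 2"
      using fin by (subst card_Un_disjoint) auto
    then show ?thesis using True by (simp add: slide_def)
  qed (simp add: slide_def P(3))
  moreover have "even (quiver_matrix (mutate k Q) i j) \<longleftrightarrow>
      even (card (slide Q k e i \<inter> slide Q k e j))" for i j
  proof -
    let ?B = "\<lambda>i j. of_int (quiver_matrix Q i j) :: bit" and ?m = "out_parity Q k"
    have "(of_nat (card ((slide Q k e i \<inter> slide Q k e j) \<inter> P)) :: bit) =
        (\<Sum>p\<in>P. of_bool (p \<in> slide Q k e i \<inter> slide Q k e j))"
      by (rule of_nat_card_Int[OF P(1)])
    also have "\<dots> = (\<Sum>p\<in>P. of_bool (p \<in> slide Q k e i) * of_bool (p \<in> slide Q k e j))"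
      by (rule sum.cong) auto
    also have "\<dots> = ?B i j + ?B i k * ?m j + ?m i * ?B k j + ?m i * ?m j * ?B k k"
      unfolding graph_model_mod2[OF G] of_bool_slide
      by (simp add: algebra_simps sum.distrib sum_distrib_left del: matrix_self)
    also have "\<dots> = of_int (quiver_matrix (mutate k Q) i j)"
      by (simp add: mutate_mod2)
    finally show ?thesis
      using sub[of j] by (simp add: bit_eq_of_int_of_nat[symmetric] Int_absorb2 le_infI2)
  qed
  moreover have "X = {} \<or> X = P" if X: "X \<subseteq> P" "\<And>i. even (card (slide Q k e i \<inter> X))" for X
  proof (rule conn[OF X(1)])
    have fX: "finite X" using X(1) P(1) finite_subset by blast
    have 0: "(of_nat (card (slide Q k e i \<inter> X)) :: bit) = 0" for i
      using X(2) by (simp add: of_nat_bit)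
    have "(of_nat (card (slide Q k e i \<inter> X)) :: bit) =
        of_nat (card (e i \<inter> X)) + out_parity Q k i * of_nat (card (e k \<inter> X))" for i
      unfolding of_nat_card_Int[OF fX] of_bool_slide
      by (simp add: sum.distrib sum_distrib_left)
    then have eq: "of_nat (card (e i \<inter> X)) + out_parity Q k i * of_nat (card (e k \<inter> X)) = (0 :: bit)" for i
      using 0 by simp
    from eq[of k] have "(of_nat (card (e k \<inter> X)) :: bit) = 0" by simp
    then have "(of_nat (card (e i \<inter> X)) :: bit) = 0" for i using eq[of i] by simp
    then show "even (card (e i \<inter> X))" for i by (simp add: of_nat_bit)
  qed
  ultimately show ?thesis using P(1) sub by (auto simp: graph_model_def)
qed

lemma subspace_cycle_space: "vec.subspace (cycle_space e)"
  by (auto simp: vec.subspace_def cycle_space_def boundary_def algebra_simps sum.distrib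
      simp flip: sum_distrib_left)

lemma boundary_add: "boundary e (u + v) p = boundary e u p + boundary e v p"
  by (simp add: boundary_def algebra_simps sum.distrib)

lemma boundary_indicator: "boundary e (indicator_vector S) p = (\<Sum>i\<in>S. of_bool (p \<in> e i))"
  unfolding boundary_def by (rule sum_indicator_vector)

text \<open>Entry i of the product counts, modulo 2, the odd-degree vertices of u lying on edge i.
  For a radical vector the set of odd-degree vertices thus meets every edge evenly, and the cut
  condition leaves only the empty set and \<open>P\<close>.\<close>

lemma radical_space_graph:
  assumes G: "graph_model Q P e"
  shows "u \<in> radical_space Q \<longleftrightarrow> u \<in> cycle_space e \<or> (\<forall>p\<in>P. boundary e u p = 1)"
proof -
  have P: "finite P" "\<And>i. e i \<subseteq> P" "\<And>i. card (e i) = 2"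
    and conn: "\<And>X. X \<subseteq> P \<Longrightarrow> (\<And>i. even (card (e i \<inter> X))) \<Longrightarrow> X = {} \<or> X = P"
    using G by (auto simp: graph_model_def)
  define X where "X = {p \<in> P. boundary e u p = 1}"
  have fX: "finite X" and XP: "X \<subseteq> P" using P(1) by (auto simp: X_def)
  have sum: "(\<Sum>j\<in>UNIV. of_int (quiver_matrix Q i j) * u $ j) = (of_nat (card (e i \<inter> X)) :: bit)" for i
  proof -
    have "(\<Sum>j\<in>UNIV. of_int (quiver_matrix Q i j) * u $ j) =
        (\<Sum>j\<in>UNIV. \<Sum>p\<in>P. of_bool (p \<in> e i) * (of_bool (p \<in> e j) * u $ j))"
      unfolding graph_model_mod2[OF G] by (simp add: sum_distrib_right mult.assoc)
    also have "\<dots> = (\<Sum>p\<in>P. of_bool (p \<in> e i) * boundary e u p)"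
      unfolding boundary_def by (subst sum.swap) (simp only: sum_distrib_left)
    also have "\<dots> = (\<Sum>p\<in>P. if p \<in> X then of_bool (p \<in> e i) else 0)"
      by (rule sum.cong) (auto simp: X_def)
    also have "\<dots> = (\<Sum>p\<in>X. of_bool (p \<in> e i))"
      using P(1) XP by (simp add: sum.inter_restrict[symmetric] Int_absorb1)
    finally show ?thesis using of_nat_card_Int[OF fX] by metis
  qed
  have off: "boundary e u p = 0" if "p \<notin> P" for p
    using that P(2) by (auto simp: boundary_def intro!: sum.neutral)
  have "u \<in> radical_space Q \<longleftrightarrow> (\<forall>i. even (card (e i \<inter> X)))"
    unfolding radical_space_iff sum by (simp add: of_nat_bit)
  also have "\<dots> \<longleftrightarrow> X = {} \<or> X = P"
    using conn[OF XP] P by (auto simp: Int_absorb2)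
  also have "X = {} \<longleftrightarrow> u \<in> cycle_space e"
    using off by (auto simp: X_def cycle_space_def)
  also have "X = P \<longleftrightarrow> (\<forall>p\<in>P. boundary e u p = 1)"
    by (auto simp: X_def)
  finally show ?thesis .
qed

section \<open>Cycle spaces and basic radical vectors\<close>

lemma support_indicator [simp]: "support (indicator_vector S) = S"
  by (auto simp: support_def indicator_vector_def)

lemma indicator_support: "indicator_vector (support u) = u"
proof (rule vec_eq_iff[THEN iffD2], rule allI)
  fix i
  show "indicator_vector (support u) $ i = u $ i"
    by (cases "u $ i") (simp_all add: indicator_vector_def support_def)
qed

lemma vec_bit_add_self [simp]: "u + u = (0 :: bit^'v)"
  by (simp add: vec_eq_iff)

lemma subspace_basic_radical_space: "vec.subspace (basic_radical_space Q)"
  by (simp add: basic_radical_space_def)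

lemma basic_radical_space_subset: "basic_radical_space Q \<subseteq> radical_space Q"
  unfolding basic_radical_space_def
  by (rule vec.span_minimal) (auto simp: basic_radical_vectors_def subspace_radical_space)

lemma basic_radicalI:
  assumes "indicator_vector S \<in> radical_space Q" "card S = 2 \<or> is_cycle Q S"
  shows "indicator_vector S \<in> basic_radical_space Q"
  unfolding basic_radical_space_def
  by (rule vec.span_base) (use assms in \<open>simp add: basic_radical_vectors_def\<close>)

lemma basic_radical_add:
  "u \<in> basic_radical_space Q \<Longrightarrow> v \<in> basic_radical_space Q \<Longrightarrow> u + v \<in> basic_radical_space Q"
  by (rule vec.subspace_add[OF subspace_basic_radical_space])

text \<open>
  Walk along edges of the support, never turning back, until a vertex is met again for the first
  time.
\<close>

lemma ex_closed_trail:
  fixes e :: "'v::finite \<Rightarrow> 'p set"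
  assumes fin: "finite P" and e: "\<And>i. e i \<subseteq> P" "\<And>i. card (e i) = 2"
    and ne: "S \<noteq> {}"
    and deg: "\<And>i p. i \<in> S \<Longrightarrow> p \<in> e i \<Longrightarrow> \<exists>j\<in>S. j \<noteq> i \<and> p \<in> e j"
  shows "\<exists>m g v. m \<ge> 2 \<and> inj_on v {..<m} \<and> v m = v 0 \<and> inj_on g {..<m} \<and> g ` {..<m} \<subseteq> S \<and>
    (\<forall>z<m. e (g z) = {v z, v (Suc z)})"
proof -
  \<comment> \<open>A state is a vertex with the edge to be traversed next; \<open>?R\<close> goes
    to the other end and takes a different edge there.\<close>
  let ?P = "\<lambda>_ :: nat. \<lambda>x. snd x \<in> S \<and> fst x \<in> e (snd x)"
  let ?R = "\<lambda>_ :: nat. \<lambda>x y. fst y \<in> e (snd x) \<and> fst y \<noteq> fst x \<and> snd y \<noteq> snd x"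
  have two: "\<exists>q. q \<in> e i \<and> q \<noteq> p" for i p
  proof (rule ccontr)
    assume "\<not> ?thesis"
    then have "e i \<subseteq> {p}" by auto
    then show False using card_mono[of "{p}" "e i"] e(2)[of i] by auto
  qed
  have "\<exists>f. \<forall>n. ?P n (f n) \<and> ?R n (f n) (f (Suc n))"
  proof (rule dependent_nat_choice)
    obtain i where "i \<in> S" using ne by blast
    moreover obtain p where "p \<in> e i" using two by blast
    ultimately show "\<exists>x. ?P 0 x" by (intro exI[of _ "(p, i)"]) simp
  next
    fix x n assume x: "?P n x"
    obtain q where q: "q \<in> e (snd x)" "q \<noteq> fst x" using two by blast
    then obtain j where "j \<in> S" "j \<noteq> snd x" "q \<in> e j" using deg x by blast
    then show "\<exists>y. ?P (Suc n) y \<and> ?R n x y" using q by (intro exI[of _ "(q, j)"]) simp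
  qed
  then obtain f where f: "\<And>n. ?P n (f n)" "\<And>n. ?R n (f n) (f (Suc n))" by blast
  define w h where "w n = fst (f n)" and "h n = snd (f n)" for n
  have wh: "h n \<in> S" "w n \<in> e (h n)" "w (Suc n) \<in> e (h n)" "w (Suc n) \<noteq> w n" "h (Suc n) \<noteq> h n" for n
    using f[of n] by (auto simp: w_def h_def)
  have eh: "e (h n) = {w n, w (Suc n)}" for n
  proof -
    have "finite (e (h n))" using e(1) fin finite_subset by blast
    moreover have "{w n, w (Suc n)} \<subseteq> e (h n)" using wh by blast
    moreover have "card {w n, w (Suc n)} = card (e (h n))" using wh(4)[of n] e(2) by (auto simp: card_insert_if)
    ultimately show ?thesis using card_subset_eq by blast
  qed
  have "range w \<subseteq> P" using wh(2) e(1) by blast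
  then have "finite (range w)" using fin finite_subset by blast
  then have "\<not> inj w" using finite_imageD[of w UNIV] by auto
  then obtain a b where ab: "w a = w b" "a < b"
    unfolding inj_def by (metis nat_neq_iff)
  \<comment> \<open>The least distance between equal vertices, over all starting points, makes the
    vertices in between distinct.\<close>
  define Rep where "Rep m \<longleftrightarrow> m > 0 \<and> (\<exists>x. w x = w (x + m))" for m
  have "Rep (b - a)" unfolding Rep_def using ab by (intro conjI exI[of _ a]) auto
  then obtain m where m: "Rep m" and least: "\<And>l. l < m \<Longrightarrow> \<not> Rep l"
    using exists_least_iff[of Rep] by blast
  then obtain x where x: "m > 0" "w x = w (x + m)" by (auto simp: Rep_def)
  have wne: "w y \<noteq> w (y + l)" if "0 < l" "l < m" for y l
    using least[of l] that by (auto simp: Rep_def)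
  define v g where "v z = w (x + z)" and "g z = h (x + z)" for z
  have eg: "e (g z) = {v z, v (Suc z)}" for z by (simp add: g_def v_def eh)
  have vne: "v a \<noteq> v b" if "a < b" "b < m" for a b
    using wne[of "b - a" "x + a"] that by (simp add: v_def)
  have v0: "v m = v 0" using x by (simp add: v_def)
  have m2: "m \<ge> 2"
  proof (rule ccontr)
    assume "\<not> m \<ge> 2"
    then have "m = 1" using x by simp
    then show False using x(2) wh(4)[of x] by simp
  qed
  have inj_v: "inj_on v {..<m}"
    by (rule linorder_inj_onI) (use vne in auto)
  \<comment> \<open>A repeated edge would be traversed in opposite directions, which forces m = 2;
    but consecutive edges of the walk differ.\<close>
  have "g a \<noteq> g b" if "a < b" "b < m" for a b
  proof
    assume eq: "g a = g b"
    then have *: "{v a, v (Suc a)} = {v b, v (Suc b)}" using eg by metis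
    have "v a \<noteq> v b" using vne that by blast
    then have 1: "v a = v (Suc b)" "v (Suc a) = v b" using * by (auto simp: doubleton_eq_iff)
    have "Suc b = m"
      using 1(1) vne[of a "Suc b"] that by force
    moreover have "a = 0"
      using 1(1) v0 vne[of 0 a] that \<open>Suc b = m\<close> by (cases "a = 0") auto
    moreover have "b = Suc a" using 1(2) vne[of "Suc a" b] that by (cases "Suc a < b") auto
    ultimately have "b = Suc 0" by simp
    then show False using eq wh(5)[of x] \<open>a = 0\<close> by (simp add: g_def)
  qed
  then have "inj_on g {..<m}" by (intro linorder_inj_onI) auto
  moreover have "g ` {..<m} \<subseteq> S" using wh(1) by (auto simp: g_def)
  ultimately show ?thesis using m2 inj_v v0 eg by blast
qed

text \<open>Modulo 2, incidence with an edge of the trail is the difference of the indicators of its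
  two ends, so the degree telescopes.\<close>

lemma boundary_closed_trail:
  assumes "inj_on g {..<m}" "inj_on v {..<m}" "m \<ge> 2" "v m = v 0" "\<And>z. z < m \<Longrightarrow> e (g z) = {v z, v (Suc z)}"
  shows "indicator_vector (g ` {..<m}) \<in> cycle_space e"
  unfolding cycle_space_def
proof (rule CollectI, rule allI)
  fix p
  let ?a = "\<lambda>z. of_bool (p = v z) :: bit"
  have ne: "v z \<noteq> v (Suc z)" if "z < m" for z
  proof (cases "Suc z = m")
    case True
    then show ?thesis using assms(2,3,4) by (auto simp: inj_on_eq_iff)
  next
    case False
    then have "Suc z < m" using that by simp
    then show ?thesis using assms(2) that by (auto simp: inj_on_eq_iff)
  qed
  have "boundary e (indicator_vector (g ` {..<m})) p = (\<Sum>z<m. of_bool (p \<in> e (g z)))"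
    unfolding boundary_indicator by (simp add: sum.reindex[OF assms(1)] comp_def)
  also have "\<dots> = (\<Sum>z<m. ?a (Suc z) - ?a z)"
  proof (rule sum.cong)
    fix z assume "z \<in> {..<m}"
    then have z: "z < m" by simp
    show "of_bool (p \<in> e (g z)) = ?a (Suc z) - ?a z"
      using assms(5)[OF z] ne[OF z] by auto
  qed simp
  also have "\<dots> = ?a m - ?a 0" by (rule sum_lessThan_telescope)
  also have "\<dots> = 0" using assms(4) by simp
  finally show "boundary e (indicator_vector (g ` {..<m})) p = 0" .
qed

lemma boundary_pair:
  "i \<noteq> j \<Longrightarrow> boundary e (indicator_vector {i, j}) p = of_bool (p \<in> e i) + of_bool (p \<in> e j)"
  unfolding boundary_indicator by simp

locale quiver_graph =
  fixes Q :: "'v::finite quiver" and P :: "'p set" and e :: "'v \<Rightarrow> 'p set"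
  assumes Q: "mutation_finite Q" and card: "CARD('v) \<ge> 3" and G: "graph_model Q P e"
begin

lemma finite_P: "finite P" and e_subset: "e i \<subseteq> P" and card_e: "card (e i) = 2"
  and parity: "even (quiver_matrix Q i j) \<longleftrightarrow> even (card (e i \<inter> e j))"
  using G by (auto simp: graph_model_def)

lemma finite_e [simp]: "finite (e i)"
  using e_subset finite_P finite_subset by blast

lemma is_quiver: "is_quiver Q" and connected: "connected_quiver Q"
  using Q by (auto simp: mutation_finite_def)

lemma cycle_space_radical: "u \<in> cycle_space e \<Longrightarrow> u \<in> radical_space Q"
  using radical_space_graph[OF G] by blast

lemma full_boundary_radical: "(\<And>p. p \<in> P \<Longrightarrow> boundary e u p = 1) \<Longrightarrow> u \<in> radical_space Q"
  using radical_space_graph[OF G] by blast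

text \<open>The entry is even, so being non-zero it is a double edge and its vector is radical. The
  degree is odd at one end and hence everywhere, so the two edges cover \<open>P\<close>. For any
  other size of \<open>P\<close>, adjacency in \<open>Q\<close> implies that the edges meet.\<close>

lemma disjoint_edges:
  assumes "e i \<inter> e j = {}" "quiver_matrix Q i j \<noteq> 0"
  shows "card P = 4" "indicator_vector {i, j} \<in> radical_space Q"
proof -
  have "even (quiver_matrix Q i j)" using parity[of i j] assms(1) by simp
  moreover have "\<bar>quiver_matrix Q i j\<bar> \<le> 2" by (rule weight_le_2[OF Q card])
  moreover from calculation have "quiver_matrix Q i j \<noteq> 1" "quiver_matrix Q i j \<noteq> - 1" by auto
  ultimately have "\<bar>quiver_matrix Q i j\<bar> = 2" using assms(2) by linarith
  then show rad: "indicator_vector {i, j} \<in> radical_space Q"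
    by (rule double_edge_radical[OF Q card])
  have ij: "i \<noteq> j" using assms(2) by auto
  have b: "boundary e (indicator_vector {i, j}) p = of_bool (p \<in> e i) + of_bool (p \<in> e j)" for p
    by (rule boundary_pair[OF ij])
  have "e i \<noteq> {}" using card_e[of i] by auto
  then obtain q where "q \<in> e i" "q \<notin> e j" using assms(1) by blast
  then have "boundary e (indicator_vector {i, j}) q = 1" unfolding b by simp
  then have "indicator_vector {i, j} \<notin> cycle_space e" unfolding cycle_space_def by force
  then have full: "\<forall>p\<in>P. boundary e (indicator_vector {i, j}) p = 1"
    using rad radical_space_graph[OF G] by blast
  have "p \<in> e i \<union> e j" if "p \<in> P" for p
    using full that unfolding b by (cases "p \<in> e i"; cases "p \<in> e j") auto
  then have "P = e i \<union> e j" using e_subset by blast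
  then show "card P = 4" using assms(1) card_e by (simp add: card_Un_disjoint)
qed

text \<open>In general consecutive edges of the trail are adjacent in \<open>Q\<close> and no others
  are, which makes it an induced cycle. Two parallel edges are basic as a pair. A quadrilateral on
  all of a four-element \<open>P\<close> may have adjacent opposite edges, but it is the sum of two
  perfect matchings, each radical with two-element support.\<close>

lemma closed_trail_basic:
  assumes m: "m \<ge> 2" and v: "inj_on v {..<m}" "v m = v 0" and g: "inj_on g {..<m}"
    and eg: "\<And>z. z < m \<Longrightarrow> e (g z) = {v z, v (Suc z)}"
  shows "indicator_vector (g ` {..<m}) \<in> basic_radical_space Q"
proof -
  have cyc: "indicator_vector (g ` {..<m}) \<in> cycle_space e"
    by (rule boundary_closed_trail[OF g v(1) m v(2) eg])
  have eg': "e (g z) = {v z, v (Suc z mod m)}" if "z < m" for z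
    using eg[OF that] v(2) that by (cases "Suc z = m") auto
  have vi: "v a = v b \<longleftrightarrow> a = b" if "a < m" "b < m" for a b
    using v(1) that by (auto simp: inj_on_eq_iff)
  have disj: "e (g z) \<inter> e (g w) = {}"
    if "z < m" "w < m" "z \<noteq> w" "w \<noteq> Suc z mod m" "z \<noteq> Suc w mod m" for z w
  proof -
    have "Suc z mod m < m" "Suc w mod m < m" using m by auto
    moreover have "Suc z mod m \<noteq> Suc w mod m"
      using that add_mod_cancel[of z 1 m w] by auto
    ultimately show ?thesis using that vi by (auto simp: eg')
  qed
  consider "m = 2" | "m \<ge> 3" "card P = 4" "m \<noteq> 3" | "m \<ge> 3" "m = 3 \<or> card P \<noteq> 4" using m by linarith
  then show ?thesis
  proof cases
    case 1
    then have "card (g ` {..<m}) = 2" using card_image[OF g] by simp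
    then show ?thesis using basic_radicalI cycle_space_radical[OF cyc] by blast
  next
    case 2
    have "v ` {..<m} \<subseteq> P" using eg e_subset by fastforce
    then have "m \<le> 4" using card_mono[OF finite_P, of "v ` {..<m}"] card_image[OF v(1)] 2 by simp
    then have m4: "m = 4" using 2 by simp
    have pair: "indicator_vector {g z, g w} \<in> basic_radical_space Q"
      if "z < 4" "w < 4" "z \<noteq> w" "e (g z) \<inter> e (g w) = {}" for z w
    proof -
      have "card (e (g z) \<union> e (g w)) = card P"
        using that(4) card_e 2 by (simp add: card_Un_disjoint)
      then have P: "P = e (g z) \<union> e (g w)"
        using e_subset finite_P card_subset_eq[of P "e (g z) \<union> e (g w)"] by blast
      have ne: "g z \<noteq> g w" using g that m4 by (auto simp: inj_on_eq_iff)
      have "boundary e (indicator_vector {g z, g w}) p = 1" if "p \<in> P" for p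
        using that \<open>e (g z) \<inter> e (g w) = {}\<close> unfolding boundary_pair[OF ne] P by auto
      then have "indicator_vector {g z, g w} \<in> radical_space Q" by (rule full_boundary_radical)
      then show ?thesis using ne by (intro basic_radicalI) auto
    qed
    have "indicator_vector {g 0, g 2} \<in> basic_radical_space Q"
      using disj[of 0 2] m4 by (intro pair) auto
    moreover have "indicator_vector {g 1, g 3} \<in> basic_radical_space Q"
      using disj[of 1 3] m4 by (intro pair) auto
    moreover have "indicator_vector (g ` {..<m}) = indicator_vector {g 0, g 2} + indicator_vector {g 1, g 3}"
    proof -
      have "{..<4 :: nat} = {0, 1, 2, 3}" by auto
      then have "g ` {..<m} = {g 0, g 2} \<union> {g 1, g 3}" using m4 by auto
      moreover have "{g 0, g 2} \<inter> {g 1, g 3} = {}"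
        using g m4 by (auto simp: inj_on_eq_iff)
      ultimately show ?thesis by (auto simp: vec_eq_iff indicator_vector_def)
    qed
    ultimately show ?thesis using basic_radical_add by metis
  next
    case 3
    have cons: "adjacent Q (g z) (g (Suc z mod m))" if "z < m" for z
    proof -
      define w u where "w = Suc z mod m" and "u = Suc w mod m"
      have wm: "w < m" "u < m" using m by (auto simp: w_def u_def)
      have ne: "z \<noteq> w" "w \<noteq> u" "u \<noteq> z"
        using 3(1) that by (auto simp: w_def u_def mod_Suc split: if_splits)
      have "e (g z) \<inter> e (g w) = {v w}"
        using ne vi wm that by (auto simp: eg' w_def[symmetric] u_def[symmetric])
      then have "odd (quiver_matrix Q (g z) (g w))" using parity[of "g z" "g w"] by simp
      then show ?thesis using is_quiver by (auto simp: adjacent_iff w_def)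
    qed
    have non: "\<not> adjacent Q (g z) (g w)" if "z < m" "w < m" "w \<noteq> Suc z mod m" "z \<noteq> Suc w mod m" for z w
    proof (cases "z = w")
      case False
      have d: "e (g z) \<inter> e (g w) = {}" by (rule disj[OF that(1,2) False that(3,4)])
      have "m \<noteq> 3"
      proof
        assume "m = 3"
        then have "z = 0 \<or> z = 1 \<or> z = 2" "w = 0 \<or> w = 1 \<or> w = 2" using that by linarith+
        then show False using that(3,4) False \<open>m = 3\<close> by (elim disjE) simp_all
      qed
      then show ?thesis using disjoint_edges(1)[OF d] 3 is_quiver by (auto simp: adjacent_iff)
    qed (simp add: adjacent_iff[OF is_quiver])
    have "adjacent Q (g z) (g w) \<longleftrightarrow> w = Suc z mod m \<or> z = Suc w mod m" if "z < m" "w < m" for z w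
    proof
      show "adjacent Q (g z) (g w)" if "w = Suc z mod m \<or> z = Suc w mod m"
        using that cons[OF \<open>z < m\<close>] cons[OF \<open>w < m\<close>] adjacent_sym[of Q "g z" "g w"] by blast
    qed (use non[OF that] in blast)
    then have "cycle_labelling Q (g ` {..<m}) m g"
      using 3(1) inj_on_imp_bij_betw[OF g] by (simp only: cycle_labelling_def) blast
    then have "is_cycle Q (g ` {..<m})" unfolding is_cycle_def by blast
    then show ?thesis using basic_radicalI cycle_space_radical[OF cyc] by blast
  qed
qed

text \<open>Every vertex on the support has even degree, so no edge is a dead end and the support
  contains a closed trail. Adding its vector shrinks the support.\<close>

lemma cycle_space_basic:
  assumes "u \<in> cycle_space e"
  shows "u \<in> basic_radical_space Q"
  using assms
proof (induction "card (support u)" arbitrary: u rule: less_induct)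
  case less
  show ?case
  proof (cases "support u = {}")
    case True
    then have "u = 0" by (auto simp: support_def vec_eq_iff)
    then show ?thesis using vec.subspace_0[OF subspace_basic_radical_space] by simp
  next
    case False
    have deg: "\<exists>j\<in>support u. j \<noteq> i \<and> p \<in> e j" if "i \<in> support u" "p \<in> e i" for i p
    proof (rule ccontr)
      assume *: "\<not> ?thesis"
      have "boundary e (indicator_vector (support u)) p = (\<Sum>j\<in>support u. if j = i then 1 else 0)"
        unfolding boundary_indicator by (rule sum.cong) (use * that in auto)
      also have "\<dots> = 1" using that by simp
      finally show False using less.prems by (simp add: indicator_support cycle_space_def)
    qed
    obtain m g v where t: "m \<ge> 2" "inj_on v {..<m}" "v m = v 0" "inj_on g {..<m}"
      "g ` {..<m} \<subseteq> support u" "\<forall>z<m. e (g z) = {v z, v (Suc z)}"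
      using ex_closed_trail[OF finite_P e_subset card_e False deg] by blast
    let ?C = "indicator_vector (g ` {..<m})"
    have C: "?C \<in> basic_radical_space Q" "?C \<in> cycle_space e"
      using closed_trail_basic[of m v g] boundary_closed_trail[of g m v e] t by blast+
    have "support (u + ?C) = support u - g ` {..<m}"
      using t(5) by (auto simp: support_def indicator_vector_def)
    moreover have "0 \<in> {..<m}" using t(1) by simp
    then have "g ` {..<m} \<noteq> {}" by blast
    ultimately have "support (u + ?C) \<subset> support u" using t(5) by auto
    then have "card (support (u + ?C)) < card (support u)" by (intro psubset_card_mono) auto
    moreover have "u + ?C \<in> cycle_space e"
      using vec.subspace_add[OF subspace_cycle_space less.prems C(2)] .
    ultimately have "u + ?C \<in> basic_radical_space Q" using less.hyps by blast
    then have "(u + ?C) + ?C \<in> basic_radical_space Q" using C(1) basic_radical_add by blast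
    then show ?thesis by (simp add: add.assoc)
  qed
qed

end

section \<open>Induced cycles: triangles, neighbours and closed subsets\<close>

lemma card_2_other:
  assumes "card A = 2" "x \<in> A"
  shows "\<exists>y. A = {x, y} \<and> x \<noteq> y"
proof -
  obtain a b where ab: "A = {a, b}" "a \<noteq> b" using assms(1) by (auto simp: card_2_iff)
  show ?thesis
  proof (cases "x = a")
    case False
    then have "x = b" using assms(2) ab by simp
    then show ?thesis using ab by (intro exI[of _ a]) auto
  qed (use ab in blast)
qed

lemma triangle_is_cycle:
  assumes "is_quiver Q" "distinct [a, b, c]" "adjacent Q a b" "adjacent Q b c" "adjacent Q a c"
  shows "is_cycle Q {a, b, c}"
proof -
  define f where "f x = [a, b, c] ! x" for x
  have 3: "x < 3 \<longleftrightarrow> x = 0 \<or> x = 1 \<or> x = 2" for x :: nat by auto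
  have "{..<3} = {0, 1, 2 :: nat}" by auto
  then have "bij_betw f {..<3} {a, b, c}"
    using assms(2) by (auto simp: bij_betw_def f_def)
  moreover have "adjacent Q (f x) (f y) \<longleftrightarrow> y = Suc x mod 3 \<or> x = Suc y mod 3" if "x < 3" "y < 3" for x y
  proof -
    have "\<not> adjacent Q x x" for x using assms(1) by (simp add: adjacent_iff)
    moreover have "adjacent Q b a" "adjacent Q c b" "adjacent Q c a"
      using assms(3-5) by (auto simp: adjacent_def)
    ultimately show ?thesis
      using that assms(3-5) unfolding 3 by (elim disjE) (simp_all add: f_def)
  qed
  ultimately show ?thesis
    unfolding is_cycle_def cycle_labelling_def by (intro exI[of _ 3] exI[of _ f]) auto
qed

lemma cycle_neighbours:
  assumes "is_cycle Q S" "x \<in> S"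
  shows "card {y \<in> S. adjacent Q x y} = 2"
proof -
  obtain m f where m: "m \<ge> 3" "bij_betw f {..<m} S"
    and adj: "\<And>x y. x < m \<Longrightarrow> y < m \<Longrightarrow>
      adjacent Q (f x) (f y) \<longleftrightarrow> y = Suc x mod m \<or> x = Suc y mod m"
    using assms(1) unfolding is_cycle_def cycle_labelling_def by blast
  obtain a where a: "a < m" "x = f a" using assms(2) m(2) by (auto simp: bij_betw_def)
  define b c where "b = Suc a mod m" and "c = (if a = 0 then m - 1 else a - 1)"
  have bc: "b < m" "c < m" "b \<noteq> c"
    using m(1) a(1) by (auto simp: b_def c_def mod_Suc)
  have c: "a = Suc y mod m \<longleftrightarrow> y = c" if "y < m" for y
    using that m(1) a(1) by (auto simp: c_def mod_Suc)
  have "{y \<in> S. adjacent Q x y} = f ` {b, c}"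
  proof (intro equalityI subsetI)
    fix y assume y: "y \<in> {y \<in> S. adjacent Q x y}"
    then obtain d where d: "d < m" "y = f d" using m(2) by (auto simp: bij_betw_def)
    then have "d = b \<or> d = c" using adj[OF a(1) d(1)] c[OF d(1)] y a(2) by (auto simp: b_def)
    then show "y \<in> f ` {b, c}" using d by auto
  next
    fix y assume "y \<in> f ` {b, c}"
    then obtain d where d: "y = f d" "d = b \<or> d = c" by auto
    then have "d < m" using bc by auto
    moreover from this have "adjacent Q x y" using adj[OF a(1)] c[of d] d a(2) b_def by blast
    ultimately show "y \<in> {y \<in> S. adjacent Q x y}" using m(2) d(1) by (auto simp: bij_betw_def)
  qed
  moreover have "f b \<noteq> f c" using m(2) bc by (auto simp: bij_betw_def inj_on_eq_iff)
  ultimately show ?thesis by simp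
qed

text \<open>Connectedness of a cycle, in the form used to bound its size: from any starting label,
  taking successors reaches every label.\<close>

lemma cycle_closed:
  assumes "is_cycle Q S" "A \<subseteq> S" "A \<noteq> {}" "\<And>a b. a \<in> A \<Longrightarrow> b \<in> S \<Longrightarrow> adjacent Q a b \<Longrightarrow> b \<in> A"
  shows "A = S"
proof -
  obtain m f where m: "m \<ge> 3" "bij_betw f {..<m} S"
    and adj: "\<And>x y. x < m \<Longrightarrow> y < m \<Longrightarrow>
      adjacent Q (f x) (f y) \<longleftrightarrow> y = Suc x mod m \<or> x = Suc y mod m"
    using assms(1) unfolding is_cycle_def cycle_labelling_def by blast
  obtain a where a: "a < m" "f a \<in> A" using assms(2,3) m(2) by (auto simp: bij_betw_def)
  have step: "f ((a + n) mod m) \<in> A" for n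
  proof (induction n)
    case (Suc n)
    have "(a + n) mod m < m" "(a + Suc n) mod m < m" using m(1) by auto
    moreover have "(a + Suc n) mod m = Suc ((a + n) mod m) mod m" by (simp add: mod_simps)
    ultimately have "adjacent Q (f ((a + n) mod m)) (f ((a + Suc n) mod m))" using adj by blast
    moreover have "f ((a + Suc n) mod m) \<in> S" using m \<open>(a + Suc n) mod m < m\<close> by (auto simp: bij_betw_def)
    ultimately show ?case using assms(4) Suc.IH by blast
  qed (use a in simp)
  have "f b \<in> A" if "b < m" for b
  proof -
    have "a + (b + (m - a)) = b + m" using a(1) by simp
    then show ?thesis using step[of "b + (m - a)"] that by simp
  qed
  then show ?thesis using assms(2) m(2) by (auto simp: bij_betw_def)
qed

context quiver_graph
begin

lemma boundary_outside: "p \<notin> P \<Longrightarrow> boundary e u p = 0"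
  using e_subset by (auto simp: boundary_def intro!: sum.neutral)

text \<open>Two vectors with odd degree everywhere differ by an element of the cycle space, so
  having one of them in the span captures all.\<close>

lemma radical_subset_basic:
  assumes t: "t \<in> basic_radical_space Q" "\<And>p. p \<in> P \<Longrightarrow> boundary e t p = 1"
  shows "basic_radical_space Q = radical_space Q"
proof
  show "radical_space Q \<subseteq> basic_radical_space Q"
  proof
    fix u assume u: "u \<in> radical_space Q"
    show "u \<in> basic_radical_space Q"
    proof (cases "u \<in> cycle_space e")
      case False
      then have full: "boundary e u p = 1" if "p \<in> P" for p
        using u radical_space_graph[OF G] that by blast
      have "boundary e (u + t) p = 0" for p
        using full t(2) boundary_outside by (cases "p \<in> P") (auto simp: boundary_add)
      then have "u + t \<in> basic_radical_space Q"
        by (intro cycle_space_basic) (simp add: cycle_space_def)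
      then have "(u + t) + t \<in> basic_radical_space Q" using t(1) basic_radical_add by blast
      then show ?thesis by (simp add: add.assoc)
    qed (rule cycle_space_basic)
  qed
qed (rule basic_radical_space_subset)

lemma odd_adjacent: "odd (card (e i \<inter> e j)) \<Longrightarrow> adjacent Q i j"
  using parity[of i j] is_quiver by (auto simp: adjacent_iff)

subsection \<open>Graphs with two vertices\<close>

text \<open>Two double edges leaving a, or two entering it, together with a double edge between
  their other ends form an acyclic triangle with all weights 2.\<close>

lemma heavy_out_neighbours:
  assumes "distinct [a, b, c]" "quiver_matrix Q a b = 2 * s" "quiver_matrix Q a c = 2 * s"
    "s * s = 1" "\<bar>quiver_matrix Q b c\<bar> = 2"
  shows False
proof -
  have "quiver_matrix Q b c = s * 2 \<or> quiver_matrix Q c b = s * 2"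
  proof -
    have "s = 1 \<or> s = - 1" using assms(4) by (auto simp: zmult_eq_1_iff)
    then show ?thesis using assms(5) matrix_skew[of Q c b] by auto
  qed
  then show False
  proof
    assume "quiver_matrix Q b c = s * 2"
    then show False using triangle_weights[OF Q card assms(1,4), of 2 2 2] assms by auto
  next
    assume "quiver_matrix Q c b = s * 2"
    then show False using triangle_weights[OF Q card _ assms(4), of a c b 2 2 2] assms by auto
  qed
qed

text \<open>All edges of the graph are parallel, so the weights are 0 or 2, and by connectedness
  double edges join all pairs. A fourth vertex would have two edges of the same direction to a
  triangle. So \<open>Q\<close> is a triangle, and its three parallel edges give degree 3 at both
  points of \<open>P\<close>.\<close>

lemma basic_radical_space_2:
  assumes "card P = 2"
  shows "basic_radical_space Q = radical_space Q"
proof -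
  let ?B = "quiver_matrix Q"
  have eP: "e i = P" for i
    using card_subset_eq[OF finite_P e_subset] card_e assms by simp
  have val: "?B i j = 0 \<or> \<bar>?B i j\<bar> = 2" for i j
  proof -
    have "even (?B i j)" using parity[of i j] assms by (simp add: eP)
    then have "?B i j \<noteq> 1" "?B i j \<noteq> - 1" by auto
    then show ?thesis using weight_le_2[OF Q card, of i j] by linarith
  qed
  have all: "i = j \<or> \<bar>?B i j\<bar> = 2" for i j
  proof -
    have "(adjacent Q)\<^sup>*\<^sup>* i j" using connected by (simp add: connected_quiver_def)
    then show ?thesis
    proof induction
      case (step j k)
      then have jk: "\<bar>?B j k\<bar> = 2" using val[of j k] is_quiver by (auto simp: adjacent_iff)
      show ?case
      proof (cases "i = k \<or> i = j")
        case False
        then have ij: "\<bar>?B i j\<bar> = 2" using step by blast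
        have "\<bar>?B i k\<bar> = \<bar>?B j k\<bar>" by (rule double_edge_weights[OF Q card ij]) (use False jk in auto)
        then show ?thesis using jk by simp
      qed (use jk in auto)
    qed simp
  qed
  obtain T :: "'v set" where T: "T \<subseteq> UNIV" "card T = 3"
    using obtain_subset_with_card_n[OF card] by metis
  then obtain a b c where abc: "distinct [a, b, c]" "T = {a, b, c}"
    by (auto simp: card_3_iff)
  have "d \<in> {a, b, c}" for d
  proof (rule ccontr)
    assume d: "d \<notin> {a, b, c}"
    have pm: "?B d x = 2 \<or> ?B d x = - 2" if "x \<in> {a, b, c}" for x
      using all[of d x] d that by auto
    have no: False if xy: "x \<in> {a, b, c}" "y \<in> {a, b, c}" "x \<noteq> y" "?B d x = ?B d y" for x y
    proof -
      obtain s where s: "?B d x = 2 * s" "s * s = 1" using pm[OF xy(1)] by force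
      moreover have "?B d y = 2 * s" using xy(4) s(1) by simp
      moreover have "distinct [d, x, y]" using d xy by auto
      moreover have "\<bar>?B x y\<bar> = 2" using all[of x y] xy(3) by blast
      ultimately show ?thesis by (intro heavy_out_neighbours)
    qed
    have "a \<noteq> b" "a \<noteq> c" "b \<noteq> c" using abc by auto
    then have "?B d a \<noteq> ?B d b" "?B d a \<noteq> ?B d c" "?B d b \<noteq> ?B d c"
      using no[of a b] no[of a c] no[of b c] by auto
    moreover have "?B d a = 2 \<or> ?B d a = - 2" "?B d b = 2 \<or> ?B d b = - 2" "?B d c = 2 \<or> ?B d c = - 2"
      by (intro pm; simp)+
    ultimately show False by metis
  qed
  then have U: "{a, b, c} = UNIV" by blast
  have "is_cycle Q {a, b, c}"
    using all[of a b] all[of b c] all[of a c] abc(1)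
    by (intro triangle_is_cycle is_quiver) (auto simp: adjacent_iff[OF is_quiver])
  moreover have full: "boundary e (indicator_vector {a, b, c}) p = 1" if "p \<in> P" for p
    unfolding boundary_indicator using abc(1) that by (simp add: eP)
  ultimately show ?thesis
    using radical_subset_basic[OF _ full] basic_radicalI full_boundary_radical[OF full] by blast
qed

subsection \<open>Graphs with four vertices\<close>

lemma edge_across_cut:
  assumes "X \<subseteq> P" "X \<noteq> {}" "X \<noteq> P"
  shows "\<exists>i x y. e i = {x, y} \<and> x \<in> X \<and> y \<in> P - X"
proof -
  obtain i where odd: "odd (card (e i \<inter> X))"
    using G assms unfolding graph_model_def by blast
  obtain x y where xy: "e i = {x, y}" "x \<noteq> y" using card_e[of i] by (auto simp: card_2_iff)
  have "\<not> (x \<in> X \<longleftrightarrow> y \<in> X)"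
  proof
    assume "x \<in> X \<longleftrightarrow> y \<in> X"
    then have "e i \<inter> X = {} \<or> e i \<inter> X = e i" using xy by auto
    then show False using odd card_e[of i] by auto
  qed
  moreover have "e i = {y, x}" "x \<in> P" "y \<in> P" using xy e_subset[of i] by auto
  ultimately show ?thesis using xy(1) by blast
qed

lemma matching_basic:
  assumes "e i = {a, b}" "e j = {c, d}" "distinct [a, b, c, d]" "P = {a, b, c, d}"
  shows "basic_radical_space Q = radical_space Q"
proof -
  have ij: "i \<noteq> j" using assms by auto
  have full: "boundary e (indicator_vector {i, j}) p = 1" if "p \<in> P" for p
    unfolding boundary_pair[OF ij] using that assms by auto
  have "indicator_vector {i, j} \<in> basic_radical_space Q"
    using full_boundary_radical[OF full] ij by (intro basic_radicalI) auto
  then show ?thesis using radical_subset_basic full by blast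
qed

text \<open>The edges meet pairwise in the centre only, hence form a triangle in \<open>Q\<close>;
  the degrees are 3 and 1, all odd.\<close>

lemma star_basic:
  assumes "e i = {a, b}" "e j = {a, c}" "e k = {a, d}" "distinct [a, b, c, d]" "P = {a, b, c, d}"
  shows "basic_radical_space Q = radical_space Q"
proof -
  have ne: "distinct [i, j, k]" using assms by (auto simp: doubleton_eq_iff)
  have full: "boundary e (indicator_vector {i, j, k}) p = 1" if "p \<in> P" for p
  proof -
    have "boundary e (indicator_vector {i, j, k}) p =
        of_bool (p \<in> e i) + (of_bool (p \<in> e j) + of_bool (p \<in> e k))"
      unfolding boundary_indicator using ne by simp
    then show ?thesis using that assms by auto
  qed
  have "e i \<inter> e j = {a}" "e j \<inter> e k = {a}" "e i \<inter> e k = {a}" using assms by auto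
  then have "is_cycle Q {i, j, k}"
    by (intro triangle_is_cycle is_quiver ne odd_adjacent) simp_all
  then have "indicator_vector {i, j, k} \<in> basic_radical_space Q"
    using full_boundary_radical[OF full] by (intro basic_radicalI) auto
  then show ?thesis using radical_subset_basic full by blast
qed

text \<open>A spanning tree on four vertices is a star or a path, and the outer edges of a path form
  a perfect matching.\<close>

lemma basic_radical_space_4:
  assumes "card P = 4"
  shows "basic_radical_space Q = radical_space Q"
proof -
  have card_ins: "card {a, b} \<le> 2" "card {a, b, c} \<le> 3" for a b c :: 'p
    by (simp_all add: card_insert_if)
  obtain q where q: "q \<in> P" using assms by (metis card.empty equals0I zero_neq_numeral)
  obtain i x y where "e i = {x, y}" "x \<in> {q}" "y \<in> P - {q}"
    using edge_across_cut[of "{q}"] q assms by force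
  then have i: "e i = {q, y}" "y \<in> P" "y \<noteq> q" by auto
  have "{q, y} \<noteq> P" using assms card_ins(1)[of q y] by auto
  then obtain j r s where j: "e j = {r, s}" "r \<in> {q, y}" "s \<in> P - {q, y}"
    using edge_across_cut[of "{q, y}"] q i by blast
  \<comment> \<open>The second edge is attached at r, and r' is the other end of the first. The
    point t where the third edge is attached decides between star and path.\<close>
  obtain r' where r': "e i = {r, r'}" "r \<noteq> r'" "r \<in> P" "r' \<in> P" "{q, y} = {r, r'}"
  proof (cases "r = q")
    case True
    show thesis by (rule that[of y]) (use True i q in simp_all)
  next
    case False
    then have "r = y" using j(2) by simp
    then show thesis by (intro that[of q]) (use i q in auto)
  qed
  note i' = r'(1)
  have "s \<in> P - {r, r'}" using j(3) unfolding r'(5) .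
  then have rs: "r \<in> P" "r' \<in> P" "s \<in> P" "s \<noteq> r" "s \<noteq> r'" using r'(3,4) by auto
  have "card {r, r', s} \<noteq> card P" using assms card_ins(2)[of r r' s] by linarith
  then have "{r, r', s} \<noteq> P" by blast
  then obtain k t w where k: "e k = {t, w}" "t \<in> {r, r', s}" "w \<in> P - {r, r', s}"
    using edge_across_cut[of "{r, r', s}"] rs by blast
  have d: "distinct [r, r', s, w]" using rs(4,5) r'(2) k(3) by fastforce
  have P: "P = {r, r', s, w}"
  proof -
    have "card {r, r', s, w} = 4" using d by simp
    moreover have "{r, r', s, w} \<subseteq> P" using rs k(3) by simp
    ultimately show ?thesis using card_subset_eq[OF finite_P, of "{r, r', s, w}"] assms by simp
  qed
  consider "t = r" | "t = r'" | "t = s" using k(2) by blast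
  then show ?thesis
  proof cases
    case 1
    show ?thesis
      by (rule star_basic[of i r r' j s k w]) (use i' j(1) k(1) d P 1 in simp_all)
  next
    case 2
    show ?thesis
      by (rule matching_basic[of j r s k r' w]) (use j(1) k(1) d P 2 in auto)
  next
    case 3
    show ?thesis
      by (rule matching_basic[of i r r' k s w]) (use i' k(1) d P 3 in simp_all)
  qed
qed

subsection \<open>Graphs with another number of vertices\<close>

text \<open>The handshake lemma: degrees add up to twice the number of edges.\<close>

lemma full_boundary_even:
  assumes "\<And>p. p \<in> P \<Longrightarrow> boundary e u p = 1"
  shows "even (card P)"
proof -
  have "(of_nat (card P) :: bit) = (\<Sum>p\<in>P. boundary e u p)" using assms by simp
  also have "\<dots> = (\<Sum>i\<in>UNIV. (\<Sum>p\<in>P. of_bool (p \<in> e i)) * u $ i)"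
    unfolding boundary_def sum_distrib_right by (rule sum.swap)
  also have "\<dots> = (\<Sum>i\<in>UNIV. of_nat (card (e i \<inter> P)) * u $ i)"
    by (simp only: of_nat_card_Int[OF finite_P])
  also have "\<dots> = 0"
    using card_e e_subset by (simp add: Int_absorb2 of_nat_bit)
  finally show ?thesis by (simp add: of_nat_bit)
qed

text \<open>Odd degrees make the edges of \<open>S\<close> cover \<open>P\<close>, whereas an
  induced cycle of this kind reaches at most four vertices. Parallel edges cancel in the degree and
  have common neighbours, so then \<open>S\<close> is all parallel or has three or four elements.
  Without parallel edges, a vertex shared by two edges lies on a third one; the three are pairwise
  adjacent and therefore make up \<open>S\<close>.\<close>

lemma no_full_cycle:
  assumes P6: "card P \<ge> 6" and cyc: "is_cycle Q S"
    and full: "\<And>p. p \<in> P \<Longrightarrow> boundary e (indicator_vector S) p = 1"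
  shows False
proof -
  have small: False if "P \<subseteq> X" "finite X" "card X \<le> 4" for X
    using card_mono[OF that(2,1)] P6 that(3) by simp
  have one: "boundary e (indicator_vector S) p = (\<Sum>i\<in>S. of_bool (p \<in> e i))" for p
    by (rule boundary_indicator)
  have covered: "\<exists>x\<in>S. p \<in> e x" if "p \<in> P" for p
  proof (rule ccontr)
    assume "\<not> ?thesis"
    then have "boundary e (indicator_vector S) p = 0" unfolding one by (intro sum.neutral) auto
    then show False using full[OF that] by simp
  qed
  have meet: "e i \<inter> e j \<noteq> {}" if "adjacent Q i j" for i j
    using disjoint_edges(1)[of i j] that P6 is_quiver by (auto simp: adjacent_iff)
  have adj: "adjacent Q i j" if "e i \<inter> e j \<noteq> {}" "e i \<noteq> e j" for i j
  proof (rule odd_adjacent)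
    have "card (e i \<inter> e j) \<noteq> 2"
      using card_subset_eq[of "e i" "e i \<inter> e j"] card_subset_eq[of "e j" "e i \<inter> e j"] card_e that(2) by auto
    moreover have "card (e i \<inter> e j) \<noteq> 0" using that(1) by simp
    moreover have "card (e i \<inter> e j) \<le> 2" using card_mono[of "e i" "e i \<inter> e j"] card_e by auto
    ultimately have "card (e i \<inter> e j) = 1" by linarith
    then show "odd (card (e i \<inter> e j))" by simp
  qed
  have nbrs: "{y \<in> S. adjacent Q x y} = {a, b}"
    if "x \<in> S" "a \<in> S" "b \<in> S" "a \<noteq> b" "adjacent Q x a" "adjacent Q x b" for x a b
  proof -
    have "{a, b} \<subseteq> {y \<in> S. adjacent Q x y}" using that by auto
    then show ?thesis
      using card_subset_eq[of "{y \<in> S. adjacent Q x y}" "{a, b}"] cycle_neighbours[OF cyc that(1)] that(4)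
      by auto
  qed
  have par: False if ij: "i \<in> S" "j \<in> S" "i \<noteq> j" "e i = e j" for i j
  proof (cases "{x \<in> S. e x = e i} = S")
    case True
    have "P \<subseteq> e i"
    proof
      fix p assume "p \<in> P"
      then obtain x where "x \<in> S" "p \<in> e x" using covered by blast
      then show "p \<in> e i" using True by auto
    qed
    then show False using small[of "e i"] card_e by simp
  next
    case False
    \<comment> \<open>A neighbour y outside the parallel class meets it in one vertex, so it is
      adjacent to both i and j, which are then its only neighbours on the cycle.\<close>
    then obtain x y where xy: "x \<in> S" "e x = e i" "y \<in> S" "e y \<noteq> e i" "adjacent Q x y"
      using cycle_closed[OF cyc, of "{x \<in> S. e x = e i}"] ij(1) by blast
    have "e y \<inter> e i \<noteq> {}" using meet[OF xy(5)] xy(2) by auto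
    then have yi: "adjacent Q y i" "adjacent Q y j" using adj xy(4) ij(4) by auto
    have ny: "{z \<in> S. adjacent Q y z} = {i, j}" using nbrs[OF xy(3) ij(1-3) yi] .
    have iy: "adjacent Q i y" "adjacent Q j y" using yi adjacent_sym[of Q] by blast+
    have yne: "y \<noteq> i" "y \<noteq> j" using xy(4) ij(4) by auto
    show False
    proof (cases "adjacent Q i j")
      case True
      then have ji: "adjacent Q j i" using adjacent_sym[of Q] by blast
      have ni: "{z \<in> S. adjacent Q i z} = {j, y}" using nbrs[OF ij(1) ij(2) xy(3) _ True iy(1)] yne by blast
      have nj: "{z \<in> S. adjacent Q j z} = {i, y}" using nbrs[OF ij(2) ij(1) xy(3) _ ji iy(2)] yne by blast
      have S: "{i, j, y} = S"
        by (rule cycle_closed[OF cyc]) (use ij xy ni nj ny in blast)+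
      have "boundary e (indicator_vector S) p = of_bool (p \<in> e i) + (of_bool (p \<in> e j) + of_bool (p \<in> e y))" for p
        unfolding S[symmetric] boundary_indicator using ij(3) yne by simp
      then have "P \<subseteq> e y"
        using full ij(4) by fastforce
      then show False using small[of "e y"] card_e by simp
    next
      case False
      have "card {z \<in> S. adjacent Q i z} = 2" by (rule cycle_neighbours[OF cyc ij(1)])
      moreover have "y \<in> {z \<in> S. adjacent Q i z}" using iy xy by simp
      ultimately obtain y' where y': "{z \<in> S. adjacent Q i z} = {y, y'}" "y \<noteq> y'"
        using card_2_other[of "{z \<in> S. adjacent Q i z}" y] by blast
      then have y'S: "y' \<in> S" "adjacent Q i y'" by auto
      have y'ne: "y' \<noteq> i" "y' \<noteq> j"
        using y'S(2) False adjacent_iff[OF is_quiver] by auto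
      have y'e: "e y' \<noteq> e i"
      proof
        assume "e y' = e i"
        then have "adjacent Q y y'" using adj[of y y'] \<open>e y \<inter> e i \<noteq> {}\<close> xy(4) by simp
        then have "y' \<in> {i, j}" using ny y'S(1) by blast
        then show False using y'ne by simp
      qed
      have "e y' \<inter> e i \<noteq> {}" using meet[OF y'S(2)] by auto
      then have yi': "adjacent Q y' i" "adjacent Q y' j" using adj y'e ij(4) by auto
      have ny': "{z \<in> S. adjacent Q y' z} = {i, j}" using nbrs[OF y'S(1) ij(1-3) yi'] .
      have "adjacent Q j y'" using yi' adjacent_sym[of Q] by blast
      then have nj: "{z \<in> S. adjacent Q j z} = {y, y'}" using nbrs[OF ij(2) xy(3) y'S(1) y'(2) iy(2)] by blast
      have S: "{i, j, y, y'} = S"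
        by (rule cycle_closed[OF cyc]) (use ij xy y' y'S nj ny ny' in blast)+
      have "boundary e (indicator_vector S) p = of_bool (p \<in> e i) +
          (of_bool (p \<in> e j) + (of_bool (p \<in> e y) + of_bool (p \<in> e y')))" for p
        unfolding S[symmetric] boundary_indicator using ij(3) yne y'ne y'(2) by simp
      then have "P \<subseteq> e y \<union> e y'"
        using full ij(4) by fastforce
      moreover have "card (e y \<union> e y') \<le> 4" using card_Un_le[of "e y" "e y'"] card_e by simp
      ultimately show False using small[of "e y \<union> e y'"] by simp
    qed
  qed
  have "\<exists>i. i \<in> S"
  proof -
    obtain m :: nat and f where "m \<ge> 3" "bij_betw f {..<m} S"
      using cyc unfolding is_cycle_def cycle_labelling_def by blast
    then have "f 0 \<in> S" using bij_betwE[of f "{..<m}" S] by auto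
    then show ?thesis ..
  qed
  then obtain i where i: "i \<in> S" by blast
  have "{y \<in> S. adjacent Q i y} \<noteq> {}"
  proof
    assume *: "{y \<in> S. adjacent Q i y} = {}"
    show False using cycle_neighbours[OF cyc i] unfolding * by simp
  qed
  then obtain j where j: "j \<in> S" "adjacent Q i j" by blast
  then have ij: "i \<noteq> j" using is_quiver by (auto simp: adjacent_iff)
  obtain p where p: "p \<in> e i" "p \<in> e j" using meet[OF j(2)] by blast
  have "\<exists>k\<in>S. k \<noteq> i \<and> k \<noteq> j \<and> p \<in> e k"
  proof (rule ccontr)
    assume *: "\<not> ?thesis"
    have "(\<Sum>k\<in>S. of_bool (p \<in> e k)) = (\<Sum>k\<in>{i, j}. of_bool (p \<in> e k) :: bit)"
      by (rule sum.mono_neutral_right) (use * i j in auto)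
    also have "\<dots> = 0" using ij p by simp
    finally show False using full[of p] p(1) e_subset one by auto
  qed
  then obtain k where k: "k \<in> S" "k \<noteq> i" "k \<noteq> j" "p \<in> e k" by blast
  have ne: "e i \<noteq> e j" "e i \<noteq> e k" "e j \<noteq> e k" using par i j(1) k ij by blast+
  have "adjacent Q i k" "adjacent Q j k" using adj[of i k] adj[of j k] ne p k by auto
  moreover from this have "adjacent Q k i" "adjacent Q k j" "adjacent Q j i"
    using adjacent_sym[of Q] j(2) by blast+
  ultimately have n: "{z \<in> S. adjacent Q i z} = {j, k}" "{z \<in> S. adjacent Q j z} = {i, k}"
    "{z \<in> S. adjacent Q k z} = {i, j}"
  proof -
    show "{z \<in> S. adjacent Q i z} = {j, k}"
      by (rule nbrs[OF i j(1) k(1)]) (use k j(2) \<open>adjacent Q i k\<close> in auto)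
    show "{z \<in> S. adjacent Q j z} = {i, k}"
      by (rule nbrs[OF j(1) i k(1)]) (use k \<open>adjacent Q j i\<close> \<open>adjacent Q j k\<close> in auto)
    show "{z \<in> S. adjacent Q k z} = {i, j}"
      by (rule nbrs[OF k(1) i j(1)]) (use ij \<open>adjacent Q k i\<close> \<open>adjacent Q k j\<close> in auto)
  qed
  have S: "{i, j, k} = S"
    by (rule cycle_closed[OF cyc]) (use i j k n in blast)+
  obtain a where a: "e i = {p, a}" using card_2_other[OF card_e p(1)] by blast
  obtain b where b: "e j = {p, b}" using card_2_other[OF card_e p(2)] by blast
  obtain c where c: "e k = {p, c}" using card_2_other[OF card_e k(4)] by blast
  have "P \<subseteq> {p, a, b, c}"
  proof
    fix r assume "r \<in> P"
    then obtain x where "x \<in> S" "r \<in> e x" using covered by blast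
    then show "r \<in> {p, a, b, c}" using S a b c by auto
  qed
  moreover have "card {p, a, b, c} \<le> 4" by (simp add: card_insert_if)
  ultimately show False using small by blast
qed

text \<open>A basic vector outside the cycle space has odd degree everywhere, so
  \<open>card P\<close> is even and hence at least 6. Two edges cannot cover so many vertices, and
  \<open>no_full_cycle\<close> excludes cycles.\<close>

lemma basic_radical_space_other:
  assumes "card P \<noteq> 2" "card P \<noteq> 4"
  shows "basic_radical_space Q = cycle_space e"
proof
  show "basic_radical_space Q \<subseteq> cycle_space e"
    unfolding basic_radical_space_def
  proof (rule vec.span_minimal[OF _ subspace_cycle_space], rule subsetI, rule ccontr)
    fix u assume u: "u \<in> basic_radical_vectors Q" "u \<notin> cycle_space e"
    define S where "S = support u"
    have uS: "u = indicator_vector S" by (simp add: S_def indicator_support)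
    have full: "boundary e (indicator_vector S) p = 1" if "p \<in> P" for p
      using u radical_space_graph[OF G] that uS by (auto simp: basic_radical_vectors_def)
    have "P \<noteq> {}" using e_subset card_e[of undefined] by (metis card.empty subset_empty zero_neq_numeral)
    then have "card P \<noteq> 0" using finite_P by simp
    moreover have "even (card P)" by (rule full_boundary_even[OF full])
    ultimately have P6: "card P \<ge> 6" using assms by presburger
    have "card S \<noteq> 2"
    proof
      assume "card S = 2"
      then obtain i j where ij: "S = {i, j}" "i \<noteq> j" by (auto simp: card_2_iff)
      have "P \<subseteq> e i \<union> e j"
        using full unfolding ij(1) boundary_pair[OF ij(2)] by fastforce
      then have "card P \<le> card (e i \<union> e j)" by (intro card_mono) auto
      also have "\<dots> \<le> 4" using card_Un_le[of "e i" "e j"] card_e by simp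
      finally show False using P6 by simp
    qed
    then have "is_cycle Q S" using u(1) by (simp add: basic_radical_vectors_def S_def)
    then show False using no_full_cycle[OF P6 _ full] by blast
  qed
qed (use cycle_space_basic in blast)

end

text \<open>A set meeting every edge evenly contains or misses each edge. Adjacent vertices of
  \<open>Q\<close> have meeting edges, so the same alternative holds along all of
  \<open>Q\<close>.\<close>

lemma graph_model_connectedI:
  fixes e :: "'v::finite \<Rightarrow> 'p set"
  assumes conn: "connected_quiver Q"
    and card: "\<And>i. card (e i) = 2"
    and par: "\<And>i j. even (quiver_matrix Q i j) \<longleftrightarrow> even (card (e i \<inter> e j))"
    and adj: "\<And>i j. adjacent Q i j \<Longrightarrow> e i \<inter> e j \<noteq> {}"
  shows "graph_model Q (\<Union>i. e i) e"
proof -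
  have fin: "finite (e i)" for i using card[of i] by (intro card_ge_0_finite) simp
  have "X = {} \<or> X = (\<Union>i. e i)" if X: "X \<subseteq> (\<Union>i. e i)" "\<forall>i. even (card (e i \<inter> X))" for X
  proof (cases "X = {}")
    case False
    have in_or_out: "e i \<subseteq> X \<or> e i \<inter> X = {}" for i
    proof -
      obtain x y where xy: "e i = {x, y}" "x \<noteq> y" using card[of i] by (auto simp: card_2_iff)
      have "e i \<inter> X = (if x \<in> X then {x} else {}) \<union> (if y \<in> X then {y} else {})"
        using xy(1) by auto
      moreover have "even (card (e i \<inter> X))" using X by blast
      ultimately have "x \<in> X \<longleftrightarrow> y \<in> X" by (auto split: if_splits)
      then show ?thesis using xy(1) by auto
    qed
    obtain i where i: "e i \<subseteq> X" using False X(1) in_or_out by blast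
    have "e j \<subseteq> X" for j
    proof -
      have "(adjacent Q)\<^sup>*\<^sup>* i j" using conn by (simp add: connected_quiver_def)
      then show ?thesis
      proof induction
        case (step j k)
        then show ?case using adj[of j k] in_or_out[of k] by blast
      qed (rule i)
    qed
    then show ?thesis using X(1) by blast
  qed simp
  then show ?thesis using fin card par unfolding graph_model_def by auto
qed

lemma graph_model_isomorphic:
  fixes Q :: "'v::finite quiver" and R :: "'w quiver"
  assumes f: "bij f" "\<And>i j. R (f i) (f j) = Q i j" and G: "graph_model R P e"
  shows "graph_model Q P (e \<circ> f)"
proof -
  have "quiver_matrix Q i j = quiver_matrix R (f i) (f j)" for i j
    by (simp add: quiver_matrix_def f(2))
  moreover have "(\<forall>i. even (card (e (f i) \<inter> X))) \<longleftrightarrow> (\<forall>i. even (card (e i \<inter> X)))" for X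
  proof
    assume *: "\<forall>i. even (card (e (f i) \<inter> X))"
    show "\<forall>i. even (card (e i \<inter> X))"
    proof
      fix i
      obtain j where "i = f j" using f(1) by (metis bij_pointE)
      then show "even (card (e i \<inter> X))" using * by blast
    qed
  qed blast
  ultimately show ?thesis using G by (simp add: graph_model_def)
qed

section \<open>Invariance under mutation\<close>

lemma mutate_involution:
  assumes "is_quiver Q"
  shows "mutate k (mutate k Q) = Q"
proof (intro ext)
  fix i j
  have "quiver_matrix (mutate k (mutate k Q)) i j = quiver_matrix Q i j"
  proof (cases "k = i \<or> k = j")
    case False
    then show ?thesis
      by (auto simp: quiver_matrix_mutate mutate_matrix_def sgn_minus)
  qed (auto simp: quiver_matrix_mutate mutate_matrix_def)
  then show "mutate k (mutate k Q) i j = Q i j"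
    using quiver_of_matrix[OF is_quiver_mutate] quiver_of_matrix[OF assms] by metis
qed

text \<open>Because mutation is an involution on quivers, a backward step is a forward step
  too.\<close>

lemma mutation_class_induct [consumes 2, case_names base mutate]:
  assumes "equivclp mutation_step Q R" "is_quiver Q"
    and "Pr Q" "\<And>R k. is_quiver R \<Longrightarrow> Pr R \<Longrightarrow> Pr (mutate k R)"
  shows "is_quiver R \<and> Pr R"
  using assms(1)
proof (induction rule: equivclp_induct)
  case (step R S)
  from step(2) show ?case
  proof
    assume "mutation_step R S"
    then show ?thesis using step.IH assms(4) is_quiver_mutate by (auto simp: mutation_step_def)
  next
    assume "mutation_step S R"
    then obtain k where k: "is_quiver S" "R = mutate k S" by (auto simp: mutation_step_def)
    then have "S = mutate k R" using mutate_involution by metis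
    then show ?thesis using step.IH assms(4) k(1) by metis
  qed
qed (use assms in auto)

lemma dim_mutate_vector_image: "vec.dim (mutate_vector Q k ` V) = vec.dim V"
  by (rule vec.dim_image_eq[OF linear_mutate_vector]) (rule inj_on_subset[OF inj_mutate_vector], simp)

lemma (in quiver_graph) quiver_graph_mutate: "quiver_graph (mutate k Q) P (slide Q k e)"
  by unfold_locales (use Q card G mutation_finite_mutate graph_model_mutate in auto)

text \<open>Both quivers have the same \<open>P\<close> and so fall under the same case. The radical
  and the cycle space are each mapped onto their counterpart by an injective linear map.\<close>

lemma (in quiver_graph) dim_basic_mutate:
  "vec.dim (basic_radical_space (mutate k Q)) = vec.dim (basic_radical_space Q)"
proof -
  interpret R: quiver_graph "mutate k Q" P "slide Q k e" by (rule quiver_graph_mutate)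
  show ?thesis
  proof (cases "card P = 2 \<or> card P = 4")
    case True
    then show ?thesis
      using basic_radical_space_2 basic_radical_space_4 R.basic_radical_space_2 R.basic_radical_space_4
      by (auto simp: mutate_radical_space_image dim_mutate_vector_image)
  next
    case False
    then show ?thesis
      using basic_radical_space_other R.basic_radical_space_other
      by (auto simp: cycle_space_slide dim_mutate_vector_image)
  qed
qed

text \<open>All radical vectors outside the cycle space lie in a single coset of it, so at most one
  generator is missing from the span.\<close>

lemma (in quiver_graph) quotient_dim_le_1:
  "quotient_dim (radical_space Q) (basic_radical_space Q) \<le> 1"
proof -
  have "vec.dim (radical_space Q) \<le> vec.dim (basic_radical_space Q) + 1"
  proof (cases "radical_space Q \<subseteq> cycle_space e")
    case True
    then have "radical_space Q \<subseteq> basic_radical_space Q" using cycle_space_basic by blast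
    then show ?thesis using vec.dim_subset[of "radical_space Q" "basic_radical_space Q"] by simp
  next
    case False
    then obtain t where t: "t \<in> radical_space Q" "t \<notin> cycle_space e" by blast
    then have full: "boundary e t p = 1" if "p \<in> P" for p
      using radical_space_graph[OF G] that by blast
    have "radical_space Q \<subseteq> vec.span (insert t (basic_radical_space Q))"
    proof
      fix u assume u: "u \<in> radical_space Q"
      show "u \<in> vec.span (insert t (basic_radical_space Q))"
      proof (cases "u \<in> cycle_space e")
        case True
        then show ?thesis using cycle_space_basic by (intro vec.span_base) auto
      next
        case False
        then have fu: "boundary e u p = 1" if "p \<in> P" for p
          using u radical_space_graph[OF G] that by blast
        have "boundary e (u + t) p = 0" for p
          using full fu boundary_outside by (cases "p \<in> P") (auto simp: boundary_add)
        then have "u + t \<in> basic_radical_space Q"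
          by (intro cycle_space_basic) (simp add: cycle_space_def)
        then have "(u + t) + t \<in> vec.span (insert t (basic_radical_space Q))"
          by (intro vec.span_add vec.span_base) auto
        then show ?thesis by (simp add: add.assoc)
      qed
    qed
    then have "vec.dim (radical_space Q) \<le> vec.dim (insert t (basic_radical_space Q))"
      by (rule vec.dim_mono)
    also have "\<dots> \<le> vec.dim (basic_radical_space Q) + 1"
      by (simp add: vec.dim_insert)
    finally show ?thesis .
  qed
  then show ?thesis
    using quotient_dim_eq[OF subspace_radical_space subspace_basic_radical_space basic_radical_space_subset, of Q]
    by simp
qed

section \<open>Invariance under relabelling of vertices\<close>

definition relabel :: "('v \<Rightarrow> 'w) \<Rightarrow> bit^'v::finite \<Rightarrow> bit^'w::finite" where
  "relabel f u = (\<chi> i. u $ inv f i)"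

lemma is_cycle_image:
  assumes "inj f" "\<And>i j. adjacent R (f i) (f j) \<longleftrightarrow> adjacent Q i j" "is_cycle Q S"
  shows "is_cycle R (f ` S)"
proof -
  obtain m g where g: "m \<ge> 3" "bij_betw g {..<m} S"
    "\<forall>x<m. \<forall>y<m. adjacent Q (g x) (g y) \<longleftrightarrow> y = Suc x mod m \<or> x = Suc y mod m"
    using assms(3) unfolding is_cycle_def cycle_labelling_def by blast
  have "bij_betw f S (f ` S)" by (rule inj_on_imp_bij_betw[OF inj_on_subset[OF assms(1) subset_UNIV]])
  with g(2) have "bij_betw (f \<circ> g) {..<m} (f ` S)" by (rule bij_betw_trans)
  moreover have "\<forall>x<m. \<forall>y<m. adjacent R ((f \<circ> g) x) ((f \<circ> g) y) \<longleftrightarrow> y = Suc x mod m \<or> x = Suc y mod m"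
    using g(3) by (simp only: comp_def assms(2))
  ultimately show ?thesis
    unfolding is_cycle_def cycle_labelling_def
    by (intro exI[of _ m] exI[of _ "f \<circ> g"] conjI g(1))
qed

lemma dim_basic_isomorphic:
  fixes Q :: "'v::finite quiver" and R :: "'w::finite quiver"
  assumes "isomorphic_quivers Q R"
  shows "vec.dim (basic_radical_space Q) = vec.dim (basic_radical_space R)"
proof -
  obtain f where f: "bij f" "\<And>i j. R (f i) (f j) = Q i j"
    using assms by (auto simp: isomorphic_quivers_def)
  have inv: "inv f (f i) = i" "f (inv f j) = j" for i j
    using f(1) by (auto simp: bij_is_inj bij_is_surj surj_f_inv_f)
  have lin: "Vector_Spaces.linear (*s) (*s) (relabel f :: bit^'v \<Rightarrow> bit^'w)"
    by unfold_locales (auto simp: vec_eq_iff relabel_def)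
  have inj: "inj (relabel f :: bit^'v \<Rightarrow> bit^'w)"
    by (rule injI) (metis (no_types, lifting) inv(1) relabel_def vec_eq_iff vec_lambda_beta)
  have surj: "\<exists>u. v = relabel f u" for v :: "bit^'w"
    by (intro exI[of _ "\<chi> i. v $ f i"]) (simp add: vec_eq_iff relabel_def inv)
  have B: "quiver_matrix R (f i) (f j) = quiver_matrix Q i j" for i j
    by (simp add: quiver_matrix_def f(2))
  have all: "(\<forall>j. Pr j) \<longleftrightarrow> (\<forall>i. Pr (f i))" for Pr
    using inv(2) by metis
  have rad: "relabel f u \<in> radical_space R \<longleftrightarrow> u \<in> radical_space Q" for u :: "bit^'v"
  proof -
    let ?F = "\<lambda>i j. of_int (quiver_matrix R i j) * relabel f u $ j"
    have "(\<Sum>j\<in>UNIV. ?F (f i) (f j)) = (\<Sum>j\<in>UNIV. ?F (f i) j)" for i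
      by (rule sum.reindex_bij_betw[OF f(1)])
    then have "(\<Sum>j\<in>UNIV. ?F (f i) j) = (\<Sum>j\<in>UNIV. of_int (quiver_matrix Q i j) * u $ j)" for i
      by (simp add: B relabel_def inv)
    then show ?thesis
      unfolding radical_space_iff all[of "\<lambda>i. (\<Sum>j\<in>UNIV. ?F i j) = 0"] by simp
  qed
  have supp: "support (relabel f u) = f ` support u" for u :: "bit^'v"
  proof
    show "support (relabel f u) \<subseteq> f ` support u"
    proof
      fix j assume "j \<in> support (relabel f u)"
      then show "j \<in> f ` support u"
        by (intro image_eqI[of j f "inv f j"]) (simp_all add: support_def relabel_def inv)
    qed
    show "f ` support u \<subseteq> support (relabel f u)"
      by (auto simp: support_def relabel_def inv)
  qed
  have fi: "inj f" using f(1) by (rule bij_is_inj)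
  have adj: "adjacent R (f i) (f j) \<longleftrightarrow> adjacent Q i j" for i j by (simp add: adjacent_def f(2))
  have cyc: "is_cycle R (f ` S) \<longleftrightarrow> is_cycle Q S" for S
  proof
    assume "is_cycle R (f ` S)"
    moreover have "inj (inv f)" using f(1) by (simp add: bij_imp_bij_inv bij_is_inj)
    moreover have "adjacent Q (inv f i) (inv f j) \<longleftrightarrow> adjacent R i j" for i j
      using adj[of "inv f i" "inv f j"] by (simp add: inv)
    ultimately have "is_cycle Q (inv f ` f ` S)" using is_cycle_image by blast
    then show "is_cycle Q S" by (simp add: image_image inv)
  qed (rule is_cycle_image[OF fi adj])
  have "relabel f u \<in> basic_radical_vectors R \<longleftrightarrow> u \<in> basic_radical_vectors Q" for u :: "bit^'v"
    using rad cyc card_image[OF inj_on_subset[OF fi subset_UNIV]]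
    by (simp add: basic_radical_vectors_def supp)
  then have "basic_radical_vectors R = relabel f ` basic_radical_vectors Q"
    using surj by (metis (no_types, lifting) image_iff subsetI subset_antisym)
  then have "basic_radical_space R = relabel f ` basic_radical_space Q"
    unfolding basic_radical_space_def using vec.linear_span_image[OF lin] by metis
  then show ?thesis
    using vec.dim_image_eq[OF lin inj_on_subset[OF inj subset_UNIV]] by simp
qed

lemma dim_basic_mutation_equivalent:
  fixes Q :: "'v::finite quiver" and R :: "'w::finite quiver"
  assumes "quiver_graph Q P e" "mutation_equivalent Q R"
  shows "vec.dim (basic_radical_space Q) = vec.dim (basic_radical_space R)"
proof -
  interpret quiver_graph Q P e by (rule assms(1))
  obtain S where S: "equivclp mutation_step Q S" "isomorphic_quivers S R"
    using assms(2) by (auto simp: mutation_equivalent_def)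
  have "is_quiver S \<and> (\<exists>e. quiver_graph S P e \<and>
      vec.dim (basic_radical_space S) = vec.dim (basic_radical_space Q))"
    using S(1) is_quiver
  proof (induction rule: mutation_class_induct)
    case base
    show ?case using assms(1) by blast
  next
    case (mutate R k)
    then show ?case
      using quiver_graph.quiver_graph_mutate quiver_graph.dim_basic_mutate by metis
  qed
  then show ?thesis using dim_basic_isomorphic[OF S(2)] by metis
qed

text \<open>The mutation sequence is run backwards, from the quiver known to have a model.\<close>

lemma graph_model_mutation_equivalent:
  fixes Q :: "'v::finite quiver" and R :: "'w quiver"
  assumes "is_quiver Q" "mutation_equivalent Q R" "graph_model R P e"
  shows "\<exists>e'. graph_model Q P e'"
proof -
  obtain S f where S: "equivclp mutation_step Q S" and f: "bij f" "\<forall>i j. R (f i) (f j) = S i j"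
    using assms(2) by (auto simp: mutation_equivalent_def isomorphic_quivers_def)
  have "is_quiver S"
    using mutation_class_induct[OF S assms(1), of "\<lambda>_. True"] by simp
  moreover have "graph_model S P (e \<circ> f)" using graph_model_isomorphic f assms(3) by blast
  then have ex: "\<exists>e'. graph_model S P e'" by blast
  moreover have "equivclp mutation_step S Q" using S by (rule equivclp_sym)
  ultimately have "equivclp mutation_step S Q" "is_quiver S" by blast+
  then have "is_quiver Q \<and> (\<exists>e'. graph_model Q P e')"
  proof (induction rule: mutation_class_induct)
    case base
    show ?case by (rule ex)
  next
    case (mutate R k)
    then obtain e1 where "graph_model R P e1" by blast
    then show ?case by (intro exI) (rule graph_model_mutate)
  qed
  then show ?thesis ..
qed

section \<open>Graph models of triangulations and of the exceptional quivers\<close>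

text \<open>
  The radius of a self-folded triangle gets the same two triangles as its enclosing loop. So the
  dual graph has no loops, and the two arcs are parallel edges of it.
\<close>

definition triangles_at :: "'v triangle list \<Rightarrow> 'v \<Rightarrow> nat set" where
  "triangles_at T j = {p. p < length T \<and> fold_map T (Inl j) \<in> set (sides (T ! p))}"

lemma count_sides_concat:
  "count_list (concat (map sides T)) s = (\<Sum>p<length T. count_list (sides (T ! p)) s)"
proof -
  have "count_list (concat xss) s = sum_list (map (\<lambda>xs. count_list xs s) xss)" for xss :: "('a + nat) list list"
    by (induction xss) auto
  then show ?thesis by (simp add: sum_list_sum_nth atLeast0LessThan comp_def)
qed

text \<open>The degenerate triple with l = r is kept as a case here; it is ruled out later because
  no side occurs three times.\<close>

lemma folded_insideD:
  assumes "folded_inside T r l"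
  obtains p where "p < length T" "set (sides (T ! p)) = {r, l}"
    "count_list (sides (T ! p)) r \<ge> 2" "l \<noteq> r \<Longrightarrow> count_list (sides (T ! p)) l = 1"
    "l = r \<Longrightarrow> count_list (sides (T ! p)) r = 3"
proof -
  obtain t where t: "t \<in> set T" "t = (r, r, l) \<or> t = (r, l, r) \<or> t = (l, r, r)"
    using assms by (auto simp: folded_inside_def)
  then obtain p where "p < length T" "T ! p = t" by (auto simp: in_set_conv_nth)
  then show thesis using t(2) by (intro that[of p]) auto
qed

lemma folded_insideI:
  assumes "p < length T" "count_list (sides (T ! p)) r \<ge> 2"
  shows "\<exists>l. folded_inside T r l"
proof -
  obtain x y z where t: "T ! p = (x, y, z)" by (metis prod_cases3)
  then have "(x, y, z) \<in> set T" using assms(1) by (metis nth_mem)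
  moreover have "(x = r \<and> y = r) \<or> (x = r \<and> z = r) \<or> (y = r \<and> z = r)"
    using assms(2) by (auto simp: t split: if_splits)
  ultimately show ?thesis unfolding folded_inside_def by blast
qed

lemma follows_sides: "follows t x y \<Longrightarrow> x \<in> set (sides t) \<and> y \<in> set (sides t)"
  by (cases t) auto

lemma follows_odd:
  assumes "x \<noteq> y" "distinct (sides t)"
  shows "odd (of_bool (follows t x y) - of_bool (follows t y x) :: int) \<longleftrightarrow>
    x \<in> set (sides t) \<and> y \<in> set (sides t)"
proof -
  obtain a b c where t: "t = (a, b, c)" by (metis prod_cases3)
  have "\<not> (follows t x y \<and> follows t y x)"
    using assms unfolding t by (simp; blast)
  moreover have "x \<in> set (sides t) \<and> y \<in> set (sides t) \<longleftrightarrow> follows t x y \<or> follows t y x"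
    using assms(1) unfolding t by (simp; blast)
  ultimately show ?thesis
    by (cases "follows t x y"; cases "follows t y x") simp_all
qed

context
  fixes T :: "'v::finite triangle list" and Q :: "'v quiver"
  assumes T: "is_triangulation T" and B: "\<And>i j. quiver_matrix Q i j = signed_adjacency T i j"
begin

lemma count_arc: "(\<Sum>p<length T. count_list (sides (T ! p)) (Inl i)) = 2"
  using T by (simp add: is_triangulation_def count_sides_concat)

lemma count_boundary: "(\<Sum>p<length T. count_list (sides (T ! p)) (Inr b)) \<le> 1"
  using T by (simp add: is_triangulation_def count_sides_concat)

lemma count_le_2: "(\<Sum>p<length T. count_list (sides (T ! p)) s) \<le> 2"
proof (cases s)
  case (Inl i)
  show ?thesis unfolding Inl count_arc by simp
next
  case (Inr b)
  show ?thesis unfolding Inr using count_boundary[of b] by linarith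
qed

lemma count_at_le:
  "p < length T \<Longrightarrow> count_list (sides (T ! p)) s \<le> (\<Sum>p<length T. count_list (sides (T ! p)) s)"
  by (rule member_le_sum) auto

lemma count_two_le:
  assumes "p < length T" "q < length T" "p \<noteq> q"
  shows "count_list (sides (T ! p)) s + count_list (sides (T ! q)) s \<le> 2"
proof -
  have "(\<Sum>p\<in>{p, q}. count_list (sides (T ! p)) s) \<le> (\<Sum>p<length T. count_list (sides (T ! p)) s)"
    by (rule sum_mono2) (use assms in auto)
  then show ?thesis using assms(3) count_le_2[of s] by simp
qed

text \<open>The two occurrences of r in one self-folded triangle already exhaust those
  available.\<close>

lemma folded_inside_unique:
  assumes "folded_inside T r l" "folded_inside T r l'"
  shows "l = l'"
proof -
  obtain p where p: "p < length T" "set (sides (T ! p)) = {r, l}" "count_list (sides (T ! p)) r \<ge> 2"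
    "l = r \<Longrightarrow> count_list (sides (T ! p)) r = 3"
    using folded_insideD[OF assms(1)] by metis
  obtain q where q: "q < length T" "set (sides (T ! q)) = {r, l'}" "count_list (sides (T ! q)) r \<ge> 2"
    "l' = r \<Longrightarrow> count_list (sides (T ! q)) r = 3"
    using folded_insideD[OF assms(2)] by metis
  have "p = q" using count_two_le[of p q r] p q by fastforce
  moreover have "count_list (sides (T ! p)) r \<le> 2"
    using count_at_le[OF p(1), of r] count_le_2[of r] by simp
  ultimately have "l \<noteq> r" "l' \<noteq> r" using p(4) q(4) by auto
  then show ?thesis using p(2) q(2) \<open>p = q\<close> by (metis doubleton_eq_iff)
qed

lemma fold_map_eq:
  assumes "folded_inside T s l"
  shows "fold_map T s = l"
proof -
  have "(THE l. folded_inside T s l) = l"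
  proof (rule the_equality)
    show "folded_inside T s l" by (rule assms)
    show "l' = l" if "folded_inside T s l'" for l'
      using folded_inside_unique[OF that assms] .
  qed
  moreover have "\<exists>l. folded_inside T s l" using assms by blast
  ultimately show ?thesis by (simp add: fold_map_def)
qed

text \<open>A side repeated in a triangle is a radius and gets replaced by its loop. The loop occurs
  once in the self-folded triangle, hence at most once in any other. This keeps loops out of the
  dual graph.\<close>

lemma count_fold_map_le_1:
  assumes "q < length T"
  shows "count_list (sides (T ! q)) (fold_map T (Inl j)) \<le> 1"
proof (cases "\<exists>l. folded_inside T (Inl j) l")
  case True
  then obtain l where l: "folded_inside T (Inl j) l" by blast
  then have fold: "fold_map T (Inl j) = l" by (rule fold_map_eq)
  obtain p where p: "p < length T" "count_list (sides (T ! p)) (Inl j) \<ge> 2"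
    "l \<noteq> Inl j \<Longrightarrow> count_list (sides (T ! p)) l = 1"
    "l = Inl j \<Longrightarrow> count_list (sides (T ! p)) (Inl j) = 3"
    using folded_insideD[OF l] by metis
  have "l \<noteq> Inl j"
    using p(4) count_at_le[OF p(1), of "Inl j"] count_le_2[of "Inl j"] by fastforce
  then have "count_list (sides (T ! p)) l = 1" using p(3) by blast
  then show ?thesis
    using count_two_le[OF assms p(1), of l] unfolding fold by (cases "q = p") auto
next
  case False
  then have "\<not> 2 \<le> count_list (sides (T ! q)) (Inl j)"
    using folded_insideI[OF assms] by blast
  moreover have "fold_map T (Inl j) = Inl j" unfolding fold_map_def if_not_P[OF False] ..
  ultimately show ?thesis by simp
qed

lemma fold_map_same:
  assumes "fold_map T (Inl i) = fold_map T (Inl j)"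
  shows "quiver_matrix Q i j = 0"
  unfolding B signed_adjacency_def assms by simp

lemma triangles_at_adjacent:
  assumes "quiver_matrix Q i j \<noteq> 0"
  shows "triangles_at T i \<inter> triangles_at T j \<noteq> {}"
proof -
  let ?x = "fold_map T (Inl i)" and ?y = "fold_map T (Inl j)"
  have "\<exists>t\<in>set T. of_bool (follows t ?x ?y) - of_bool (follows t ?y ?x) \<noteq> (0 :: int)"
  proof (rule ccontr)
    assume "\<not> ?thesis"
    then have "map (\<lambda>t. of_bool (follows t ?x ?y) - of_bool (follows t ?y ?x)) (filter (\<lambda>t. \<not> self_folded t) T)
        = map (\<lambda>t. 0 :: int) (filter (\<lambda>t. \<not> self_folded t) T)"
      by (intro map_cong) auto
    then have "signed_adjacency T i j = 0"
      unfolding signed_adjacency_def by (simp only: sum_list_0)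
    then show False using assms B by simp
  qed
  then obtain t where t: "t \<in> set T" "of_bool (follows t ?x ?y) - of_bool (follows t ?y ?x) \<noteq> (0 :: int)"
    by blast
  have follows: "follows t ?x ?y \<or> follows t ?y ?x"
  proof (rule ccontr)
    assume "\<not> ?thesis"
    then show False using t(2) by simp
  qed
  obtain p where p: "p < length T" "T ! p = t" using t(1) by (auto simp: in_set_conv_nth)
  have "?x \<in> set (sides t)" "?y \<in> set (sides t)" using follows follows_sides by blast+
  then have "p \<in> triangles_at T i \<inter> triangles_at T j" using p by (simp add: triangles_at_def)
  then show ?thesis by blast
qed

text \<open>A folded side that is an arc occurs twice, but at most once per triangle. It is a
  boundary segment only for a radius as in a once-punctured monogon. Any neighbour of j would then
  fold to the same side and have entry 0, contradicting connectedness.\<close>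

lemma card_triangles_at:
  assumes "connected_quiver Q" "is_quiver Q" "CARD('v) \<ge> 3"
  shows "card (triangles_at T j) = 2"
proof -
  let ?y = "fold_map T (Inl j)"
  have "count_list (sides (T ! p)) ?y = of_bool (p \<in> triangles_at T j)" if "p < length T" for p
    using count_fold_map_le_1[OF that, of j] that count_list_0_iff[of "sides (T ! p)" ?y]
    by (cases "count_list (sides (T ! p)) ?y") (auto simp: triangles_at_def)
  then have "(\<Sum>p<length T. count_list (sides (T ! p)) ?y) = (\<Sum>p<length T. of_bool (p \<in> triangles_at T j))"
    by (intro sum.cong) auto
  also have "\<dots> = card ({..<length T} \<inter> triangles_at T j)" by simp
  also have "{..<length T} \<inter> triangles_at T j = triangles_at T j" by (auto simp: triangles_at_def)
  finally have sum: "(\<Sum>p<length T. count_list (sides (T ! p)) ?y) = card (triangles_at T j)" .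
  show ?thesis
  proof (cases ?y)
    case (Inl a)
    then show ?thesis using sum count_arc[of a] by simp
  next
    case (Inr b)
    then have 1: "card (triangles_at T j) \<le> 1" using sum count_boundary[of b] by simp
    have "folded_inside T (Inl j) ?y"
    proof (cases "\<exists>l. folded_inside T (Inl j) l")
      case True
      then obtain l where l: "folded_inside T (Inl j) l" by blast
      then show ?thesis using fold_map_eq[OF l] by simp
    next
      case False
      then show ?thesis using Inr by (simp add: fold_map_def)
    qed
    then obtain p where p: "p < length T" "set (sides (T ! p)) = {Inl j, ?y}"
      "count_list (sides (T ! p)) (Inl j) \<ge> 2"
      using folded_insideD by metis
    then have "p \<in> triangles_at T j" by (simp add: triangles_at_def)
    moreover have fin: "finite (triangles_at T j)" by (simp add: triangles_at_def)
    ultimately have tj: "{p} = triangles_at T j" using 1 by (intro card_seteq) auto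
    obtain v where "v \<noteq> j" using ex_third_vertex[OF assms(3), of j j] by blast
    then obtain i where "adjacent Q j i"
      using connected_quiver_exit[OF assms(1), of j "{j}" v] by auto
    then have nz: "quiver_matrix Q j i \<noteq> 0" using assms(2) by (simp add: adjacent_iff)
    then have "p \<in> triangles_at T i" using triangles_at_adjacent tj by fastforce
    then have "fold_map T (Inl i) \<in> {Inl j, ?y}" using p(2) by (simp add: triangles_at_def)
    moreover have "fold_map T (Inl i) \<noteq> Inl j"
    proof
      assume "fold_map T (Inl i) = Inl j"
      then show False using count_fold_map_le_1[OF p(1), of i] p(3) by simp
    qed
    ultimately have "quiver_matrix Q j i = 0" by (intro fold_map_same) simp
    then show ?thesis using nz by blast
  qed
qed

text \<open>Arcs with different images get a contribution of 1 or -1 from each common triangle; no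
  such triangle is self-folded, so the filter drops none of them. Arcs with equal images have entry
  0 and share two triangles.\<close>

lemma parity_triangles_at:
  assumes "card (triangles_at T i) = 2"
  shows "even (quiver_matrix Q i j) \<longleftrightarrow> even (card (triangles_at T i \<inter> triangles_at T j))"
proof (cases "fold_map T (Inl i) = fold_map T (Inl j)")
  case True
  then have "triangles_at T j = triangles_at T i" by (simp add: triangles_at_def)
  moreover have "quiver_matrix Q i j = 0" using True by (rule fold_map_same)
  ultimately show ?thesis using assms by simp
next
  case False
  let ?x = "fold_map T (Inl i)" and ?y = "fold_map T (Inl j)"
  define g :: "'v triangle \<Rightarrow> int" where "g t = (if \<not> self_folded t then of_bool (follows t ?x ?y) - of_bool (follows t ?y ?x) else 0)" for t
  have folded: "distinct (sides (T ! p))"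
    if "p < length T" "?x \<in> set (sides (T ! p))" "?y \<in> set (sides (T ! p))" for p
  proof -
    obtain a b c where abc: "T ! p = (a, b, c)" by (metis prod_cases3)
    show ?thesis
      using that count_fold_map_le_1[OF that(1), of i] count_fold_map_le_1[OF that(1), of j] False
      by (auto simp: abc split: if_splits)
  qed
  have g: "odd (g (T ! p)) \<longleftrightarrow> p \<in> triangles_at T i \<inter> triangles_at T j" if "p < length T" for p
  proof (cases "distinct (sides (T ! p))")
    case True
    then show ?thesis
      using follows_odd[OF False True] that by (simp add: g_def triangles_at_def self_folded_def)
  next
    case False
    then have "\<not> (?x \<in> set (sides (T ! p)) \<and> ?y \<in> set (sides (T ! p)))"
      using folded[OF that] by blast
    then show ?thesis using False that by (simp add: g_def triangles_at_def self_folded_def)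
  qed
  have "quiver_matrix Q i j = (\<Sum>t\<leftarrow>T. g t)"
    unfolding B signed_adjacency_def g_def by (rule sum_list_map_filter')
  also have "\<dots> = (\<Sum>p<length T. g (T ! p))"
    by (simp add: sum_list_sum_nth atLeast0LessThan)
  finally have "(of_int (quiver_matrix Q i j) :: bit) = (\<Sum>p<length T. of_int (g (T ! p)))" by simp
  also have "\<dots> = (\<Sum>p<length T. of_bool (p \<in> triangles_at T i \<inter> triangles_at T j))"
    by (intro sum.cong) (auto simp: of_int_bit g)
  also have "\<dots> = of_nat (card ((triangles_at T i \<inter> triangles_at T j) \<inter> {..<length T}))"
    by (rule of_nat_card_Int[symmetric]) simp
  also have "(triangles_at T i \<inter> triangles_at T j) \<inter> {..<length T} = triangles_at T i \<inter> triangles_at T j"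
    by (auto simp: triangles_at_def)
  finally show ?thesis by (simp add: bit_eq_of_int_of_nat)
qed

end

lemma graph_model_triangulation:
  fixes Q :: "'v::finite quiver"
  assumes "from_triangulation Q" "is_quiver Q" "connected_quiver Q" "CARD('v) \<ge> 3"
  shows "\<exists>(P :: nat set) e. graph_model Q P e"
proof -
  obtain T where T: "is_triangulation T" "\<And>i j. quiver_matrix Q i j = signed_adjacency T i j"
    using assms(1) by (auto simp: from_triangulation_def)
  have "graph_model Q (\<Union>i. triangles_at T i) (triangles_at T)"
    using card_triangles_at[OF T assms(3,2,4)] parity_triangles_at[OF T] triangles_at_adjacent[OF T]
    by (intro graph_model_connectedI assms(3)) (auto simp: adjacent_iff[OF assms(2)])
  then show ?thesis by blast
qed

section \<open>Graphs of the exceptional quivers\<close>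

lemma triangle_cuts:
  fixes X :: "nat set"
  assumes "X \<subseteq> {0, 1, 2}" "even (card ({0, 1} \<inter> X))" "even (card ({1, 2} \<inter> X))"
  shows "X = {} \<or> X = {0, 1, 2}"
proof -
  have "{0, 1} \<inter> X = (if 0 \<in> X then {0} else {}) \<union> (if 1 \<in> X then {1} else {})"
    "{1, 2} \<inter> X = (if 1 \<in> X then {1} else {}) \<union> (if 2 \<in> X then {2} else {})" by auto
  then have "0 \<in> X \<longleftrightarrow> 1 \<in> X" "1 \<in> X \<longleftrightarrow> 2 \<in> X"
    using assms(2,3) by (auto split: if_splits)
  then show ?thesis using assms(1) by auto
qed

text \<open>Modulo 2 the double edges vanish and only the centre is adjacent to the others. So these
  are parallel edges, each meeting the edge of the centre in one vertex.\<close>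

lemma graph_model_X6:
  "graph_model (X6 outward) {0, 1, 2 :: nat} (\<lambda>i. if i = C6 then {0, 1} else {1, 2})"
  unfolding graph_model_def
proof (intro conjI allI impI)
  show "even (quiver_matrix (X6 outward) i j) \<longleftrightarrow>
    even (card ((if i = C6 then {0, 1} else {1, 2 :: nat}) \<inter> (if j = C6 then {0, 1} else {1, 2})))" for i j
    by (cases i; cases j; simp add: quiver_matrix_def X6_def quiver_of_edges_def)
  show "X = {} \<or> X = {0, 1, 2}" if "X \<subseteq> {0, 1, 2 :: nat}"
    "\<forall>i. even (card ((if i = C6 then {0, 1} else {1, 2}) \<inter> X))" for X
    using triangle_cuts[OF that(1)] that(2)[rule_format, of C6] that(2)[rule_format, of A6] by simp
qed auto

lemma graph_model_X7:
  "graph_model X7 {0, 1, 2 :: nat} (\<lambda>i. if i = C7 then {0, 1} else {1, 2})"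
  unfolding graph_model_def
proof (intro conjI allI impI)
  show "even (quiver_matrix X7 i j) \<longleftrightarrow>
    even (card ((if i = C7 then {0, 1} else {1, 2 :: nat}) \<inter> (if j = C7 then {0, 1} else {1, 2})))" for i j
    by (cases i; cases j; simp add: quiver_matrix_def X7_def quiver_of_edges_def)
  show "X = {} \<or> X = {0, 1, 2}" if "X \<subseteq> {0, 1, 2 :: nat}"
    "\<forall>i. even (card ((if i = C7 then {0, 1} else {1, 2}) \<inter> X))" for X
    using triangle_cuts[OF that(1)] that(2)[rule_format, of C7] that(2)[rule_format, of A7] by simp
qed auto

theorem theorem1p3:
  fixes Q :: "'v::finite quiver"
  assumes "is_quiver Q"
    and "connected_quiver Q"
    and "finite_mutation_type Q"
    and "CARD('v) \<ge> 3"
  shows "(\<forall>S. double_edge Q S \<or> nonoriented_cycle Q S \<longrightarrow> indicator_vector S \<in> radical_space Q) \<and>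
    (from_triangulation Q \<or> (\<exists>outward. mutation_equivalent Q (X6 outward)) \<or>
        mutation_equivalent Q X7 \<longrightarrow>
      quotient_dim (radical_space Q) (basic_radical_space Q) \<le> 1 \<and>
      (\<forall>Q' :: 'w::finite quiver. mutation_equivalent Q Q' \<longrightarrow>
        vec.dim (basic_radical_space Q) = vec.dim (basic_radical_space Q')))"
proof (intro conjI impI)
  have Q: "mutation_finite Q" using assms by (simp add: mutation_finite_def)
  show "\<forall>S. double_edge Q S \<or> nonoriented_cycle Q S \<longrightarrow> indicator_vector S \<in> radical_space Q"
    using double_edge_or_nonoriented_cycle_radical[OF Q assms(4)] by blast
  assume "from_triangulation Q \<or> (\<exists>outward. mutation_equivalent Q (X6 outward)) \<or>
    mutation_equivalent Q X7"
  \<comment> \<open>Indices of triangles and the three points of the exceptional graphs are all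
    naturals, so the three cases share one type of model.\<close>
  then have "\<exists>(P :: nat set) e. graph_model Q P e"
    using graph_model_triangulation[OF _ assms(1,2,4)]
      graph_model_mutation_equivalent[OF assms(1) _ graph_model_X6]
      graph_model_mutation_equivalent[OF assms(1) _ graph_model_X7] by metis
  then obtain P :: "nat set" and e where "graph_model Q P e" by blast
  then have qg: "quiver_graph Q P e" using Q assms(4) by unfold_locales
  show "quotient_dim (radical_space Q) (basic_radical_space Q) \<le> 1"
    by (rule quiver_graph.quotient_dim_le_1[OF qg])
  show "\<forall>Q' :: 'w quiver. mutation_equivalent Q Q' \<longrightarrow>
      vec.dim (basic_radical_space Q) = vec.dim (basic_radical_space Q')"
    using dim_basic_mutation_equivalent[OF qg] by blast
qed

end
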